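(* Let $G$ and $H$ be graphs. Then $\xi_{\mathrm{tr}}(G*H)=\xi_{\mathrm{tr}}(G[H])=\xi_{\mathrm{tr}}(G)\,\xi_{\mathrm{tr}}(H)$, where $G*H$ is the disjunctive product (co-normal product, OR product) and $G[H]$ is the lexicographical product.
   Context: Graphs are finite, simple and undirected. The tracial rank $\xi_{\mathrm{tr}}(G)$ of $G=(V,E)$ is the reciprocal of the supremum of the set of real numbers $u$ for which there exist a unital C*-algebra $\mathcal A$, a tracial state $s$ on $\mathcal A$ (a state with $s(xy)=s(yx)$ for all $x,y$) and projections $e_v\in\mathcal A$, $v\in V$, such that $e_ve_w=0$ whenever $(v,w)\in E$ and $s(e_v)=u$ for every $v\in V$. Both $G*H$ and $G[H]$ have vertex set $V(G)\times V(H)$. In $G*H$, $(g,h)\sim(g',h')$ iff $g\sim g'$ in $G$ or $h\sim h'$ in $H$. In $G[H]$, $(g,h)\sim(g',h')$ iff $g\sim g'$ in $G$, or $g=g'$ and $h\sim h'$ in $H$. *)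

theory Defs
  imports
    "HOL-Analysis.Analysis"
    "HOL-Algebra.Module"
    "Graph_Theory.Pair_Digraph"
begin

section \<open>Unital C*-algebras\<close>

definition complex_ring :: "complex ring" where
  "complex_ring = \<lparr>carrier = UNIV, mult = (*), one = 1, zero = 0, add = (+)\<rparr>"

record 'a star_algebra = "(complex, 'a) module" +
  adj :: "'a \<Rightarrow> 'a"
  anorm :: "'a \<Rightarrow> real"

text \<open>The zero algebra is not excluded; it carries no state.\<close>

locale c_star_algebra = ring A + V: module complex_ring A for A :: "'a star_algebra" (structure) +
  assumes smult_mult_left:
      "\<lbrakk>x \<in> carrier A; y \<in> carrier A\<rbrakk> \<Longrightarrow> (c \<odot> x) \<otimes> y = c \<odot> (x \<otimes> y)"
    and smult_mult_right:
      "\<lbrakk>x \<in> carrier A; y \<in> carrier A\<rbrakk> \<Longrightarrow> x \<otimes> (c \<odot> y) = c \<odot> (x \<otimes> y)"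
    and adj_closed: "x \<in> carrier A \<Longrightarrow> adj A x \<in> carrier A"
    and adj_adj: "x \<in> carrier A \<Longrightarrow> adj A (adj A x) = x"
    and adj_add:
      "\<lbrakk>x \<in> carrier A; y \<in> carrier A\<rbrakk> \<Longrightarrow> adj A (x \<oplus> y) = adj A x \<oplus> adj A y"
    and adj_smult: "x \<in> carrier A \<Longrightarrow> adj A (c \<odot> x) = cnj c \<odot> adj A x"
    and adj_mult:
      "\<lbrakk>x \<in> carrier A; y \<in> carrier A\<rbrakk> \<Longrightarrow> adj A (x \<otimes> y) = adj A y \<otimes> adj A x"
    and anorm_nonneg: "x \<in> carrier A \<Longrightarrow> 0 \<le> anorm A x"
    and anorm_eq_0_iff: "x \<in> carrier A \<Longrightarrow> anorm A x = 0 \<longleftrightarrow> x = \<zero>"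
    and anorm_triangle:
      "\<lbrakk>x \<in> carrier A; y \<in> carrier A\<rbrakk> \<Longrightarrow> anorm A (x \<oplus> y) \<le> anorm A x + anorm A y"
    and anorm_smult: "x \<in> carrier A \<Longrightarrow> anorm A (c \<odot> x) = cmod c * anorm A x"
    and anorm_mult:
      "\<lbrakk>x \<in> carrier A; y \<in> carrier A\<rbrakk> \<Longrightarrow> anorm A (x \<otimes> y) \<le> anorm A x * anorm A y"
    and c_star_identity: "x \<in> carrier A \<Longrightarrow> anorm A (adj A x \<otimes> x) = (anorm A x)\<^sup>2"
    and anorm_complete:
      "\<lbrakk>\<And>n. \<sigma> n \<in> carrier A; \<forall>\<epsilon>>0. \<exists>N. \<forall>m\<ge>N. \<forall>n\<ge>N. anorm A (\<sigma> m \<ominus> \<sigma> n) < \<epsilon>\<rbrakk>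
        \<Longrightarrow> \<exists>x\<in>carrier A. (\<lambda>n. anorm A (\<sigma> n \<ominus> x)) \<longlonglongrightarrow> 0"

definition tracial_state :: "'a star_algebra \<Rightarrow> ('a \<Rightarrow> complex) \<Rightarrow> bool" where
  "tracial_state A s \<longleftrightarrow>
     (\<forall>x\<in>carrier A. \<forall>y\<in>carrier A. s (x \<oplus>\<^bsub>A\<^esub> y) = s x + s y) \<and>
     (\<forall>c. \<forall>x\<in>carrier A. s (c \<odot>\<^bsub>A\<^esub> x) = c * s x) \<and>
     (\<forall>x\<in>carrier A. s (adj A x \<otimes>\<^bsub>A\<^esub> x) \<in> \<real>\<^sub>\<ge>\<^sub>0) \<and>
     s \<one>\<^bsub>A\<^esub> = 1 \<and>
     (\<forall>x\<in>carrier A. \<forall>y\<in>carrier A. s (x \<otimes>\<^bsub>A\<^esub> y) = s (y \<otimes>\<^bsub>A\<^esub> x))"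

definition projection :: "'a star_algebra \<Rightarrow> 'a \<Rightarrow> bool" where
  "projection A p \<longleftrightarrow> p \<in> carrier A \<and> p \<otimes>\<^bsub>A\<^esub> p = p \<and> adj A p = p"

section \<open>The tracial rank\<close>

definition tracial_rep ::
    "'v pair_pre_digraph \<Rightarrow> real \<Rightarrow> 'a star_algebra \<Rightarrow> ('a \<Rightarrow> complex) \<Rightarrow> ('v \<Rightarrow> 'a) \<Rightarrow> bool" where
  "tracial_rep G u A s e \<longleftrightarrow>
     c_star_algebra A \<and> tracial_state A s \<and>
     (\<forall>v\<in>pverts G. projection A (e v)) \<and>
     (\<forall>(v, w)\<in>parcs G. e v \<otimes>\<^bsub>A\<^esub> e w = \<zero>\<^bsub>A\<^esub>) \<and>
     (\<forall>v\<in>pverts G. s (e v) = complex_of_real u)"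

text \<open>
  HOL cannot quantify existentially over the type of the elements of the algebra, so the
  carrier is taken to be a set of reals, which only serve as names for the elements.  This
  is no restriction: a unital C*-algebra generated by finitely many projections is separable
  and so has at most continuum many elements.  The lemma \<open>tracial_values_universal\<close> below
  proves that a representation over any type gives one over the reals.
\<close>

definition tracial_values :: "'v pair_pre_digraph \<Rightarrow> real set" where
  "tracial_values G = {u. \<exists>(A :: real star_algebra) s e. tracial_rep G u A s e}"

text \<open>
  For the graph without vertices every real number is a tracial value, so the supremum is
  \<open>\<infinity>\<close> and the rank is \<open>0\<close>; this is why the supremum is taken in the extended reals.
\<close>

definition tracial_rank :: "'v pair_pre_digraph \<Rightarrow> ereal" where
  "tracial_rank G = inverse (SUP u\<in>tracial_values G. ereal u)"

section \<open>Graph products\<close>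

definition disj_product ::
    "'v pair_pre_digraph \<Rightarrow> 'w pair_pre_digraph \<Rightarrow> ('v \<times> 'w) pair_pre_digraph" where
  "disj_product G H =
     \<lparr>pverts = pverts G \<times> pverts H,
      parcs = {((g, h), (g', h')). g \<in> pverts G \<and> h \<in> pverts H \<and> g' \<in> pverts G \<and> h' \<in> pverts H \<and>
                 ((g, g') \<in> parcs G \<or> (h, h') \<in> parcs H)}\<rparr>"

definition lex_product ::
    "'v pair_pre_digraph \<Rightarrow> 'w pair_pre_digraph \<Rightarrow> ('v \<times> 'w) pair_pre_digraph" where
  "lex_product G H =
     \<lparr>pverts = pverts G \<times> pverts H,
      parcs = {((g, h), (g', h')). g \<in> pverts G \<and> h \<in> pverts H \<and> g' \<in> pverts G \<and> h' \<in> pverts H \<and>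
                 ((g, g') \<in> parcs G \<or> g = g' \<and> (h, h') \<in> parcs H)}\<rparr>"

lemma pair_graphI:
  assumes "finite (pverts G)" "parcs G \<subseteq> pverts G \<times> pverts G"
    and "\<And>x y. (x, y) \<in> parcs G \<Longrightarrow> (y, x) \<in> parcs G"
    and "\<And>x. (x, x) \<notin> parcs G"
  shows "pair_graph G"
proof
  show "finite (parcs G)" using assms(1,2) by (meson finite_SigmaI finite_subset)
  show "symmetric (with_proj G)" using assms(3) by (auto simp: symmetric_def sym_def)
qed (use assms in auto)

lemma pair_graphD:
  assumes "pair_graph G"
  shows "finite (pverts G)" "parcs G \<subseteq> pverts G \<times> pverts G"
    and "(x, y) \<in> parcs G \<Longrightarrow> (y, x) \<in> parcs G" "(x, x) \<notin> parcs G"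
proof -
  interpret pair_graph G by fact
  show "finite (pverts G)" by (rule pair_finite_verts)
  show "parcs G \<subseteq> pverts G \<times> pverts G" by (auto dest: in_arcsD1 in_arcsD2)
  show "(x, y) \<in> parcs G \<Longrightarrow> (y, x) \<in> parcs G"
    using pair_sym_arcs by (auto simp: symmetric_def sym_def)
  show "(x, x) \<notin> parcs G" using pair_no_loops by fastforce
qed

lemma pair_graph_disj_product:
  assumes "pair_graph G" "pair_graph H"
  shows "pair_graph (disj_product G H)"
  by (rule pair_graphI)
    (use pair_graphD[OF assms(1)] pair_graphD[OF assms(2)] in \<open>auto simp: disj_product_def\<close>)

lemma pair_graph_lex_product:
  assumes "pair_graph G" "pair_graph H"
  shows "pair_graph (lex_product G H)"
  by (rule pair_graphI)
    (use pair_graphD[OF assms(1)] pair_graphD[OF assms(2)] in \<open>auto simp: lex_product_def\<close>)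

section \<open>Independence of the type of the carrier\<close>

lemma complex_ring_simps [simp]:
  "carrier complex_ring = UNIV" "mult complex_ring = (*)" "one complex_ring = 1"
  "zero complex_ring = 0" "add complex_ring = (+)"
  by (simp_all add: complex_ring_def)

lemma cring_complex_ring: "cring complex_ring"
  by (rule cringI, rule abelian_groupI, auto intro!: comm_monoidI simp: algebra_simps)
    (metis add.right_inverse)

lemma module_minus_eq:
  fixes B (structure)
  assumes "module complex_ring B" "x \<in> carrier B" "y \<in> carrier B"
  shows "x \<ominus>\<^bsub>B\<^esub> y = x \<oplus>\<^bsub>B\<^esub> (-1) \<odot>\<^bsub>B\<^esub> y"
proof -
  interpret module complex_ring B by fact
  have "(-1) \<odot> y \<oplus> y = \<zero>"
    using smult_l_distr[of "-1" 1 y] smult_one[of y] smult_l_null[of y] assms by simp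
  then have "\<ominus> y = (-1) \<odot> y"
    using assms smult_closed[of "-1" y] by (intro M.minus_equality) auto
  then show ?thesis by (simp add: a_minus_def)
qed

context c_star_algebra
begin

lemma sm [simp]: "x \<in> carrier A \<Longrightarrow> c \<odot> x \<in> carrier A"
  by (rule V.smult_closed) auto

lemma minus_eq: "\<lbrakk>x \<in> carrier A; y \<in> carrier A\<rbrakk> \<Longrightarrow> x \<ominus> y = x \<oplus> (-1) \<odot> y"
  by (rule module_minus_eq) (rule V.module_axioms)

lemma anorm_minus_self: "x \<in> carrier A \<Longrightarrow> anorm A (x \<ominus> x) = 0"
  by (simp add: anorm_eq_0_iff a_minus_def r_neg)

lemma anorm_minus_commute:
  assumes "x \<in> carrier A" "y \<in> carrier A"
  shows "anorm A (x \<ominus> y) = anorm A (y \<ominus> x)"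
proof -
  have "y \<ominus> x = (-1) \<odot> (x \<ominus> y)"
    using assms V.smult_r_distr[of "-1" x "(-1) \<odot> y"] V.smult_assoc1[of "-1" "-1" y] V.smult_one[of y]
    by (simp add: minus_eq a_comm)
  then show ?thesis using assms anorm_smult[of "x \<ominus> y" "-1"] by simp
qed

lemma minus_split:
  assumes "x \<in> carrier A" "y \<in> carrier A" "z \<in> carrier A"
  shows "x \<ominus> z = (x \<ominus> y) \<oplus> (y \<ominus> z)"
  using assms by (simp add: a_minus_def a_assoc) (metis a_inv_closed r_neg1)

lemma anorm_minus_triangle:
  assumes "x \<in> carrier A" "y \<in> carrier A" "z \<in> carrier A"
  shows "anorm A (x \<ominus> z) \<le> anorm A (x \<ominus> y) + anorm A (y \<ominus> z)"
  using assms anorm_triangle[of "x \<ominus> y" "y \<ominus> z"] minus_split[of x y z] by simp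

lemma anorm_minus_eq_0:
  assumes "x \<in> carrier A" "y \<in> carrier A" "anorm A (x \<ominus> y) = 0"
  shows "x = y"
proof -
  have "x = (x \<ominus> y) \<oplus> y" using assms by (simp add: a_minus_def a_assoc l_neg)
  also have "x \<ominus> y = \<zero>" using assms by (simp add: anorm_eq_0_iff)
  finally show ?thesis using assms by simp
qed

lemma adj_minus:
  assumes "x \<in> carrier A" "y \<in> carrier A"
  shows "adj A (x \<ominus> y) = adj A x \<ominus> adj A y"
  using assms by (simp add: minus_eq adj_add adj_smult adj_closed)

lemma anorm_adj:
  assumes x: "x \<in> carrier A"
  shows "anorm A (adj A x) = anorm A x"
proof -
  have le: "anorm A y \<le> anorm A (adj A y)" if y: "y \<in> carrier A" for y
  proof -
    have "(anorm A y)\<^sup>2 \<le> anorm A (adj A y) * anorm A y"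
      using c_star_identity[OF y] anorm_mult[of "adj A y" y] y by (simp add: adj_closed)
    then show ?thesis
      using anorm_nonneg[OF y] anorm_nonneg[OF adj_closed[OF y]]
      by (cases "anorm A y = 0") (auto simp: power2_eq_square)
  qed
  show ?thesis using le[OF x] le[OF adj_closed[OF x]] x by (simp add: adj_adj)
qed

lemma smult_minus:
  assumes "x \<in> carrier A" "y \<in> carrier A"
  shows "c \<odot> (x \<ominus> y) = c \<odot> x \<ominus> c \<odot> y"
  using assms V.smult_r_distr[of c x "(-1) \<odot> y"] V.smult_assoc1[of c "-1" y] V.smult_assoc1[of "-1" c y]
  by (simp add: minus_eq)

lemma smult_scalar_minus:
  assumes "x \<in> carrier A"
  shows "(c - d) \<odot> x = c \<odot> x \<ominus> d \<odot> x"
  using assms V.smult_l_distr[of c "-d" x] V.smult_assoc1[of "-1" d x]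
  by (simp add: minus_eq)

definition acl :: "'a set \<Rightarrow> 'a set" where
  "acl D = {x \<in> carrier A. \<forall>\<epsilon>>0. \<exists>d\<in>D. anorm A (x \<ominus> d) < \<epsilon>}"

lemma aclI:
  assumes "x \<in> carrier A" "\<And>\<epsilon>. \<epsilon> > 0 \<Longrightarrow> \<exists>d\<in>D. anorm A (x \<ominus> d) < \<epsilon>"
  shows "x \<in> acl D"
  using assms by (auto simp: acl_def)

lemma acl_incl: "D \<subseteq> carrier A \<Longrightarrow> D \<subseteq> acl D"
  by (force simp: acl_def anorm_minus_self)

lemma aclD: "x \<in> acl D \<Longrightarrow> x \<in> carrier A"
  "x \<in> acl D \<Longrightarrow> \<epsilon> > 0 \<Longrightarrow> \<exists>d\<in>D. anorm A (x \<ominus> d) < \<epsilon>"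
  by (auto simp: acl_def)

lemma acl_add:
  assumes D: "D \<subseteq> carrier A" "\<And>x y. \<lbrakk>x \<in> D; y \<in> D\<rbrakk> \<Longrightarrow> x \<oplus> y \<in> D"
    and x: "x \<in> acl D" and y: "y \<in> acl D"
  shows "x \<oplus> y \<in> acl D"
proof (rule aclI)
  show "x \<oplus> y \<in> carrier A" using aclD(1)[OF x] aclD(1)[OF y] by simp
  fix \<epsilon> :: real assume "\<epsilon> > 0"
  then obtain a b where a: "a \<in> D" "anorm A (x \<ominus> a) < \<epsilon>/2" and b: "b \<in> D" "anorm A (y \<ominus> b) < \<epsilon>/2"
    using aclD(2)[OF x, of "\<epsilon>/2"] aclD(2)[OF y, of "\<epsilon>/2"] by auto
  have c: "x \<in> carrier A" "y \<in> carrier A" "a \<in> carrier A" "b \<in> carrier A"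
    using aclD(1)[OF x] aclD(1)[OF y] a b D by auto
  have "(x \<oplus> y) \<ominus> (a \<oplus> b) = (x \<ominus> a) \<oplus> (y \<ominus> b)"
    using c by (simp add: a_minus_def minus_add a_ac add.inv_closed)
  then have "anorm A ((x \<oplus> y) \<ominus> (a \<oplus> b)) < \<epsilon>"
    using anorm_triangle[of "x \<ominus> a" "y \<ominus> b"] c a b by simp
  then show "\<exists>d\<in>D. anorm A (x \<oplus> y \<ominus> d) < \<epsilon>" using D a b by blast
qed

lemma acl_adj:
  assumes D: "D \<subseteq> carrier A" "\<And>x. x \<in> D \<Longrightarrow> adj A x \<in> D" and x: "x \<in> acl D"
  shows "adj A x \<in> acl D"
proof (rule aclI)
  show "adj A x \<in> carrier A" using aclD(1)[OF x] by (simp add: adj_closed)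
  fix \<epsilon> :: real assume "\<epsilon> > 0"
  then obtain a where a: "a \<in> D" "anorm A (x \<ominus> a) < \<epsilon>" using aclD(2)[OF x] by auto
  then have "anorm A (adj A x \<ominus> adj A a) < \<epsilon>"
    using aclD(1)[OF x] D anorm_adj[of "x \<ominus> a"] adj_minus[of x a] by auto
  then show "\<exists>d\<in>D. anorm A (adj A x \<ominus> d) < \<epsilon>" using D a by blast
qed

lemma acl_approx:
  assumes x: "x \<in> carrier A" "\<And>\<epsilon>. \<epsilon> > 0 \<Longrightarrow> \<exists>d\<in>acl D. anorm A (x \<ominus> d) < \<epsilon>" and D: "D \<subseteq> carrier A"
  shows "x \<in> acl D"
proof (rule aclI[OF x(1)])
  fix \<epsilon> :: real assume "\<epsilon> > 0"
  then obtain a where a: "a \<in> acl D" "anorm A (x \<ominus> a) < \<epsilon>/2" using x(2)[of "\<epsilon>/2"] by auto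
  obtain b where b: "b \<in> D" "anorm A (a \<ominus> b) < \<epsilon>/2" using aclD(2)[OF a(1), of "\<epsilon>/2"] \<open>\<epsilon> > 0\<close> by auto
  have "anorm A (x \<ominus> b) < \<epsilon>"
    using anorm_minus_triangle[of x a b] x(1) aclD(1)[OF a(1)] a b D by auto
  then show "\<exists>d\<in>D. anorm A (x \<ominus> d) < \<epsilon>" using b by blast
qed

lemma acl_smult:
  assumes D: "D \<subseteq> carrier A" "\<And>c x. \<lbrakk>c \<in> Q; x \<in> D\<rbrakk> \<Longrightarrow> c \<odot> x \<in> D"
    and Q: "\<And>(c::complex) \<epsilon>. \<epsilon> > 0 \<Longrightarrow> \<exists>q\<in>Q. cmod (c - q) < \<epsilon>" and x: "x \<in> acl D"
  shows "c \<odot> x \<in> acl D"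
proof -
  have step: "c \<odot> d \<in> acl D" if d: "d \<in> D" for d
  proof (rule aclI)
    have dc: "d \<in> carrier A" using d D by auto
    then show "c \<odot> d \<in> carrier A" by simp
    fix \<epsilon> :: real assume e: "\<epsilon> > 0"
    have n: "anorm A d \<ge> 0" using anorm_nonneg dc by auto
    obtain q where q: "q \<in> Q" "cmod (c - q) < \<epsilon> / (anorm A d + 1)"
      using Q[of "\<epsilon> / (anorm A d + 1)"] e n by (metis add_nonneg_pos divide_pos_pos zero_less_one)
    have "anorm A (c \<odot> d \<ominus> q \<odot> d) = cmod (c - q) * anorm A d"
      using dc by (simp flip: smult_scalar_minus add: anorm_smult)
    also have "\<dots> \<le> cmod (c - q) * (anorm A d + 1)" by (simp add: mult_left_mono)
    also have "\<dots> < \<epsilon>" using q n by (simp add: pos_less_divide_eq)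
    finally show "\<exists>y\<in>D. anorm A (c \<odot> d \<ominus> y) < \<epsilon>" using D q d by blast
  qed
  show ?thesis
  proof (rule acl_approx[OF _ _ D(1)])
    show "c \<odot> x \<in> carrier A" using aclD(1)[OF x] by simp
    fix \<epsilon> :: real assume e: "\<epsilon> > 0"
    have "\<epsilon> / (cmod c + 1) > 0" using e by (simp add: add_nonneg_pos)
    then obtain d where d: "d \<in> D" "anorm A (x \<ominus> d) < \<epsilon> / (cmod c + 1)" using aclD(2)[OF x] by blast
    have c: "x \<in> carrier A" "d \<in> carrier A" using aclD(1)[OF x] d D by auto
    have "anorm A (c \<odot> x \<ominus> c \<odot> d) = cmod c * anorm A (x \<ominus> d)"
      using c by (simp flip: smult_minus add: anorm_smult)
    also have "\<dots> \<le> (cmod c + 1) * anorm A (x \<ominus> d)"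
      using c anorm_nonneg[of "x \<ominus> d"] by (simp add: mult_right_mono)
    also have "\<dots> < \<epsilon>" using d by (simp add: pos_less_divide_eq add_nonneg_pos mult.commute)
    finally show "\<exists>y\<in>acl D. anorm A (c \<odot> x \<ominus> y) < \<epsilon>" using step d by blast
  qed
qed

lemma acl_mult:
  assumes D: "D \<subseteq> carrier A" "\<And>x y. \<lbrakk>x \<in> D; y \<in> D\<rbrakk> \<Longrightarrow> x \<otimes> y \<in> D"
    and x: "x \<in> acl D" and y: "y \<in> acl D"
  shows "x \<otimes> y \<in> acl D"
proof -
  have step: "d \<otimes> y \<in> acl D" if d: "d \<in> D" for d
  proof (rule aclI)
    have dc: "d \<in> carrier A" using d D by auto
    then show "d \<otimes> y \<in> carrier A" using aclD(1)[OF y] by simp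
    fix \<epsilon> :: real assume e: "\<epsilon> > 0"
    have n: "anorm A d \<ge> 0" using anorm_nonneg dc by auto
    obtain q where q: "q \<in> D" "anorm A (y \<ominus> q) < \<epsilon> / (anorm A d + 1)"
      using aclD(2)[OF y, of "\<epsilon> / (anorm A d + 1)"] e n by (auto simp: add_nonneg_pos)
    have c: "y \<in> carrier A" "q \<in> carrier A" using aclD(1)[OF y] q D by auto
    have "d \<otimes> y \<ominus> d \<otimes> q = d \<otimes> (y \<ominus> q)"
      using c dc by (simp add: a_minus_def r_distr r_minus)
    then have "anorm A (d \<otimes> y \<ominus> d \<otimes> q) \<le> anorm A d * anorm A (y \<ominus> q)"
      using anorm_mult[of d "y \<ominus> q"] c dc by simp
    also have "\<dots> \<le> (anorm A d + 1) * anorm A (y \<ominus> q)"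
      using c anorm_nonneg[of "y \<ominus> q"] by (simp add: mult_right_mono)
    also have "\<dots> < \<epsilon>" using q n by (simp add: pos_less_divide_eq mult.commute)
    finally show "\<exists>z\<in>D. anorm A (d \<otimes> y \<ominus> z) < \<epsilon>" using D q d by blast
  qed
  show ?thesis
  proof (rule acl_approx[OF _ _ D(1)])
    have yc: "y \<in> carrier A" using aclD(1)[OF y] .
    show "x \<otimes> y \<in> carrier A" using aclD(1)[OF x] yc by simp
    fix \<epsilon> :: real assume e: "\<epsilon> > 0"
    have n: "anorm A y \<ge> 0" using anorm_nonneg yc by auto
    obtain d where d: "d \<in> D" "anorm A (x \<ominus> d) < \<epsilon> / (anorm A y + 1)"
      using aclD(2)[OF x, of "\<epsilon> / (anorm A y + 1)"] e n by (auto simp: add_nonneg_pos)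
    have c: "x \<in> carrier A" "d \<in> carrier A" using aclD(1)[OF x] d D by auto
    have "x \<otimes> y \<ominus> d \<otimes> y = (x \<ominus> d) \<otimes> y"
      using c yc by (simp add: a_minus_def l_distr l_minus)
    then have "anorm A (x \<otimes> y \<ominus> d \<otimes> y) \<le> anorm A (x \<ominus> d) * anorm A y"
      using anorm_mult[of "x \<ominus> d" y] c yc by simp
    also have "\<dots> \<le> anorm A (x \<ominus> d) * (anorm A y + 1)"
      using c anorm_nonneg[of "x \<ominus> d"] by (simp add: mult_left_mono)
    also have "\<dots> < \<epsilon>" using d n by (simp add: pos_less_divide_eq)
    finally show "\<exists>z\<in>acl D. anorm A (x \<otimes> y \<ominus> z) < \<epsilon>" using step d by blast
  qed
qed

lemma acl_lepoll_reals:
  assumes D: "D \<subseteq> carrier A" "countable D"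
  shows "\<exists>f :: 'a \<Rightarrow> real. inj_on f (acl D)"
proof -
  define \<phi> where
    "\<phi> x = {prod_encode (n, to_nat_on D d) | n d. d \<in> D \<and> anorm A (x \<ominus> d) < 1 / real (Suc n)}" for x
  have mem: "prod_encode (n, to_nat_on D d) \<in> \<phi> x \<longleftrightarrow> anorm A (x \<ominus> d) < 1 / real (Suc n)"
    if "d \<in> D" for n d x
    using that D(2) inj_on_to_nat_on[OF D(2)] by (auto simp: \<phi>_def inj_on_def)
  have inj: "inj_on \<phi> (acl D)"
  proof
    fix x y assume x: "x \<in> acl D" and y: "y \<in> acl D" and eq: "\<phi> x = \<phi> y"
    note c = aclD(1)[OF x] aclD(1)[OF y]
    have "anorm A (x \<ominus> y) \<le> \<epsilon>" if e: "\<epsilon> > 0" for \<epsilon> :: real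
    proof -
      obtain n where n: "1 / real (Suc n) < \<epsilon> / 2" using nat_approx_posE[of "\<epsilon>/2"] e by auto
      obtain d where d: "d \<in> D" "anorm A (x \<ominus> d) < 1 / real (Suc n)"
        using aclD(2)[OF x, of "1 / real (Suc n)"] by auto
      have "anorm A (y \<ominus> d) < 1 / real (Suc n)" using mem[OF d(1)] d(2) eq by blast
      then show ?thesis
        using anorm_minus_triangle[of x d y] anorm_minus_commute[of y d] c d D n by auto
    qed
    then have "anorm A (x \<ominus> y) \<le> 0" by (metis dense_ge)
    then show "x = y" using anorm_nonneg[of "x \<ominus> y"] anorm_minus_eq_0[of x y] c by simp
  qed
  obtain h :: "nat set \<Rightarrow> real" where h: "inj h"
    using nat_sets_eqpoll_reals by (auto simp: eqpoll_def bij_betw_def)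
  have "inj_on (h \<circ> \<phi>) (acl D)" using inj h by (intro comp_inj_on) (auto intro: inj_on_subset)
  then show ?thesis by blast
qed

primrec gen :: "complex set \<Rightarrow> 'a set \<Rightarrow> nat \<Rightarrow> 'a set" where
  "gen Q F 0 = insert \<one> F"
| "gen Q F (Suc n) = gen Q F n \<union> (\<lambda>(x, y). x \<oplus> y) ` (gen Q F n \<times> gen Q F n)
     \<union> (\<lambda>(x, y). x \<otimes> y) ` (gen Q F n \<times> gen Q F n)
     \<union> (\<lambda>(c, x). c \<odot> x) ` (Q \<times> gen Q F n) \<union> adj A ` gen Q F n"

lemma gen_closed: "F \<subseteq> carrier A \<Longrightarrow> gen Q F n \<subseteq> carrier A"
  by (induction n) (auto simp: adj_closed)

lemma gen_countable: "countable Q \<Longrightarrow> countable F \<Longrightarrow> countable (gen Q F n)"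
  by (induction n) auto

lemma gen_mono: "m \<le> n \<Longrightarrow> gen Q F m \<subseteq> gen Q F n"
  by (rule lift_Suc_mono_le) auto

lemma ex_countable_star_subring:
  fixes Q :: "complex set"
  assumes F: "F \<subseteq> carrier A" "countable F" and Q: "countable Q"
  shows "\<exists>D. D \<subseteq> carrier A \<and> countable D \<and> F \<subseteq> D \<and> \<one> \<in> D \<and>
     (\<forall>x\<in>D. \<forall>y\<in>D. x \<oplus> y \<in> D \<and> x \<otimes> y \<in> D) \<and> (\<forall>c\<in>Q. \<forall>x\<in>D. c \<odot> x \<in> D) \<and> (\<forall>x\<in>D. adj A x \<in> D)"
proof (intro exI conjI ballI)
  let ?D = "\<Union>n. gen Q F n"
  show "?D \<subseteq> carrier A" using gen_closed[OF F(1)] by auto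
  show "countable ?D" using gen_countable[OF Q F(2)] by auto
  have "insert \<one> F \<subseteq> ?D" using UN_upper[of 0 UNIV "gen Q F"] by simp
  then show "F \<subseteq> ?D" "\<one> \<in> ?D" by auto
  fix x assume "x \<in> ?D"
  then obtain m where m: "x \<in> gen Q F m" by auto
  have "adj A x \<in> gen Q F (Suc m)" using m by auto
  then show "adj A x \<in> ?D" by blast
  { fix c assume "c \<in> Q"
    then have "c \<odot> x \<in> gen Q F (Suc m)" using m by force
    then show "c \<odot> x \<in> ?D" by blast }
  { fix y assume "y \<in> ?D"
    then obtain k where k: "y \<in> gen Q F k" by auto
    have *: "x \<in> gen Q F (max m k)" "y \<in> gen Q F (max m k)"
      using m k gen_mono[of m "max m k" Q F] gen_mono[of k "max m k" Q F] by auto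
    have "x \<oplus> y \<in> gen Q F (Suc (max m k))" "x \<otimes> y \<in> gen Q F (Suc (max m k))" using * by force+
    then show "x \<oplus> y \<in> ?D" "x \<otimes> y \<in> ?D" by blast+ }
qed

text \<open>Restriction to a closed unital *-subalgebra \<open>K\<close>, transported along an injection \<open>f\<close>.\<close>

definition transp :: "'a set \<Rightarrow> ('a \<Rightarrow> 'b) \<Rightarrow> 'b star_algebra" where
  "transp K f = (let g = inv_into K f in
     \<lparr>carrier = f ` K, mult = (\<lambda>a b. f (g a \<otimes> g b)), one = f \<one>, zero = f \<zero>,
      add = (\<lambda>a b. f (g a \<oplus> g b)), smult = (\<lambda>c a. f (c \<odot> g a)),
      adj = (\<lambda>a. f (adj A (g a))), anorm = (\<lambda>a. anorm A (g a))\<rparr>)"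

context
  fixes K :: "'a set" and f :: "'a \<Rightarrow> 'b"
  assumes inj: "inj_on f K" and KA: "K \<subseteq> carrier A"
    and K1: "\<one> \<in> K"
    and Kadd: "\<And>x y. \<lbrakk>x \<in> K; y \<in> K\<rbrakk> \<Longrightarrow> x \<oplus> y \<in> K"
    and Kmult: "\<And>x y. \<lbrakk>x \<in> K; y \<in> K\<rbrakk> \<Longrightarrow> x \<otimes> y \<in> K"
    and Ksm: "\<And>c x. x \<in> K \<Longrightarrow> c \<odot> x \<in> K"
    and Kadj: "\<And>x. x \<in> K \<Longrightarrow> adj A x \<in> K"
    and Kcl: "\<And>x. \<lbrakk>x \<in> carrier A; \<And>\<epsilon>. \<epsilon> > 0 \<Longrightarrow> \<exists>d\<in>K. anorm A (x \<ominus> d) < \<epsilon>\<rbrakk> \<Longrightarrow> x \<in> K"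
begin

lemma KA': "x \<in> K \<Longrightarrow> x \<in> carrier A" using KA by auto

lemma K0: "\<zero> \<in> K"
  using Ksm[OF K1, of 0] V.smult_l_null[of \<one>] by simp

lemma g_f [simp]: "x \<in> K \<Longrightarrow> inv_into K f (f x) = x"
  by (rule inv_into_f_f[OF inj])

lemma transp_simps [simp]:
  "carrier (transp K f) = f ` K" "one (transp K f) = f \<one>" "zero (transp K f) = f \<zero>"
  "\<lbrakk>x \<in> K; y \<in> K\<rbrakk> \<Longrightarrow> f x \<otimes>\<^bsub>transp K f\<^esub> f y = f (x \<otimes> y)"
  "\<lbrakk>x \<in> K; y \<in> K\<rbrakk> \<Longrightarrow> f x \<oplus>\<^bsub>transp K f\<^esub> f y = f (x \<oplus> y)"
  "x \<in> K \<Longrightarrow> c \<odot>\<^bsub>transp K f\<^esub> f x = f (c \<odot> x)"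
  "x \<in> K \<Longrightarrow> adj (transp K f) (f x) = f (adj A x)"
  "x \<in> K \<Longrightarrow> anorm (transp K f) (f x) = anorm A x"
  by (simp_all add: transp_def Let_def)

lemma transp_ring: "ring (transp K f)"
proof (rule ringI)
  have neg: "\<exists>y\<in>K. y \<oplus> x = \<zero>" if "x \<in> K" for x
    using that KA' Ksm[of x "-1"] minus_eq[of x x] by (intro bexI[of _ "(-1) \<odot> x"])
      (auto simp: a_comm r_neg a_minus_def)
  show "abelian_group (transp K f)"
    by (rule abelian_groupI) (use neg in \<open>auto simp: Kadd K0 KA' a_ac\<close>, (metis transp_simps(5))?)
  show "monoid (transp K f)"
    by (rule monoidI) (auto simp: Kmult K1 KA' m_assoc)
qed (auto simp: Kadd Kmult KA' l_distr r_distr)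

lemma transp_module: "module complex_ring (transp K f)"
proof (rule moduleI)
  show "cring complex_ring" by (rule cring_complex_ring)
  show "abelian_group (transp K f)" using transp_ring by (rule ring.is_abelian_group)
qed (use V.smult_l_distr V.smult_r_distr V.smult_assoc1 V.smult_one in \<open>auto simp: Ksm Kadd KA'\<close>)

lemma transp_minus:
  assumes "x \<in> K" "y \<in> K"
  shows "f x \<ominus>\<^bsub>transp K f\<^esub> f y = f (x \<ominus> y)"
  using assms by (simp add: module_minus_eq[OF transp_module] minus_eq Ksm KA')

lemma K_minus: "x \<in> K \<Longrightarrow> y \<in> K \<Longrightarrow> x \<ominus> y \<in> K"
  by (simp add: minus_eq Kadd Ksm KA')

lemma transp_c_star: "c_star_algebra (transp K f)"
proof (intro c_star_algebra.intro c_star_algebra_axioms.intro transp_ring transp_module)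
  fix \<sigma> :: "nat \<Rightarrow> 'b"
  assume \<sigma>: "\<And>n. \<sigma> n \<in> carrier (transp K f)"
    and cau: "\<forall>\<epsilon>>0. \<exists>N. \<forall>m\<ge>N. \<forall>n\<ge>N. anorm (transp K f) (\<sigma> m \<ominus>\<^bsub>transp K f\<^esub> \<sigma> n) < \<epsilon>"
  have "\<exists>x. x \<in> K \<and> \<sigma> n = f x" for n using \<sigma>[of n] by auto
  then obtain \<tau> where t: "\<And>n. \<tau> n \<in> K" and st: "\<And>n. \<sigma> n = f (\<tau> n)" by metis
  have "\<forall>\<epsilon>>0. \<exists>N. \<forall>m\<ge>N. \<forall>n\<ge>N. anorm A (\<tau> m \<ominus> \<tau> n) < \<epsilon>"
    using cau by (simp add: st t transp_minus K_minus)
  then obtain x where x: "x \<in> carrier A" and lim: "(\<lambda>n. anorm A (\<tau> n \<ominus> x)) \<longlonglongrightarrow> 0"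
    using anorm_complete[of \<tau>] KA'[OF t] by auto
  have xK: "x \<in> K"
  proof (rule Kcl[OF x])
    fix \<epsilon> :: real assume "\<epsilon> > 0"
    then have "\<forall>\<^sub>F n in sequentially. anorm A (\<tau> n \<ominus> x) < \<epsilon>"
      by (rule order_tendstoD(2)[OF lim])
    then obtain n where "anorm A (\<tau> n \<ominus> x) < \<epsilon>"
      using eventually_happens by force
    then show "\<exists>d\<in>K. anorm A (x \<ominus> d) < \<epsilon>"
      using t[of n] anorm_minus_commute[OF x KA'[OF t[of n]]] by (intro bexI[of _ "\<tau> n"]) simp_all
  qed
  show "\<exists>x\<in>carrier (transp K f). (\<lambda>n. anorm (transp K f) (\<sigma> n \<ominus>\<^bsub>transp K f\<^esub> x)) \<longlonglongrightarrow> 0"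
    using lim xK by (auto simp: st t transp_minus K_minus intro!: bexI[of _ x])
next
  fix x assume "x \<in> carrier (transp K f)"
  then show "(anorm (transp K f) x = 0) = (x = \<zero>\<^bsub>transp K f\<^esub>)"
    using inj K0 by (auto simp: anorm_eq_0_iff KA' inj_on_eq_iff)
qed (auto simp: Kadd Kmult Ksm Kadj KA' smult_mult_left smult_mult_right adj_adj adj_add adj_smult
      adj_mult anorm_nonneg anorm_triangle anorm_smult anorm_mult c_star_identity)

lemma transp_tracial_state:
  assumes "tracial_state A s"
  shows "tracial_state (transp K f) (s \<circ> inv_into K f)"
  unfolding tracial_state_def
proof (intro conjI)
  show "\<forall>x\<in>carrier (transp K f). (s \<circ> inv_into K f) (adj (transp K f) x \<otimes>\<^bsub>transp K f\<^esub> x) \<in> \<real>\<^sub>\<ge>\<^sub>0"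
  proof
    fix a assume "a \<in> carrier (transp K f)"
    then obtain x where x: "x \<in> K" "a = f x" by auto
    have "s (adj A x \<otimes> x) \<in> \<real>\<^sub>\<ge>\<^sub>0" using assms KA'[OF x(1)] by (simp add: tracial_state_def)
    then show "(s \<circ> inv_into K f) (adj (transp K f) a \<otimes>\<^bsub>transp K f\<^esub> a) \<in> \<real>\<^sub>\<ge>\<^sub>0"
      using x by (simp add: Kmult Kadj)
  qed
  have "s (x \<otimes> y) = s (y \<otimes> x)" if "x \<in> K" "y \<in> K" for x y
    using assms KA'[OF that(1)] KA'[OF that(2)] by (simp add: tracial_state_def)
  then show "\<forall>x\<in>carrier (transp K f). \<forall>y\<in>carrier (transp K f).
      (s \<circ> inv_into K f) (x \<otimes>\<^bsub>transp K f\<^esub> y) = (s \<circ> inv_into K f) (y \<otimes>\<^bsub>transp K f\<^esub> x)"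
    by (simp add: Kmult)
qed (use assms in \<open>simp_all add: tracial_state_def Kadd Ksm K1 KA'\<close>)

end

end

theorem tracial_values_universal:
  fixes G :: "'v pair_pre_digraph" and A :: "'a star_algebra"
  assumes fin: "finite (pverts G)" and wf: "parcs G \<subseteq> pverts G \<times> pverts G"
    and rep: "tracial_rep G u A s e"
  shows "u \<in> tracial_values G"
proof -
  interpret c_star_algebra A using rep by (simp add: tracial_rep_def)
  have proj: "projection A (e v)" if "v \<in> pverts G" for v using rep that by (simp add: tracial_rep_def)
  obtain Q :: "complex set" where Q: "countable Q"
    and dense: "\<And>X. open X \<Longrightarrow> X \<noteq> {} \<Longrightarrow> \<exists>q\<in>Q. q \<in> X"
    using countable_dense_setE by metis
  have Qd: "\<exists>q\<in>Q. cmod (c - q) < \<epsilon>" if "\<epsilon> > 0" for c \<epsilon>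
    using dense[of "ball c \<epsilon>"] that by (auto simp: dist_norm)
  have "e ` pverts G \<subseteq> carrier A" using proj by (auto simp: projection_def)
  then obtain D where D: "D \<subseteq> carrier A" "countable D" "e ` pverts G \<subseteq> D" "\<one>\<^bsub>A\<^esub> \<in> D"
    and ops: "\<And>x y. \<lbrakk>x \<in> D; y \<in> D\<rbrakk> \<Longrightarrow> x \<oplus>\<^bsub>A\<^esub> y \<in> D" "\<And>x y. \<lbrakk>x \<in> D; y \<in> D\<rbrakk> \<Longrightarrow> x \<otimes>\<^bsub>A\<^esub> y \<in> D"
      "\<And>c x. \<lbrakk>c \<in> Q; x \<in> D\<rbrakk> \<Longrightarrow> c \<odot>\<^bsub>A\<^esub> x \<in> D" "\<And>x. x \<in> D \<Longrightarrow> adj A x \<in> D"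
  proof -
    have "countable (e ` pverts G)" using fin by (simp add: countable_finite)
    from ex_countable_star_subring[OF \<open>e ` pverts G \<subseteq> carrier A\<close> this Q]
    show ?thesis using that by metis
  qed
  obtain f :: "'a \<Rightarrow> real" where f: "inj_on f (acl D)" using acl_lepoll_reals[OF D(1,2)] by blast
  let ?K = "acl D"
  have KA: "?K \<subseteq> carrier A" using aclD(1) by blast
  have K1: "\<one>\<^bsub>A\<^esub> \<in> ?K" using D acl_incl by blast
  have Kadd: "\<And>x y. \<lbrakk>x \<in> ?K; y \<in> ?K\<rbrakk> \<Longrightarrow> x \<oplus>\<^bsub>A\<^esub> y \<in> ?K"
    by (rule acl_add[OF D(1) ops(1)])
  have Kmult: "\<And>x y. \<lbrakk>x \<in> ?K; y \<in> ?K\<rbrakk> \<Longrightarrow> x \<otimes>\<^bsub>A\<^esub> y \<in> ?K"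
    by (rule acl_mult[OF D(1) ops(2)])
  have Ksm: "\<And>c x. x \<in> ?K \<Longrightarrow> c \<odot>\<^bsub>A\<^esub> x \<in> ?K"
    by (rule acl_smult[OF D(1) ops(3) Qd])
  have Kadj: "\<And>x. x \<in> ?K \<Longrightarrow> adj A x \<in> ?K"
    by (rule acl_adj[OF D(1) ops(4)])
  have Kcl: "\<And>x. \<lbrakk>x \<in> carrier A; \<And>\<epsilon>. \<epsilon> > 0 \<Longrightarrow> \<exists>d\<in>?K. anorm A (x \<ominus>\<^bsub>A\<^esub> d) < \<epsilon>\<rbrakk> \<Longrightarrow> x \<in> ?K"
    by (rule acl_approx[OF _ _ D(1)])
  have eK: "e v \<in> ?K" if "v \<in> pverts G" for v using that D acl_incl by blast
  have cs: "c_star_algebra (transp ?K f)"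
    by (rule transp_c_star) (fact f KA K1 Kadd Kmult Ksm Kadj Kcl)+
  have tsA: "tracial_state A s" using rep by (simp add: tracial_rep_def)
  have ts: "tracial_state (transp ?K f) (s \<circ> inv_into ?K f)"
    by (rule transp_tracial_state) (fact tsA f KA K1 Kadd Kmult Ksm Kadj Kcl)+
  have mul: "f x \<otimes>\<^bsub>transp ?K f\<^esub> f y = f (x \<otimes>\<^bsub>A\<^esub> y)" if "x \<in> ?K" "y \<in> ?K" for x y
    using that f by (simp add: transp_def Let_def)
  have ad: "adj (transp ?K f) (f x) = f (adj A x)" if "x \<in> ?K" for x
    using that f by (simp add: transp_def Let_def)
  have [simp]: "carrier (transp ?K f) = f ` ?K" "\<zero>\<^bsub>transp ?K f\<^esub> = f \<zero>\<^bsub>A\<^esub>"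
    by (simp_all add: transp_def Let_def)
  have "tracial_rep G u (transp ?K f) (s \<circ> inv_into ?K f) (f \<circ> e)"
    unfolding tracial_rep_def
  proof (intro conjI cs ts)
    show "\<forall>v\<in>pverts G. projection (transp ?K f) ((f \<circ> e) v)"
      using proj eK by (auto simp: projection_def mul ad)
    have "(f \<circ> e) v \<otimes>\<^bsub>transp ?K f\<^esub> (f \<circ> e) w = \<zero>\<^bsub>transp ?K f\<^esub>" if vw: "(v, w) \<in> parcs G" for v w
    proof -
      have "v \<in> pverts G" "w \<in> pverts G" using wf vw by auto
      moreover have "e v \<otimes>\<^bsub>A\<^esub> e w = \<zero>\<^bsub>A\<^esub>" using rep vw by (auto simp: tracial_rep_def)
      ultimately show ?thesis by (simp add: mul eK)
    qed
    then show "\<forall>(v, w)\<in>parcs G. (f \<circ> e) v \<otimes>\<^bsub>transp ?K f\<^esub> (f \<circ> e) w = \<zero>\<^bsub>transp ?K f\<^esub>" by auto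
    show "\<forall>v\<in>pverts G. (s \<circ> inv_into ?K f) ((f \<circ> e) v) = complex_of_real u"
      using rep eK f by (auto simp: tracial_rep_def)
  qed
  then show ?thesis by (auto simp: tracial_values_def)
qed

end

theory Submission
  imports Defs "HOL-Library.Poly_Mapping"
begin

text \<open>
  A tracial value of a graph is determined by the \<^emph>\<open>moments\<close> of a representation, the numbers
  \<open>\<phi> [v\<^sub>1, \<dots>, v\<^sub>k] = s (e\<^sub>v\<^sub>1 \<cdots> e\<^sub>v\<^sub>k)\<close>.  Four kinds of condition characterize the functions \<open>\<phi>\<close> on words that
  arise in this way: normalization, invariance under cyclic rotation, the relations of the
  projections (\<open>vv\<close> may be replaced by \<open>v\<close>, and words containing an edge vanish), and
  positive semidefiniteness of the kernels \<open>\<phi> (rev x @ y)\<close>.  Necessity is a computation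
  (\<open>moments_of_tracial_values\<close>).  For sufficiency, \<open>\<phi>\<close> extends to a positive trace on the free
  star-algebra on the vertices; left multiplication on the resulting pre-Hilbert space is bounded,
  so the operator norm is a C*-seminorm, and the completion is a C*-algebra to which the trace
  extends (\<open>tracial_values_of_moments\<close>).

  With \<open>\<tau>\<close> the supremum of the tracial values, it has to be shown that
  \<open>\<tau> G * \<tau> H \<le> \<tau> (disj_product G H) \<le> \<tau> (lex_product G H) \<le> \<tau> G * \<tau> H\<close>.

  The first inequality is the tensor product of two representations, which on moments is the
  product \<open>\<phi> (map fst w) * \<psi> (map snd w)\<close>; its positivity is the Schur product theorem
  (\<open>psd_kernel_schur\<close>).  The second one holds because the lexicographical product has fewer edges.

  For the third, let projections \<open>e\<^sub>g\<^sub>h\<close> of trace \<open>u > 0\<close> represent the lexicographical product, and let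
  \<open>p\<^sub>g\<close> be the join of the \<open>e\<^sub>g\<^sub>h\<close> over all \<open>h\<close>.  Adjacent \<open>g\<close>, \<open>g'\<close> have orthogonal joins, and cutting down to
  the corner of \<open>p\<^sub>g\<close> and normalizing the trace gives a representation of \<open>H\<close> with value \<open>u / s p\<^sub>g\<close>.
  Hence \<open>u / s p\<^sub>g \<le> \<tau> H\<close>, that is \<open>s p\<^sub>g \<ge> u / \<tau> H\<close> for every \<open>g\<close>.  The \<open>p\<^sub>g\<close> may have different traces, but
  replacing \<open>p\<^sub>g\<close> by \<open>0\<close> with a suitable probability lowers all of them to exactly \<open>u / \<tau> H\<close>
  (\<open>thin_moments\<close>), which gives \<open>u / \<tau> H \<le> \<tau> G\<close>.

  The join lives in a von Neumann algebra, but only its moments are required.  If \<open>b\<close> is the mean of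
  the complements \<open>1 - e\<^sub>g\<^sub>h\<close>, then \<open>p\<^sub>g\<close> is the limit of \<open>1 - b\<^sup>n\<close>.  The traces of \<open>b\<^sup>n\<close> decrease, which makes
  these powers a Cauchy sequence in the 2-norm, and products of contractions that converge in the
  2-norm have convergent traces (\<open>limit_moments\<close>).  So the moments of the joins (\<open>join_moments\<close>) and of
  the corners (\<open>corner_moments\<close>) are limits of traces in the free algebra.
\<close>

section \<open>Completing a C*-seminorm\<close>

text \<open>
  Complex star-algebras on a whole type.  The scalars enter as a central ring homomorphism \<open>sc\<close> into
  the algebra, so that scalar multiplication is ring multiplication and ring simplification applies.
\<close>
locale star_ring =
  fixes sc :: "complex \<Rightarrow> 'a::ring_1" and star :: "'a \<Rightarrow> 'a"
  assumes sc_add: "sc (c + d) = sc c + sc d"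
    and sc_mult: "sc (c * d) = sc c * sc d"
    and sc_1 [simp]: "sc 1 = 1"
    and sc_comm: "x * sc c = sc c * x"
    and star_add: "star (x + y) = star x + star y"
    and star_mult: "star (x * y) = star y * star x"
    and star_star [simp]: "star (star x) = x"
    and star_sc [simp]: "star (sc c) = sc (cnj c)"
begin

lemma sc_0 [simp]: "sc 0 = 0"
  using sc_add[of 0 0] by simp

lemma sc_minus: "sc (- c) = - sc c"
  using sc_add[of c "- c"] by (simp add: eq_neg_iff_add_eq_0 add.commute)

lemma sc_left_commute: "x * (sc c * y) = sc c * (x * y)"
  by (metis mult.assoc sc_comm)

lemma star_sc_mult: "star (sc c * x) = sc (cnj c) * star x"
  by (simp only: star_mult star_sc sc_comm)

lemma star_0 [simp]: "star 0 = 0"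
  using star_add[of 0 0] by simp

lemma star_1 [simp]: "star 1 = 1"
  using star_sc[of 1] by simp

lemma star_minus [simp]: "star (- x) = - star x"
  using star_add[of x "- x"] by (simp add: eq_neg_iff_add_eq_0 add.commute)

lemma star_diff: "star (x - y) = star x - star y"
  using star_add[of x "- y"] by simp

lemma star_sum: "star (sum f I) = (\<Sum>i\<in>I. star (f i))"
  by (induction I rule: infinite_finite_induct) (simp_all add: star_add)

lemma star_power: "star (x ^ n) = star x ^ n"
  by (induction n) (simp_all add: star_mult power_commutes)

end

locale c_star_seminorm = star_ring sc star
  for sc :: "complex \<Rightarrow> 'a::ring_1" and star +
  fixes N :: "'a \<Rightarrow> real"
  assumes N_nonneg: "0 \<le> N x"
    and N_add: "N (x + y) \<le> N x + N y"
    and N_sc: "N (sc c * x) = cmod c * N x"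
    and N_mult: "N (x * y) \<le> N x * N y"
    and N_star_mult_self: "N (star x * x) = (N x)\<^sup>2"
begin

lemma N_0 [simp]: "N 0 = 0"
  using N_sc[of 0 0] by simp

lemma N_minus [simp]: "N (- x) = N x"
  using N_sc[of "-1" x] by (simp add: sc_minus)

lemma N_diff_commute: "N (x - y) = N (y - x)"
  by (metis N_minus minus_diff_eq)

lemma N_diff_triangle: "N (x - z) \<le> N (x - y) + N (y - z)"
  using N_add[of "x - y" "y - z"] by simp

lemma abs_N_diff: "\<bar>N x - N y\<bar> \<le> N (x - y)"
  using N_add[of "x - y" y] N_add[of "y - x" x] N_diff_commute[of x y] by simp

lemma N_star [simp]: "N (star x) = N x"
proof -
  have le: "N y \<le> N (star y)" for y
  proof (cases "N y = 0")
    case False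
    then have "N y * N y \<le> N (star y) * N y"
      using N_star_mult_self[of y] N_mult[of "star y" y] by (simp add: power2_eq_square)
    then show ?thesis using False N_nonneg[of y] by simp
  qed (simp add: N_nonneg)
  show ?thesis using le[of x] le[of "star x"] by simp
qed

text \<open>
  A C*-seminorm is turned into a C*-algebra by taking Cauchy sequences modulo null sequences; this
  divides out the kernel of the seminorm at the same time.
\<close>
definition cauchy :: "(nat \<Rightarrow> 'a) \<Rightarrow> bool" where
  "cauchy x \<longleftrightarrow> (\<forall>\<epsilon>>0. \<exists>M. \<forall>m\<ge>M. \<forall>n\<ge>M. N (x m - x n) < \<epsilon>)"

definition eqv :: "(nat \<Rightarrow> 'a) \<Rightarrow> (nat \<Rightarrow> 'a) \<Rightarrow> bool" where
  "eqv x y \<longleftrightarrow> (\<lambda>n. N (x n - y n)) \<longlonglongrightarrow> 0"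

lemma cauchyD: "cauchy x \<Longrightarrow> \<epsilon> > 0 \<Longrightarrow> \<exists>M. \<forall>m\<ge>M. \<forall>n\<ge>M. N (x m - x n) < \<epsilon>"
  by (simp add: cauchy_def)

lemma cauchy_const [simp]: "cauchy (\<lambda>n. a)"
  by (simp add: cauchy_def)

lemma N_tendsto_0_le:
  assumes "\<And>n. N (x n) \<le> f n" "f \<longlonglongrightarrow> 0"
  shows "(\<lambda>n. N (x n)) \<longlonglongrightarrow> 0"
  by (rule tendsto_sandwich[OF _ _ tendsto_const assms(2)]) (auto simp: N_nonneg assms)

lemma cauchy_bounded:
  assumes "cauchy x"
  shows "\<exists>B>0. \<forall>n. N (x n) \<le> B"
proof -
  obtain M where M: "\<forall>m\<ge>M. \<forall>n\<ge>M. N (x m - x n) < 1"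
    using cauchyD[OF assms, of 1] by auto
  let ?S = "insert 1 (insert (N (x M) + 1) ((\<lambda>n. N (x n)) ` {..<M}))"
  have "N (x n) \<le> Max ?S" for n
  proof (cases "n < M")
    case True
    then show ?thesis by (intro Max_ge) auto
  next
    case False
    then have "N (x n) \<le> N (x M) + 1"
      using M N_add[of "x n - x M" "x M"] by (smt (verit) diff_add_cancel le_refl not_less)
    also have "\<dots> \<le> Max ?S" by (intro Max_ge) auto
    finally show ?thesis .
  qed
  moreover have "1 \<le> Max ?S" by (intro Max_ge) auto
  ultimately show ?thesis by (intro exI[of _ "Max ?S"]) auto
qed

lemma cauchy_add:
  assumes "cauchy x" "cauchy y"
  shows "cauchy (\<lambda>n. x n + y n)"
  unfolding cauchy_def
proof (intro allI impI)
  fix \<epsilon> :: real assume "\<epsilon> > 0"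
  then obtain K L where KL: "\<forall>m\<ge>K. \<forall>n\<ge>K. N (x m - x n) < \<epsilon>/2" "\<forall>m\<ge>L. \<forall>n\<ge>L. N (y m - y n) < \<epsilon>/2"
    using cauchyD[OF assms(1), of "\<epsilon>/2"] cauchyD[OF assms(2), of "\<epsilon>/2"] by auto
  have "N (x m + y m - (x n + y n)) < \<epsilon>" if "m \<ge> max K L" "n \<ge> max K L" for m n
  proof -
    have "N (x m + y m - (x n + y n)) \<le> N (x m - x n) + N (y m - y n)"
      using N_add[of "x m - x n" "y m - y n"] by (simp add: algebra_simps)
    also have "\<dots> < \<epsilon>/2 + \<epsilon>/2" using KL that by (intro add_strict_mono) auto
    finally show ?thesis by simp
  qed
  then show "\<exists>M. \<forall>m\<ge>M. \<forall>n\<ge>M. N (x m + y m - (x n + y n)) < \<epsilon>" by blast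
qed

lemma N_mult_diff: "N (a * b - c * d) \<le> N (a - c) * N b + N c * N (b - d)"
proof -
  have "a * b - c * d = (a - c) * b + c * (b - d)" by (simp add: algebra_simps)
  then show ?thesis
    using N_add[of "(a - c) * b" "c * (b - d)"] N_mult[of "a - c" b] N_mult[of c "b - d"] by simp
qed

lemma cauchy_mult:
  assumes "cauchy x" "cauchy y"
  shows "cauchy (\<lambda>n. x n * y n)"
  unfolding cauchy_def
proof (intro allI impI)
  fix \<epsilon> :: real assume e: "\<epsilon> > 0"
  obtain B C where B: "B > 0" "\<And>n. N (x n) \<le> B" and C: "C > 0" "\<And>n. N (y n) \<le> C"
    using cauchy_bounded[OF assms(1)] cauchy_bounded[OF assms(2)] by auto
  obtain K L where KL: "\<forall>m\<ge>K. \<forall>n\<ge>K. N (x m - x n) < \<epsilon>/(2*C)" "\<forall>m\<ge>L. \<forall>n\<ge>L. N (y m - y n) < \<epsilon>/(2*B)"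
    using cauchyD[OF assms(1), of "\<epsilon>/(2*C)"] cauchyD[OF assms(2), of "\<epsilon>/(2*B)"] e B C by auto
  have "N (x m * y m - x n * y n) < \<epsilon>" if "m \<ge> max K L" "n \<ge> max K L" for m n
  proof -
    have "N (x m * y m - x n * y n) \<le> N (x m - x n) * C + B * N (y m - y n)"
      using N_mult_diff[of "x m" "y m" "x n" "y n"]
        mult_left_mono[OF C(2)[of m] N_nonneg[of "x m - x n"]]
        mult_right_mono[OF B(2)[of n] N_nonneg[of "y m - y n"]] by linarith
    also have "\<dots> < \<epsilon>/(2*C) * C + B * (\<epsilon>/(2*B))"
      using KL that B C by (intro add_strict_mono mult_strict_right_mono mult_strict_left_mono) auto
    finally show ?thesis using B C by simp
  qed
  then show "\<exists>M. \<forall>m\<ge>M. \<forall>n\<ge>M. N (x m * y m - x n * y n) < \<epsilon>" by blast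
qed

lemma cauchy_sc: "cauchy x \<Longrightarrow> cauchy (\<lambda>n. sc c * x n)"
  by (rule cauchy_mult) simp_all

lemma cauchy_star: "cauchy x \<Longrightarrow> cauchy (\<lambda>n. star (x n))"
  by (simp add: cauchy_def flip: star_diff)

lemma cauchy_diff: "cauchy x \<Longrightarrow> cauchy y \<Longrightarrow> cauchy (\<lambda>n. x n - y n)"
  using cauchy_add[of x "\<lambda>n. sc (-1) * y n"] cauchy_sc[of y "-1"] by (simp add: sc_minus)

lemma eqv_refl [simp]: "eqv x x"
  by (simp add: eqv_def)

lemma eqv_sym: "eqv x y \<Longrightarrow> eqv y x"
  by (simp add: eqv_def N_diff_commute)

lemma eqv_trans:
  assumes "eqv x y" "eqv y z"
  shows "eqv x z"
  unfolding eqv_def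
  by (rule N_tendsto_0_le[OF N_diff_triangle, of x y z for x y z])
    (use tendsto_add[OF assms[unfolded eqv_def]] in simp)

lemma eqv_add:
  assumes "eqv x x'" "eqv y y'"
  shows "eqv (\<lambda>n. x n + y n) (\<lambda>n. x' n + y' n)"
  unfolding eqv_def
proof (rule N_tendsto_0_le)
  show "N (x n + y n - (x' n + y' n)) \<le> N (x n - x' n) + N (y n - y' n)" for n
    using N_add[of "x n - x' n" "y n - y' n"] by (simp add: algebra_simps)
  show "(\<lambda>n. N (x n - x' n) + N (y n - y' n)) \<longlonglongrightarrow> 0"
    using tendsto_add[OF assms[unfolded eqv_def]] by simp
qed

lemma eqv_mult:
  assumes "eqv x x'" "eqv y y'" "cauchy x'" "cauchy y"
  shows "eqv (\<lambda>n. x n * y n) (\<lambda>n. x' n * y' n)"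
proof -
  obtain B C where B: "B > 0" "\<And>n. N (x' n) \<le> B" and C: "C > 0" "\<And>n. N (y n) \<le> C"
    using cauchy_bounded[OF assms(3)] cauchy_bounded[OF assms(4)] by auto
  show ?thesis
    unfolding eqv_def
  proof (rule N_tendsto_0_le)
    show "N (x n * y n - x' n * y' n) \<le> N (x n - x' n) * C + B * N (y n - y' n)" for n
      using N_mult_diff[of "x n" "y n" "x' n" "y' n"]
          mult_left_mono[OF C(2)[of n] N_nonneg[of "x n - x' n"]]
          mult_right_mono[OF B(2)[of n] N_nonneg[of "y n - y' n"]] by linarith
    show "(\<lambda>n. N (x n - x' n) * C + B * N (y n - y' n)) \<longlonglongrightarrow> 0"
      using tendsto_add[OF tendsto_mult_right[OF assms(1)[unfolded eqv_def], of C]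
          tendsto_mult_left[OF assms(2)[unfolded eqv_def], of B]] by simp
  qed
qed

lemma eqv_star: "eqv x y \<Longrightarrow> eqv (\<lambda>n. star (x n)) (\<lambda>n. star (y n))"
  by (simp add: eqv_def flip: star_diff)

lemma eqv_sc: "eqv x y \<Longrightarrow> eqv (\<lambda>n. sc c * x n) (\<lambda>n. sc c * y n)"
  using tendsto_mult_left[of "\<lambda>n. N (x n - y n)" 0 sequentially "cmod c"]
  by (simp add: eqv_def N_sc flip: right_diff_distrib)

lemma cauchy_N_convergent: "cauchy x \<Longrightarrow> convergent (\<lambda>n. N (x n))"
  unfolding cauchy_def Cauchy_convergent_iff[symmetric] Cauchy_def dist_real_def
  by (meson abs_N_diff order.strict_trans1)

lemma eqv_N_lim: "eqv x y \<Longrightarrow> (\<lambda>n. N (x n)) \<longlonglongrightarrow> l \<Longrightarrow> (\<lambda>n. N (y n)) \<longlonglongrightarrow> l"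
  unfolding eqv_def
proof (rule Lim_transform)
  assume "(\<lambda>n. N (x n - y n)) \<longlonglongrightarrow> 0"
  then show "(\<lambda>n. N (y n) - N (x n)) \<longlonglongrightarrow> 0"
    by (rule Lim_null_comparison[rotated])
      (use abs_N_diff[of "x n" "y n" for n] in \<open>simp add: abs_minus_commute\<close>)
qed

definition cls :: "(nat \<Rightarrow> 'a) \<Rightarrow> (nat \<Rightarrow> 'a) set" where
  "cls x = {y. cauchy y \<and> eqv x y}"

text \<open>
  The operations on classes are computed from chosen representatives; \<open>completion_simps\<close> below
  shows that any other Cauchy representatives give the same class.
\<close>
definition representative :: "(nat \<Rightarrow> 'a) set \<Rightarrow> nat \<Rightarrow> 'a" where
  "representative X = (SOME x. x \<in> X)"

lemma representative_cls: "cauchy x \<Longrightarrow> cauchy (representative (cls x)) \<and> eqv x (representative (cls x))"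
  unfolding representative_def by (rule someI2[of _ x]) (auto simp: cls_def)

lemma cls_eq_iff: "cauchy x \<Longrightarrow> cauchy y \<Longrightarrow> cls x = cls y \<longleftrightarrow> eqv x y"
  unfolding cls_def set_eq_iff by (auto intro: eqv_sym eqv_trans)

definition cstar_completion :: "(nat \<Rightarrow> 'a) set star_algebra" where
  "cstar_completion =
     \<lparr>carrier = cls ` {x. cauchy x},
      mult = (\<lambda>X Y. cls (\<lambda>n. representative X n * representative Y n)), one = cls (\<lambda>n. 1), zero = cls (\<lambda>n. 0),
      add = (\<lambda>X Y. cls (\<lambda>n. representative X n + representative Y n)), smult = (\<lambda>c X. cls (\<lambda>n. sc c * representative X n)),
      adj = (\<lambda>X. cls (\<lambda>n. star (representative X n))), anorm = (\<lambda>X. lim (\<lambda>n. N (representative X n)))\<rparr>"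

lemma completion_simps [simp]:
  "carrier cstar_completion = cls ` {x. cauchy x}"
  "\<one>\<^bsub>cstar_completion\<^esub> = cls (\<lambda>n. 1)" "\<zero>\<^bsub>cstar_completion\<^esub> = cls (\<lambda>n. 0)"
  "cauchy x \<Longrightarrow> cauchy y \<Longrightarrow> cls x \<otimes>\<^bsub>cstar_completion\<^esub> cls y = cls (\<lambda>n. x n * y n)"
  "cauchy x \<Longrightarrow> cauchy y \<Longrightarrow> cls x \<oplus>\<^bsub>cstar_completion\<^esub> cls y = cls (\<lambda>n. x n + y n)"
  "cauchy x \<Longrightarrow> c \<odot>\<^bsub>cstar_completion\<^esub> cls x = cls (\<lambda>n. sc c * x n)"
  "cauchy x \<Longrightarrow> adj cstar_completion (cls x) = cls (\<lambda>n. star (x n))"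
  using representative_cls[of x] representative_cls[of y]
  by (auto simp: cstar_completion_def cls_eq_iff cauchy_mult cauchy_add cauchy_sc cauchy_star
      intro!: eqv_mult eqv_add eqv_sc eqv_star intro: eqv_sym)

lemma completion_anorm:
  assumes "cauchy x"
  shows "(\<lambda>n. N (x n)) \<longlonglongrightarrow> anorm cstar_completion (cls x)"
proof -
  have "(\<lambda>n. N (representative (cls x) n)) \<longlonglongrightarrow> anorm cstar_completion (cls x)"
    using cauchy_N_convergent[of "representative (cls x)"] representative_cls[OF assms]
    by (simp add: cstar_completion_def convergent_LIMSEQ_iff)
  then show ?thesis using representative_cls[OF assms] eqv_N_lim eqv_sym by blast
qed

lemma completion_anorm_eqI:
  "cauchy x \<Longrightarrow> (\<lambda>n. N (x n)) \<longlonglongrightarrow> l \<Longrightarrow> anorm cstar_completion (cls x) = l"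
  using completion_anorm LIMSEQ_unique by blast

lemma completion_ring: "ring cstar_completion"
proof (rule ringI)
  have neg: "\<exists>Y\<in>carrier cstar_completion. Y \<oplus>\<^bsub>cstar_completion\<^esub> cls x = cls (\<lambda>n. 0)" if "cauchy x" for x
    using that cauchy_sc[of x "-1"] by (intro bexI[of _ "cls (\<lambda>n. sc (-1) * x n)"]) (auto simp: sc_minus)
  show "abelian_group cstar_completion"
  proof (rule abelian_groupI)
    fix X assume "X \<in> carrier cstar_completion"
    then show "\<exists>Y\<in>carrier cstar_completion. Y \<oplus>\<^bsub>cstar_completion\<^esub> X = \<zero>\<^bsub>cstar_completion\<^esub>"
      using neg by force
  qed (auto simp: cauchy_add ac_simps)
  show "monoid cstar_completion"
    by (rule monoidI) (auto simp: cauchy_mult mult.assoc)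
qed (auto simp: cauchy_add cauchy_mult distrib_left distrib_right)

lemma completion_module: "module complex_ring cstar_completion"
proof (rule moduleI)
  show "cring complex_ring" by (rule cring_complex_ring)
  show "abelian_group cstar_completion" using completion_ring by (rule ring.is_abelian_group)
qed (auto simp: cauchy_sc cauchy_add sc_add sc_mult distrib_left distrib_right mult.assoc)

lemma completion_minus:
  assumes "cauchy x" "cauchy y"
  shows "cls x \<ominus>\<^bsub>cstar_completion\<^esub> cls y = cls (\<lambda>n. x n - y n)"
  using assms using cauchy_sc[of y "-1"]
  by (simp add: module_minus_eq[OF completion_module] cauchy_sc sc_minus)

text \<open>
  The usual diagonal argument: from the \<open>n\<close>-th class choose an entry that is \<open>1/(n+1)\<close>-close to the tail
  of its representative.  These entries form a Cauchy sequence, and its class is the limit.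
\<close>
lemma completion_complete:
  assumes cau: "\<And>n. cauchy (x n)"
    and lim: "\<forall>\<epsilon>>0. \<exists>M. \<forall>m\<ge>M. \<forall>n\<ge>M. anorm cstar_completion (cls (\<lambda>j. x m j - x n j)) < \<epsilon>"
  shows "\<exists>y. cauchy y \<and> (\<lambda>n. anorm cstar_completion (cls (\<lambda>j. x n j - y j))) \<longlonglongrightarrow> 0"
proof -
  have "\<exists>k. \<forall>i\<ge>k. \<forall>j\<ge>k. N (x n i - x n j) < 1 / Suc n" for n
    using cauchyD[OF cau, of "1 / Suc n"] by simp
  then obtain k where k: "\<And>n i j. i \<ge> k n \<Longrightarrow> j \<ge> k n \<Longrightarrow> N (x n i - x n j) < 1 / Suc n" by metis
  define y where "y n = x n (k n)" for n
  have yx: "\<forall>\<^sub>F j in sequentially. N (y n - x n j) < 1 / Suc n" for n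
    using k[of n "k n"] unfolding y_def eventually_sequentially by blast
  have close: "N (y m - y n) < 1 / Suc m + 1 / Suc n + \<epsilon>"
    if "anorm cstar_completion (cls (\<lambda>j. x m j - x n j)) < \<epsilon>" for m n \<epsilon>
  proof -
    have "\<forall>\<^sub>F j in sequentially. N (x m j - x n j) < \<epsilon>"
      using completion_anorm[OF cauchy_diff[OF cau[of m] cau[of n]]] that by (rule order_tendstoD(2))
    with yx[of m] yx[of n] have "\<forall>\<^sub>F j in sequentially. N (y m - y n) < 1 / Suc m + 1 / Suc n + \<epsilon>"
    proof eventually_elim
      case (elim j)
      then show ?case
        using N_diff_triangle[of "y m" "y n" "x m j"] N_diff_triangle[of "x m j" "y n" "x n j"]
          N_diff_commute[of "x n j" "y n"] by linarith
    qed
    then show ?thesis by simp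
  qed
  have y: "cauchy y"
    unfolding cauchy_def
  proof (intro allI impI)
    fix \<epsilon> :: real assume "\<epsilon> > 0"
    then obtain M where M: "\<forall>m\<ge>M. \<forall>n\<ge>M. anorm cstar_completion (cls (\<lambda>j. x m j - x n j)) < \<epsilon>/3"
      using lim by (meson divide_pos_pos zero_less_numeral)
    obtain K where K: "1 / Suc K < \<epsilon>/3" using nat_approx_posE[of "\<epsilon>/3"] \<open>\<epsilon> > 0\<close> by auto
    have "N (y m - y n) < \<epsilon>" if "m \<ge> max M K" "n \<ge> max M K" for m n
    proof -
      have "1 / Suc m \<le> 1 / Suc K" "1 / Suc n \<le> 1 / Suc K" using that by (auto simp: frac_le)
      then show ?thesis using close[of m n "\<epsilon>/3"] M that K by auto
    qed
    then show "\<exists>M. \<forall>m\<ge>M. \<forall>n\<ge>M. N (y m - y n) < \<epsilon>" by blast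
  qed
  have "(\<lambda>n. anorm cstar_completion (cls (\<lambda>j. x n j - y j))) \<longlonglongrightarrow> 0"
  proof (rule LIMSEQ_I)
    fix r :: real assume "0 < r"
    obtain M where M: "\<forall>m\<ge>M. \<forall>n\<ge>M. N (y m - y n) < r/4"
      using cauchyD[OF y, of "r/4"] \<open>0 < r\<close> by auto
    obtain K where K: "1 / Suc K < r/4" using nat_approx_posE[of "r/4"] \<open>0 < r\<close> by auto
    have "norm (anorm cstar_completion (cls (\<lambda>j. x n j - y j)) - 0) < r" if n: "n \<ge> max M K" for n
    proof -
      \<comment> \<open>the norm of a difference of classes is the limit of the seminorms of the entries\<close>
      have lim: "(\<lambda>j. N (x n j - y j)) \<longlonglongrightarrow> anorm cstar_completion (cls (\<lambda>j. x n j - y j))"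
        by (rule completion_anorm[OF cauchy_diff[OF cau y]])
      have "\<forall>\<^sub>F j in sequentially. N (x n j - y j) \<le> r/2"
        using yx[of n] eventually_ge_at_top[of M]
      proof eventually_elim
        case (elim j)
        have "N (y n - y j) < r/4" using M n elim by auto
        moreover have "1 / Suc n \<le> 1 / Suc K" using n by (auto simp: frac_le)
        ultimately show ?case
          using elim N_diff_triangle[of "x n j" "y j" "y n"] N_diff_commute[of "x n j" "y n"] K by linarith
      qed
      then have "anorm cstar_completion (cls (\<lambda>j. x n j - y j)) \<le> r/2"
        by (intro tendsto_upperbound[OF lim]) auto
      moreover have "0 \<le> anorm cstar_completion (cls (\<lambda>j. x n j - y j))"
        by (rule tendsto_lowerbound[OF lim]) (auto simp: N_nonneg)
      ultimately show ?thesis using \<open>0 < r\<close> by simp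
    qed
    then show "\<exists>no. \<forall>n\<ge>no. norm (anorm cstar_completion (cls (\<lambda>j. x n j - y j)) - 0) < r" by blast
  qed
  with y show ?thesis by blast
qed

lemma completion_c_star: "c_star_algebra cstar_completion"
proof (intro c_star_algebra.intro c_star_algebra_axioms.intro completion_ring completion_module)
  fix \<sigma> :: "nat \<Rightarrow> (nat \<Rightarrow> 'a) set" assume \<sigma>: "\<And>n. \<sigma> n \<in> carrier cstar_completion"
    and cau: "\<forall>\<epsilon>>0. \<exists>M. \<forall>m\<ge>M. \<forall>n\<ge>M. anorm cstar_completion (\<sigma> m \<ominus>\<^bsub>cstar_completion\<^esub> \<sigma> n) < \<epsilon>"
  have "\<exists>x. cauchy x \<and> \<sigma> n = cls x" for n using \<sigma>[of n] by auto
  then obtain x where x: "\<And>n. cauchy (x n)" and sx: "\<And>n. \<sigma> n = cls (x n)" by metis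
  obtain y where "cauchy y" "(\<lambda>n. anorm cstar_completion (cls (\<lambda>j. x n j - y j))) \<longlonglongrightarrow> 0"
    using completion_complete[of x] cau by (auto simp: sx x completion_minus)
  then show "\<exists>X\<in>carrier cstar_completion. (\<lambda>n. anorm cstar_completion (\<sigma> n \<ominus>\<^bsub>cstar_completion\<^esub> X)) \<longlonglongrightarrow> 0"
    by (intro bexI[of _ "cls y"]) (auto simp: sx x completion_minus)
next
  fix X assume "X \<in> carrier cstar_completion"
  then obtain x where x: "cauchy x" "X = cls x" by auto
  note lim = completion_anorm[OF x(1)]
  show "0 \<le> anorm cstar_completion X"
    unfolding x(2) by (rule tendsto_lowerbound[OF lim]) (auto simp: N_nonneg)
  have "anorm cstar_completion (cls x) = 0 \<longleftrightarrow> eqv x (\<lambda>n. 0)"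
    using lim completion_anorm_eqI[OF x(1), of 0] by (auto simp: eqv_def)
  then show "(anorm cstar_completion X = 0) = (X = \<zero>\<^bsub>cstar_completion\<^esub>)" using x by (simp add: cls_eq_iff)
  show "anorm cstar_completion (c \<odot>\<^bsub>cstar_completion\<^esub> X) = cmod c * anorm cstar_completion X" for c
  proof -
    have "anorm cstar_completion (cls (\<lambda>n. sc c * x n)) = cmod c * anorm cstar_completion (cls x)"
      by (rule completion_anorm_eqI[OF cauchy_sc[OF x(1)]])
        (simp only: N_sc tendsto_mult_left[OF lim, of "cmod c"])
    then show ?thesis using x by simp
  qed
  show "anorm cstar_completion (adj cstar_completion X \<otimes>\<^bsub>cstar_completion\<^esub> X) = (anorm cstar_completion X)\<^sup>2"
  proof -
    have "anorm cstar_completion (cls (\<lambda>n. star (x n) * x n)) = (anorm cstar_completion (cls x))\<^sup>2"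
      by (rule completion_anorm_eqI[OF cauchy_mult[OF cauchy_star[OF x(1)] x(1)]])
        (simp only: N_star_mult_self tendsto_power[OF lim, of 2])
    then show ?thesis using x by (simp add: cauchy_star)
  qed
  show "adj cstar_completion (c \<odot>\<^bsub>cstar_completion\<^esub> X)
      = cnj c \<odot>\<^bsub>cstar_completion\<^esub> adj cstar_completion X" for c
    using x by (simp add: cauchy_sc cauchy_star star_sc_mult)
  fix Y assume "Y \<in> carrier cstar_completion"
  then obtain y where y: "cauchy y" "Y = cls y" by auto
  note lim' = completion_anorm[OF y(1)]
  show "anorm cstar_completion (X \<oplus>\<^bsub>cstar_completion\<^esub> Y) \<le> anorm cstar_completion X + anorm cstar_completion Y"
  proof -
    have "anorm cstar_completion (cls (\<lambda>n. x n + y n)) \<le> anorm cstar_completion (cls x) + anorm cstar_completion (cls y)"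
      by (rule tendsto_le[OF _ tendsto_add[OF lim lim'] completion_anorm[OF cauchy_add[OF x(1) y(1)]]])
        (simp_all add: N_add)
    then show ?thesis using x y by simp
  qed
  show "anorm cstar_completion (X \<otimes>\<^bsub>cstar_completion\<^esub> Y) \<le> anorm cstar_completion X * anorm cstar_completion Y"
  proof -
    have "anorm cstar_completion (cls (\<lambda>n. x n * y n)) \<le> anorm cstar_completion (cls x) * anorm cstar_completion (cls y)"
      by (rule tendsto_le[OF _ tendsto_mult[OF lim lim'] completion_anorm[OF cauchy_mult[OF x(1) y(1)]]])
        (simp_all add: N_mult)
    then show ?thesis using x y by simp
  qed
qed (auto simp: cauchy_add cauchy_mult cauchy_sc cauchy_star star_add star_mult mult.assoc
      sc_left_commute)

text \<open>
  A linear functional bounded by the seminorm sends Cauchy sequences to convergent ones with a limit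
  depending on the class only, so it extends to the completion.
\<close>
lemma completion_functional:
  assumes add: "\<And>x y. s (x + y) = s x + s y" and scale: "\<And>c x. s (sc c * x) = c * s x"
    and bound: "\<And>x. cmod (s x) \<le> N x"
  shows "\<exists>S. \<forall>x. cauchy x \<longrightarrow> (\<lambda>n. s (x n)) \<longlonglongrightarrow> S (cls x)"
proof -
  have diff: "s (a - b) = s a - s b" for a b
    using add[of a "sc (-1) * b"] scale[of "-1" b] by (simp add: sc_minus)
  have "(\<lambda>n. s (x n)) \<longlonglongrightarrow> lim (\<lambda>n. s (representative (cls x) n))" if x: "cauchy x" for x
  proof -
    have "Cauchy (\<lambda>n. s (representative (cls x) n))"
    proof (rule metric_CauchyI)
      fix \<epsilon> :: real assume "0 < \<epsilon>"
      then obtain M where M: "\<forall>m\<ge>M. \<forall>n\<ge>M. N (representative (cls x) m - representative (cls x) n) < \<epsilon>"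
        using cauchyD representative_cls[OF x] by blast
      have "dist (s (representative (cls x) m)) (s (representative (cls x) n)) < \<epsilon>" if "m \<ge> M" "n \<ge> M" for m n
        using M that bound[of "representative (cls x) m - representative (cls x) n"] unfolding dist_norm diff
        by (meson order.strict_trans1)
      then show "\<exists>M. \<forall>m\<ge>M. \<forall>n\<ge>M. dist (s (representative (cls x) m)) (s (representative (cls x) n)) < \<epsilon>" by blast
    qed
    then have lim: "(\<lambda>n. s (representative (cls x) n)) \<longlonglongrightarrow> lim (\<lambda>n. s (representative (cls x) n))"
      by (simp add: Cauchy_convergent_iff convergent_LIMSEQ_iff)
    have "(\<lambda>n. s (x n) - s (representative (cls x) n)) \<longlonglongrightarrow> 0"
    proof (rule Lim_null_comparison)
      show "(\<lambda>n. N (x n - representative (cls x) n)) \<longlonglongrightarrow> 0" using representative_cls[OF x] by (simp add: eqv_def)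
      show "\<forall>\<^sub>F n in sequentially. norm (s (x n) - s (representative (cls x) n)) \<le> N (x n - representative (cls x) n)"
        unfolding diff[symmetric] by (simp add: bound)
    qed
    from Lim_transform[OF lim this] show ?thesis .
  qed
  then show ?thesis by (intro exI[of _ "\<lambda>X. lim (\<lambda>n. s (representative X n))"]) simp
qed

end

section \<open>Tracial star-algebras and their 2-norm\<close>

lemma nonneg_Reals_sum: "(\<And>i. i \<in> I \<Longrightarrow> f i \<in> \<real>\<^sub>\<ge>\<^sub>0) \<Longrightarrow> sum f I \<in> (\<real>\<^sub>\<ge>\<^sub>0 :: complex set)"
  by (induction I rule: infinite_finite_induct) (simp_all add: nonneg_Reals_add_I)

text \<open>
  A star-algebra with a positive trace but without a norm.  The trace need not be faithful; elements
  of 2-norm zero behave like zero because they form a two-sided ideal (\<open>norm2_mult_eq_0\<close>).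
\<close>
locale tracial_algebra = star_ring sc star
  for sc :: "complex \<Rightarrow> 'a::ring_1" and star +
  fixes s :: "'a \<Rightarrow> complex"
  assumes s_add: "s (x + y) = s x + s y"
    and s_sc: "s (sc c * x) = c * s x"
    and s_pos: "s (star x * x) \<in> \<real>\<^sub>\<ge>\<^sub>0"
    and s_1 [simp]: "s 1 = 1"
    and s_comm: "s (x * y) = s (y * x)"
begin

lemma s_0 [simp]: "s 0 = 0"
  using s_add[of 0 0] by simp

lemma s_minus [simp]: "s (- x) = - s x"
  using s_add[of x "- x"] by (simp add: eq_neg_iff_add_eq_0 add.commute)

lemma s_diff: "s (x - y) = s x - s y"
  using s_add[of x "- y"] by simp

lemma s_sum: "s (sum f I) = (\<Sum>i\<in>I. s (f i))"
  by (induction I rule: infinite_finite_induct) (simp_all add: s_add)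

text \<open>
  Positivity of \<open>s\<close> at \<open>1 + x\<close> and at \<open>1 + \<i>x\<close> determines the imaginary and the real part of
  \<open>s (star x) - cnj (s x)\<close>.
\<close>
lemma s_star: "s (star x) = cnj (s x)"
proof -
  have "s (star (1 + x) * (1 + x)) = 1 + s x + s (star x) + s (star x * x)"
    by (simp add: star_add distrib_left distrib_right s_add)
  then have im: "Im (s x) + Im (s (star x)) = 0"
    using s_pos[of "1 + x"] s_pos[of x] by (auto simp: complex_nonneg_Reals_iff)
  have eq: "star (1 + sc \<i> * x) * (1 + sc \<i> * x) = 1 + sc \<i> * x + sc (- \<i>) * star x + star x * x"
  proof -
    have "sc (- \<i>) * (star x * (sc \<i> * x)) = sc (- \<i> * \<i>) * (star x * x)"
      by (simp only: sc_mult mult.assoc sc_left_commute[of "star x"])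
    then show ?thesis
      by (simp add: star_add star_sc_mult distrib_left distrib_right mult.assoc)
  qed
  have "s (star (1 + sc \<i> * x) * (1 + sc \<i> * x)) = 1 + \<i> * s x - \<i> * s (star x) + s (star x * x)"
    unfolding eq by (simp add: s_add s_sc del: sc_minus)
  then have "Re (s x) - Re (s (star x)) = 0"
    using s_pos[of "1 + sc \<i> * x"] s_pos[of x] by (auto simp: complex_nonneg_Reals_iff)
  with im show ?thesis by (simp add: complex_eq_iff)
qed

definition norm2 :: "'a \<Rightarrow> real" where
  "norm2 x = sqrt (Re (s (star x * x)))"

lemma norm2_nonneg [simp]: "0 \<le> norm2 x"
  using s_pos[of x] by (simp add: norm2_def complex_nonneg_Reals_iff)

lemma s_star_mult_self: "s (star x * x) = complex_of_real ((norm2 x)\<^sup>2)"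
  using s_pos[of x] by (auto simp: norm2_def complex_nonneg_Reals_iff complex_eq_iff)

lemma norm2_eqI: "s (star x * x) = complex_of_real (r\<^sup>2) \<Longrightarrow> 0 \<le> r \<Longrightarrow> norm2 x = r"
  by (simp add: norm2_def)

lemma norm2_star [simp]: "norm2 (star x) = norm2 x"
  by (simp add: norm2_def s_comm[of x])

lemma norm2_sc: "norm2 (sc c * x) = cmod c * norm2 x"
proof (rule norm2_eqI)
  have "star (sc c * x) * (sc c * x) = sc (cnj c * c) * (star x * x)"
    by (simp add: star_sc_mult mult.assoc sc_left_commute[of "star x"] sc_mult)
  then show "s (star (sc c * x) * (sc c * x)) = complex_of_real ((cmod c * norm2 x)\<^sup>2)"
    unfolding power_mult_distrib of_real_mult complex_norm_square
    by (simp add: s_sc s_star_mult_self mult.commute)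
qed simp

lemma norm2_0 [simp]: "norm2 0 = 0"
  by (simp add: norm2_def)

lemma norm2_1 [simp]: "norm2 1 = 1"
  by (simp add: norm2_def)

lemma norm2_minus [simp]: "norm2 (- x) = norm2 x"
  by (simp add: norm2_def)

lemma norm2_diff_commute: "norm2 (x - y) = norm2 (y - x)"
  by (metis norm2_minus minus_diff_eq)

text \<open>
  Positivity at \<open>x - r \<cdot> cnj z \<cdot> y\<close>, where \<open>z = s (star x * y)\<close>, is a quadratic inequality in the real number \<open>r\<close>.
\<close>
lemma cauchy_schwarz: "cmod (s (star x * y)) \<le> norm2 x * norm2 y"
proof -
  define z where "z = s (star x * y)"
  have zc: "s (star y * x) = cnj z"
    using s_star[of "star x * y"] by (simp add: star_mult z_def)
  have *: "0 \<le> (norm2 x)\<^sup>2 - 2 * r * (cmod z)\<^sup>2 + r\<^sup>2 * (cmod z)\<^sup>2 * (norm2 y)\<^sup>2" for r :: real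
  proof -
    define t where "t = - (complex_of_real r * cnj z)"
    have "star (x + sc t * y) * (x + sc t * y)
        = star x * x + sc t * (star x * y) + sc (cnj t) * (star y * x) + sc (cnj t * t) * (star y * y)"
      by (simp add: star_add star_sc_mult distrib_left distrib_right mult.assoc sc_mult
          sc_left_commute[of "star x"] sc_left_commute[of "star y"])
    then have "complex_of_real ((norm2 (x + sc t * y))\<^sup>2) = complex_of_real ((norm2 x)\<^sup>2) + t * z + cnj t * cnj z
        + (cnj t * t) * complex_of_real ((norm2 y)\<^sup>2)"
      by (simp add: s_add s_sc zc del: of_real_power flip: s_star_mult_self z_def)
    also have "t * z = complex_of_real (- r * (cmod z)\<^sup>2)"
      by (simp add: t_def complex_norm_square del: of_real_power)
    also have "cnj t * cnj z = complex_of_real (- r * (cmod z)\<^sup>2)"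
      by (simp add: t_def complex_norm_square mult.commute del: of_real_power)
    also have "cnj t * t = complex_of_real (r\<^sup>2 * (cmod z)\<^sup>2)"
      unfolding of_real_mult complex_norm_square by (simp add: t_def power2_eq_square mult_ac)
    finally have "(norm2 (x + sc t * y))\<^sup>2 = (norm2 x)\<^sup>2 - 2 * r * (cmod z)\<^sup>2 + r\<^sup>2 * (cmod z)\<^sup>2 * (norm2 y)\<^sup>2"
      unfolding of_real_mult[symmetric] of_real_add[symmetric] of_real_eq_iff by simp
    then show ?thesis by (metis zero_le_power2)
  qed
  have "(cmod z)\<^sup>2 \<le> (norm2 x * norm2 y)\<^sup>2"
  proof (cases "norm2 y = 0")
    case True
    have "cmod z = 0"
    proof (rule ccontr)
      assume nz: "cmod z \<noteq> 0"
      \<comment> \<open>for a null vector \<open>y\<close> the inequality is linear in \<open>r\<close> and fails for large \<open>r\<close>\<close>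
      then show False using *[of "((norm2 x)\<^sup>2 + 1) / (2 * (cmod z)\<^sup>2)"] True by (simp add: field_simps)
    qed
    then show ?thesis by simp
  next
    case False
    \<comment> \<open>the minimum of the quadratic polynomial is at \<open>r = 1 / Y\<close>\<close>
    define X Y Z where "X = (norm2 x)\<^sup>2" and "Y = (norm2 y)\<^sup>2" and "Z = (cmod z)\<^sup>2"
    have Y: "Y > 0" using False by (simp add: Y_def)
    have "0 \<le> X - 2 * (1 / Y) * Z + (1 / Y)\<^sup>2 * Z * Y"
      using *[of "1 / Y"] by (simp only: X_def Y_def Z_def)
    then have "Z / Y \<le> X" using Y by (simp add: power2_eq_square)
    then have "Z \<le> X * Y" using Y by (simp add: pos_divide_le_eq)
    then show ?thesis by (simp add: X_def Y_def Z_def power_mult_distrib)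
  qed
  then show ?thesis unfolding z_def by (rule power2_le_imp_le) simp
qed

lemma s_le_norm2: "cmod (s x) \<le> norm2 x"
  using cauchy_schwarz[of 1 x] by simp

lemma norm2_triangle: "norm2 (x + y) \<le> norm2 x + norm2 y"
proof (rule power2_le_imp_le)
  have "s (star (x + y) * (x + y)) = s (star x * x) + s (star x * y) + cnj (s (star x * y)) + s (star y * y)"
    using s_star[of "star x * y"] by (simp add: star_add star_mult distrib_left distrib_right s_add)
  then have "complex_of_real ((norm2 (x + y))\<^sup>2)
     = complex_of_real ((norm2 x)\<^sup>2) + s (star x * y) + cnj (s (star x * y)) + complex_of_real ((norm2 y)\<^sup>2)"
    by (simp only: s_star_mult_self)
  from arg_cong[OF this, of Re]
  have "(norm2 (x + y))\<^sup>2 = (norm2 x)\<^sup>2 + 2 * Re (s (star x * y)) + (norm2 y)\<^sup>2" by simp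
  also have "\<dots> \<le> (norm2 x)\<^sup>2 + 2 * (norm2 x * norm2 y) + (norm2 y)\<^sup>2"
    using complex_Re_le_cmod[of "s (star x * y)"] cauchy_schwarz[of x y] by simp
  finally show "(norm2 (x + y))\<^sup>2 \<le> (norm2 x + norm2 y)\<^sup>2" by (simp add: power2_sum)
qed simp

text \<open>
  By traciality \<open>s (star (z * y) * (z * y))\<close> is \<open>s (star z * w)\<close> for some \<open>w\<close>, so it vanishes with the 2-norm of \<open>z\<close>
  by Cauchy-Schwarz.
\<close>
lemma norm2_mult_eq_0:
  assumes "norm2 x = 0"
  shows "norm2 (x * y) = 0" "norm2 (y * x) = 0"
proof -
  have right: "norm2 (z * y) = 0" if "norm2 z = 0" for z y
  proof -
    have "cmod (s (star (z * y) * (z * y))) = cmod (s (star z * (z * (y * star y))))"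
      using s_comm[of "star y" "star z * z * y"] by (simp add: star_mult mult.assoc)
    then have "cmod (s (star (z * y) * (z * y))) \<le> 0"
      using cauchy_schwarz[of z "z * (y * star y)"] that by simp
    then show ?thesis by (simp add: s_star_mult_self)
  qed
  show "norm2 (x * y) = 0" using right assms .
  have "norm2 (star (y * x)) = 0" unfolding star_mult using right[of "star x" "star y"] assms by simp
  then show "norm2 (y * x) = 0" by simp
qed

lemma psd_gram:
  "(\<Sum>i<n. \<Sum>j<n. cnj (c i) * c j * s (star (a i) * a j)) \<in> \<real>\<^sub>\<ge>\<^sub>0"
proof -
  let ?x = "\<Sum>i<n. sc (c i) * a i"
  have "star ?x * ?x = (\<Sum>i<n. \<Sum>j<n. sc (cnj (c i) * c j) * (star (a i) * a j))"
    by (simp add: star_sum sum_product star_sc_mult mult.assoc sc_left_commute[of "star _"] sc_mult)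
  then have "s (star ?x * ?x) = (\<Sum>i<n. \<Sum>j<n. cnj (c i) * c j * s (star (a i) * a j))"
    by (simp add: s_sum s_sc)
  then show ?thesis using s_pos[of ?x] by simp
qed

subsection \<open>Effects\<close>

text \<open>
  The operators between \<open>0\<close> and \<open>1\<close>, with the order read off from the quadratic forms
  \<open>y \<mapsto> s (star y * a * y)\<close>.
\<close>
definition effect :: "'a \<Rightarrow> bool" where
  "effect a \<longleftrightarrow> star a = a \<and> (\<forall>y. s (star y * a * y) \<in> \<real>\<^sub>\<ge>\<^sub>0 \<and> s (star y * (1 - a) * y) \<in> \<real>\<^sub>\<ge>\<^sub>0)"

definition contraction :: "'a \<Rightarrow> bool" where
  "contraction a \<longleftrightarrow> (\<forall>y. norm2 (a * y) \<le> norm2 y \<and> norm2 (y * a) \<le> norm2 y)"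

lemma effect_compl: "effect a \<Longrightarrow> effect (1 - a)"
  by (auto simp: effect_def star_diff)

lemma effect_projection:
  assumes "star e = e" "norm2 (e * e - e) = 0"
  shows "effect e"
proof -
  have z: "s (star y * (e * e - e) * y) = 0" for y
    using s_le_norm2[of "star y * (e * e - e) * y"] norm2_mult_eq_0[OF assms(2)] norm2_mult_eq_0(1)
    by (metis norm_le_zero_iff)
  have "s (star y * e * y) = s (star (e * y) * (e * y))" for y
    using z[of y] assms(1) by (simp add: star_mult mult.assoc algebra_simps s_diff)
  moreover have "s (star y * (1 - e) * y) = s (star ((1 - e) * y) * ((1 - e) * y))" for y
    using z[of y] assms(1) by (simp add: star_mult star_diff mult.assoc algebra_simps s_diff s_add)
  ultimately show ?thesis using s_pos assms(1) by (simp add: effect_def)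
qed

lemma effect_mean:
  assumes "finite I" "I \<noteq> {}" "\<And>i. i \<in> I \<Longrightarrow> effect (a i)"
  shows "effect (sc (1 / of_nat (card I)) * (\<Sum>i\<in>I. a i))"
proof -
  let ?m = "1 / complex_of_nat (card I)"
  have m: "?m \<in> \<real>\<^sub>\<ge>\<^sub>0" by (simp add: nonneg_Reals_divide_I)
  have one: "1 - sc ?m * (\<Sum>i\<in>I. a i) = sc ?m * (\<Sum>i\<in>I. 1 - a i)"
  proof -
    have "sc ?m * of_nat (card I) = 1"
    proof -
      have "sc (of_nat n) = of_nat n" for n by (induction n) (simp_all add: sc_add)
      then have "sc ?m * of_nat (card I) = sc (?m * of_nat (card I))" by (simp only: sc_mult)
      moreover have "?m * of_nat (card I) = 1" using assms by simp
      ultimately show ?thesis by (simp only: sc_1)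
    qed
    then show ?thesis by (simp add: sum_subtractf right_diff_distrib)
  qed
  have linear: "s (star y * (sc ?m * (\<Sum>i\<in>I. b i)) * y) = ?m * (\<Sum>i\<in>I. s (star y * b i * y))" for b y
  proof -
    have "star y * (sc ?m * (\<Sum>i\<in>I. b i)) * y = sc ?m * (\<Sum>i\<in>I. star y * b i * y)"
      by (simp add: sum_distrib_left sum_distrib_right mult.assoc sc_left_commute[of "star y"])
    then show ?thesis by (simp only: s_sc s_sum)
  qed
  show ?thesis
    using assms(3) m unfolding effect_def one linear
    by (auto simp: star_sum star_sc_mult intro!: nonneg_Reals_mult_I nonneg_Reals_divide_I nonneg_Reals_sum)
qed

lemma effect_pos:
  assumes "effect a"
  shows "star a = a" "s (star y * a * y) \<in> \<real>\<^sub>\<ge>\<^sub>0" "s (star y * (1 - a) * y) \<in> \<real>\<^sub>\<ge>\<^sub>0"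
  using assms by (auto simp: effect_def)

text \<open>
  Since \<open>a\<close> commutes with \<open>1 - a\<close>, their product is the sum of \<open>a * (1 - a) * a\<close> and \<open>(1 - a) * a * (1 - a)\<close>,
  which are visibly positive.
\<close>
lemma effect_variance_pos:
  assumes "effect a"
  shows "s (star y * (a * (1 - a)) * y) \<in> \<real>\<^sub>\<ge>\<^sub>0"
proof -
  note a = effect_pos[OF assms]
  have "star y * (a * (1 - a)) * y
      = star (a * y) * (1 - a) * (a * y) + star ((1 - a) * y) * a * ((1 - a) * y)"
    by (simp add: star_mult star_diff a(1) algebra_simps)
  then show ?thesis using a(2)[of "(1 - a) * y"] a(3)[of "a * y"] by (simp add: s_add nonneg_Reals_add_I)
qed

text \<open>
  \<open>a\<^sup>2 \<le> a \<le> 1\<close> gives left multiplication; right multiplication follows by taking adjoints, under which the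
  2-norm is invariant.
\<close>
lemma effect_contraction:
  assumes "effect a"
  shows "contraction a"
proof -
  note a = effect_pos[OF assms]
  have left: "norm2 (a * y) \<le> norm2 y" for y
  proof (rule power2_le_imp_le)
    have "star y * y = star (a * y) * (a * y) + star y * (a * (1 - a)) * y + star y * (1 - a) * y"
      by (simp add: star_mult a(1) algebra_simps)
    then have "s (star y * y)
        = s (star (a * y) * (a * y)) + s (star y * (a * (1 - a)) * y) + s (star y * (1 - a) * y)"
      by (simp add: s_add)
    from arg_cong[OF this, of Re] show "(norm2 (a * y))\<^sup>2 \<le> (norm2 y)\<^sup>2"
      using a(3)[of y] effect_variance_pos[OF assms, of y]
      by (simp add: s_star_mult_self complex_nonneg_Reals_iff del: of_real_power)
  qed simp
  have "norm2 (y * a) \<le> norm2 y" for y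
    using left[of "star y"] norm2_star[of "y * a"] by (simp add: star_mult a(1))
  with left show ?thesis by (simp add: contraction_def)
qed

lemma contraction_mult: "contraction a \<Longrightarrow> contraction b \<Longrightarrow> contraction (a * b)"
  unfolding contraction_def by (metis mult.assoc order.trans)

lemma contraction_1: "contraction 1"
  by (simp add: contraction_def)

lemma contraction_prod_list: "(\<And>a. a \<in> set as \<Longrightarrow> contraction a) \<Longrightarrow> contraction (prod_list as)"
  by (induction as) (simp_all add: contraction_1 contraction_mult)

text \<open>
  For even \<open>n = 2k\<close> the difference is \<open>b\<^sup>k * (1 - b) * b\<^sup>k\<close>, for odd \<open>n\<close> it is \<open>b\<^sup>k * (b * (1 - b)) * b\<^sup>k\<close>.
\<close>
lemma effect_power_decreasing:
  assumes "effect b"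
  shows "s (star y * (b ^ n - b ^ Suc n) * y) \<in> \<real>\<^sub>\<ge>\<^sub>0"
proof -
  note b = effect_pos[OF assms]
  have pc: "b ^ k * (b * z) = b * (b ^ k * z)" for k z
    by (metis mult.assoc power_commutes)
  obtain k where "n = 2 * k \<or> n = Suc (2 * k)" by (metis oddE evenE Suc_eq_plus1)
  moreover have "star y * (b ^ (2 * k) - b ^ Suc (2 * k)) * y = star (b ^ k * y) * (1 - b) * (b ^ k * y)"
    by (simp add: star_mult star_power b(1) mult_2 power_add left_diff_distrib right_diff_distrib mult.assoc pc)
  moreover have "star y * (b ^ Suc (2 * k) - b ^ Suc (Suc (2 * k))) * y
      = star (b ^ k * y) * (b * (1 - b)) * (b ^ k * y)"
    by (simp add: star_mult star_power b(1) mult_2 power_add left_diff_distrib right_diff_distrib mult.assoc pc)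
  ultimately show ?thesis
    using b(3)[of "b ^ k * y"] effect_variance_pos[OF assms, of "b ^ k * y"] by metis
qed

lemma effect_power:
  assumes "effect b"
  shows "effect (b ^ n)"
proof -
  note b = effect_pos[OF assms]
  have pos: "s (star y * b ^ n * y) \<in> \<real>\<^sub>\<ge>\<^sub>0" for y
  proof -
    have pc: "b ^ k * (b * z) = b * (b ^ k * z)" for k z
      by (metis mult.assoc power_commutes)
    obtain k where "n = 2 * k \<or> n = Suc (2 * k)" by (metis oddE evenE Suc_eq_plus1)
    moreover have "star y * b ^ (2 * k) * y = star (b ^ k * y) * (b ^ k * y)"
      by (simp add: star_mult star_power b(1) mult_2 power_add mult.assoc)
    moreover have "star y * b ^ Suc (2 * k) * y = star (b ^ k * y) * b * (b ^ k * y)"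
      by (simp add: star_mult star_power b(1) mult_2 power_add mult.assoc pc)
    ultimately show ?thesis using b(2)[of "b ^ k * y"] s_pos[of "b ^ k * y"] by metis
  qed
  have "s (star y * (1 - b ^ n) * y) \<in> \<real>\<^sub>\<ge>\<^sub>0" for y
  proof (induction n)
    case (Suc n)
    have "star y * (1 - b ^ Suc n) * y = star y * (1 - b ^ n) * y + star y * (b ^ n - b ^ Suc n) * y"
      by (simp only: left_diff_distrib right_diff_distrib) simp
    then show ?case
      using Suc effect_power_decreasing[OF assms, of y n] by (simp add: s_add del: power_Suc)
  qed simp
  with pos show ?thesis by (simp add: effect_def star_power b(1))
qed

lemma effect_power_trace_converges:
  assumes "effect b"
  shows "\<exists>t\<ge>0. (\<lambda>n. s (b ^ n)) \<longlonglongrightarrow> complex_of_real t"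
proof -
  have dec: "decseq (\<lambda>n. Re (s (b ^ n)))"
    by (rule decseq_SucI) (use effect_power_decreasing[OF assms, of 1] in \<open>auto simp: complex_nonneg_Reals_iff s_diff\<close>)
  have spos: "s (b ^ n) \<in> \<real>\<^sub>\<ge>\<^sub>0" for n
    using effect_pos(2)[OF effect_power[OF assms], of 1] by simp
  have pos: "0 \<le> Re (s (b ^ n))" for n
    using spos by (simp add: complex_nonneg_Reals_iff)
  obtain t where t: "(\<lambda>n. Re (s (b ^ n))) \<longlonglongrightarrow> t"
    using decseq_convergent[OF dec, of 0] pos by blast
  have re: "complex_of_real (Re (s (b ^ n))) = s (b ^ n)" for n
    using spos by (auto simp: complex_nonneg_Reals_iff complex_eq_iff)
  then have "(\<lambda>n. s (b ^ n)) \<longlonglongrightarrow> complex_of_real t" using tendsto_of_real[OF t, where 'a = complex] by (simp only: re)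
  moreover have "0 \<le> t" by (rule tendsto_lowerbound[OF t]) (auto simp: pos)
  ultimately show ?thesis by blast
qed

lemma norm2_sq_power_diff:
  assumes "star b = b"
  shows "complex_of_real ((norm2 (b ^ m - b ^ n))\<^sup>2) = s (b ^ (2 * m)) - 2 * s (b ^ (m + n)) + s (b ^ (2 * n))"
proof -
  have "star (b ^ m - b ^ n) * (b ^ m - b ^ n) = b ^ (2 * m) - b ^ (m + n) - b ^ (m + n) + b ^ (2 * n)"
    by (simp add: star_diff star_power assms algebra_simps flip: power_add mult_2)
  then show ?thesis by (simp add: s_add s_diff del: of_real_power flip: s_star_mult_self)
qed

definition norm2_cauchy :: "(nat \<Rightarrow> 'a) \<Rightarrow> bool" where
  "norm2_cauchy x \<longleftrightarrow> (\<forall>\<epsilon>>0. \<exists>M. \<forall>m\<ge>M. \<forall>n\<ge>M. norm2 (x m - x n) < \<epsilon>)"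

lemma norm2_cauchyD: "norm2_cauchy x \<Longrightarrow> \<epsilon> > 0 \<Longrightarrow> \<exists>M. \<forall>m\<ge>M. \<forall>n\<ge>M. norm2 (x m - x n) < \<epsilon>"
  by (simp add: norm2_cauchy_def)

text \<open>
  The square of the 2-norm of \<open>b\<^sup>m - b\<^sup>n\<close> is a combination of three traces of powers whose coefficients
  \<open>1, -2, 1\<close> add up to zero, and all three traces have the same limit.
\<close>
lemma effect_power_norm2_cauchy:
  assumes "effect b"
  shows "norm2_cauchy (\<lambda>n. b ^ n)"
  unfolding norm2_cauchy_def
proof (intro allI impI)
  fix \<epsilon> :: real assume e: "\<epsilon> > 0"
  obtain t where t: "(\<lambda>n. s (b ^ n)) \<longlonglongrightarrow> complex_of_real t"
    using effect_power_trace_converges[OF assms] by blast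
  obtain M where M: "\<And>n. n \<ge> M \<Longrightarrow> cmod (s (b ^ n) - complex_of_real t) < \<epsilon>\<^sup>2 / 4"
    using LIMSEQ_D[OF t, of "\<epsilon>\<^sup>2 / 4"] e by auto
  have "norm2 (b ^ m - b ^ n) < \<epsilon>" if "m \<ge> M" "n \<ge> M" for m n
  proof (rule power2_less_imp_less)
    have three: "cmod (p - 2 * q + r) \<le> cmod p + 2 * cmod q + cmod r" for p q r
      using norm_triangle_ineq[of "p - 2 * q" r] norm_triangle_ineq4[of p "2 * q"] by (simp add: norm_mult)
    let ?d = "\<lambda>n. s (b ^ n) - complex_of_real t"
    have "complex_of_real ((norm2 (b ^ m - b ^ n))\<^sup>2) = ?d (2 * m) - 2 * ?d (m + n) + ?d (2 * n)"
      by (simp add: norm2_sq_power_diff effect_pos[OF assms] del: of_real_power)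
    then have "(norm2 (b ^ m - b ^ n))\<^sup>2 = cmod (?d (2 * m) - 2 * ?d (m + n) + ?d (2 * n))"
      by (metis norm_of_real abs_of_nonneg zero_le_power2)
    also have "\<dots> \<le> cmod (?d (2 * m)) + 2 * cmod (?d (m + n)) + cmod (?d (2 * n))"
      by (rule three)
    also have "\<dots> < \<epsilon>\<^sup>2" using M[of "2 * m"] M[of "m + n"] M[of "2 * n"] that by simp
    finally show "(norm2 (b ^ m - b ^ n))\<^sup>2 < \<epsilon>\<^sup>2" .
  qed (use e in simp)
  then show "\<exists>M. \<forall>m\<ge>M. \<forall>n\<ge>M. norm2 (b ^ m - b ^ n) < \<epsilon>" by blast
qed

lemma norm2_cauchy_mult:
  assumes "norm2_cauchy x" "norm2_cauchy y" and "\<And>n. contraction (x n)" "\<And>n. contraction (y n)"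
  shows "norm2_cauchy (\<lambda>n. x n * y n)"
  unfolding norm2_cauchy_def
proof (intro allI impI)
  fix \<epsilon> :: real assume e: "\<epsilon> > 0"
  obtain K L where KL: "\<forall>m\<ge>K. \<forall>n\<ge>K. norm2 (x m - x n) < \<epsilon>/2" "\<forall>m\<ge>L. \<forall>n\<ge>L. norm2 (y m - y n) < \<epsilon>/2"
    using norm2_cauchyD[OF assms(1), of "\<epsilon>/2"] norm2_cauchyD[OF assms(2), of "\<epsilon>/2"] e by auto
  have "norm2 (x m * y m - x n * y n) < \<epsilon>" if "m \<ge> max K L" "n \<ge> max K L" for m n
  proof -
    have "norm2 (x m * y m - x n * y n) \<le> norm2 ((x m - x n) * y m) + norm2 (x n * (y m - y n))"
      using norm2_triangle[of "(x m - x n) * y m" "x n * (y m - y n)"] by (simp add: algebra_simps)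
    also have "\<dots> \<le> norm2 (x m - x n) + norm2 (y m - y n)"
      using assms(3)[of n] assms(4)[of m] by (intro add_mono) (auto simp: contraction_def)
    also have "\<dots> < \<epsilon>/2 + \<epsilon>/2" using KL that by (intro add_strict_mono) auto
    finally show ?thesis by simp
  qed
  then show "\<exists>M. \<forall>m\<ge>M. \<forall>n\<ge>M. norm2 (x m * y m - x n * y n) < \<epsilon>" by blast
qed

lemma norm2_cauchy_trace_convergent:
  assumes "norm2_cauchy x"
  shows "convergent (\<lambda>n. s (x n))"
proof -
  have "Cauchy (\<lambda>n. s (x n))"
  proof (rule metric_CauchyI)
    fix \<epsilon> :: real assume "0 < \<epsilon>"
    then obtain M where M: "\<forall>m\<ge>M. \<forall>n\<ge>M. norm2 (x m - x n) < \<epsilon>"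
      using norm2_cauchyD[OF assms] by blast
    have "dist (s (x m)) (s (x n)) < \<epsilon>" if "m \<ge> M" "n \<ge> M" for m n
    proof -
      have "norm2 (x m - x n) < \<epsilon>" using M that by blast
      then show ?thesis using s_le_norm2[of "x m - x n"] by (simp add: dist_norm s_diff)
    qed
    then show "\<exists>M. \<forall>m\<ge>M. \<forall>n\<ge>M. dist (s (x m)) (s (x n)) < \<epsilon>" by blast
  qed
  then show ?thesis by (simp add: Cauchy_convergent_iff)
qed

end

section \<open>Moments of families of projections\<close>

text \<open>
  \<open>rev x @ y\<close> is the word of the operator \<open>star (e\<^sub>x) * e\<^sub>y\<close>.  The words are indexed by numbers, with
  repetitions permitted, so that positivity survives substitutions such as \<open>map fst\<close> that may identify
  words.
\<close>
definition psd :: "('i list \<Rightarrow> complex) \<Rightarrow> bool" where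
  "psd \<phi> \<longleftrightarrow> (\<forall>(n::nat) c x. (\<Sum>i<n. \<Sum>j<n. cnj (c i) * c j * \<phi> (rev (x i) @ x j)) \<in> \<real>\<^sub>\<ge>\<^sub>0)"

text \<open>
  The relations are demanded at the front of a word only; invariance under rotation moves them to any
  other place.
\<close>
definition tracial_moments :: "('i \<times> 'i) set \<Rightarrow> ('i list \<Rightarrow> complex) \<Rightarrow> bool" where
  "tracial_moments E \<phi> \<longleftrightarrow>
     \<phi> [] = 1 \<and> (\<forall>x y. \<phi> (x @ y) = \<phi> (y @ x)) \<and> (\<forall>v x. \<phi> (v # v # x) = \<phi> (v # x)) \<and>
     (\<forall>(v, w)\<in>E. \<forall>x. \<phi> (v # w # x) = 0) \<and> psd \<phi>"

lemma tracial_momentsD: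
  assumes "tracial_moments E \<phi>"
  shows "\<phi> [] = 1" "\<phi> (x @ y) = \<phi> (y @ x)" "\<phi> (v # v # x) = \<phi> (v # x)"
    "(v, w) \<in> E \<Longrightarrow> \<phi> (v # w # x) = 0" "psd \<phi>"
  using assms by (auto simp: tracial_moments_def)

context tracial_algebra
begin

text \<open>
  A sequence of families of self-adjoint contractions that converges in the 2-norm, and whose members
  become projections in the limit and are orthogonal along \<open>E\<close> up to elements of 2-norm zero, has limit
  moments like a family of projections in a C*-algebra: the trace of a word changes by at most the sum of the changes
  of its letters in 2-norm.
\<close>
lemma limit_moments:
  fixes f :: "nat \<Rightarrow> 'i \<Rightarrow> 'a"
  assumes sa: "\<And>n i. star (f n i) = f n i"
    and contr: "\<And>n i. contraction (f n i)"
    and cauchy: "\<And>i. norm2_cauchy (\<lambda>n. f n i)"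
    and idem: "\<And>i. (\<lambda>n. norm2 (f n i * f n i - f n i)) \<longlonglongrightarrow> 0"
    and orth: "\<And>i j n. (i, j) \<in> E \<Longrightarrow> norm2 (f n i * f n j) = 0"
  shows "\<exists>\<phi>. tracial_moments E \<phi> \<and> (\<forall>w. (\<lambda>n. s (prod_list (map (f n) w))) \<longlonglongrightarrow> \<phi> w)"
proof -
  define P where "P n w = prod_list (map (f n) w)" for n w
  have P: "P n [] = 1" "P n (i # w) = f n i * P n w" "P n (x @ y) = P n x * P n y" for n i w x y
    by (simp_all add: P_def)
  have P_star: "star (P n w) = P n (rev w)" for n w
    by (induction w) (simp_all add: P star_mult sa)
  have P_contr: "contraction (P n w)" for n w
    unfolding P_def by (rule contraction_prod_list) (use contr in auto)
  have "norm2_cauchy (\<lambda>n. P n w)" for w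
  proof (induction w)
    case Nil
    then show ?case by (simp add: P norm2_cauchy_def)
  next
    case (Cons i w)
    then show ?case unfolding P by (intro norm2_cauchy_mult cauchy contr P_contr)
  qed
  then have "\<exists>l. (\<lambda>n. s (P n w)) \<longlonglongrightarrow> l" for w
    using norm2_cauchy_trace_convergent unfolding convergent_def by blast
  then obtain \<phi> where \<phi>: "\<And>w. (\<lambda>n. s (P n w)) \<longlonglongrightarrow> \<phi> w" by metis
  have "tracial_moments E \<phi>"
    unfolding tracial_moments_def
  proof (intro conjI allI ballI)
    show "\<phi> [] = 1" using LIMSEQ_unique[OF \<phi>[of "[]"], of 1] by (simp add: P)
    show "\<phi> (x @ y) = \<phi> (y @ x)" for x y
    proof (rule LIMSEQ_unique[OF \<phi>])
      have "s (P n (x @ y)) = s (P n (y @ x))" for n unfolding P by (rule s_comm)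
      then show "(\<lambda>n. s (P n (x @ y))) \<longlonglongrightarrow> \<phi> (y @ x)" using \<phi>[of "y @ x"] by simp
    qed
    show "\<phi> (v # v # x) = \<phi> (v # x)" for v x
    proof -
      have "(\<lambda>n. s (P n (v # v # x)) - s (P n (v # x))) \<longlonglongrightarrow> 0"
      proof (rule Lim_null_comparison)
        have "cmod (s (P n (v # v # x)) - s (P n (v # x))) \<le> norm2 (f n v * f n v - f n v)" for n
        proof -
          have "s (P n (v # v # x)) - s (P n (v # x)) = s ((f n v * f n v - f n v) * P n x)"
            by (simp add: P left_diff_distrib mult.assoc s_diff)
          then show ?thesis
            using s_le_norm2[of "(f n v * f n v - f n v) * P n x"] P_contr[of n x]
            unfolding contraction_def by (metis order.trans)
        qed
        then show "\<forall>\<^sub>F n in sequentially. cmod (s (P n (v # v # x)) - s (P n (v # x))) \<le> norm2 (f n v * f n v - f n v)"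
          by simp
      qed (rule idem)
      from LIMSEQ_unique[OF this tendsto_diff[OF \<phi> \<phi>]] show ?thesis by simp
    qed
    fix e assume "e \<in> E"
    then show "case e of (v, w) \<Rightarrow> \<forall>x. \<phi> (v # w # x) = 0"
    proof (clarify)
      fix v w x assume "(v, w) \<in> E"
      then have "norm2 (P n (v # w # x)) = 0" for n
        using norm2_mult_eq_0(1)[OF orth, of v w n "P n x"] by (simp add: P mult.assoc)
      then have "s (P n (v # w # x)) = 0" for n
        using s_le_norm2[of "P n (v # w # x)"] by simp
      then show "\<phi> (v # w # x) = 0"
        using LIMSEQ_unique[OF \<phi>[of "v # w # x"], of 0] by simp
    qed
  next
    show "psd \<phi>"
      unfolding psd_def
    proof (intro allI)
      fix n c and x :: "nat \<Rightarrow> 'i list"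
      show "(\<Sum>i<n. \<Sum>j<n. cnj (c i) * c j * \<phi> (rev (x i) @ x j)) \<in> \<real>\<^sub>\<ge>\<^sub>0"
      proof (rule Lim_in_closed_set)
        show "(\<lambda>k. \<Sum>i<n. \<Sum>j<n. cnj (c i) * c j * s (P k (rev (x i) @ x j)))
            \<longlonglongrightarrow> (\<Sum>i<n. \<Sum>j<n. cnj (c i) * c j * \<phi> (rev (x i) @ x j))"
          by (intro tendsto_intros \<phi>)
        show "\<forall>\<^sub>F k in sequentially. (\<Sum>i<n. \<Sum>j<n. cnj (c i) * c j * s (P k (rev (x i) @ x j))) \<in> \<real>\<^sub>\<ge>\<^sub>0"
          using psd_gram[of c "\<lambda>i. P k (x i)" n for k] by (simp add: P P_star)
      qed simp_all
    qed
  qed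
  with \<phi> show ?thesis unfolding P_def by blast
qed

end

section \<open>The free algebra\<close>

text \<open>
  Words form the free monoid.  Finitely supported functions on an additively written monoid form its
  monoid algebra under convolution, so with concatenation as addition they are the free algebra.
\<close>
instantiation list :: (type) monoid_add
begin
definition zero_list :: "'a list" where "zero_list = []"
definition plus_list :: "'a list \<Rightarrow> 'a list \<Rightarrow> 'a list" where "plus_list = (@)"
instance by standard (simp_all add: zero_list_def plus_list_def)
end

type_synonym 'i free_algebra = "'i list \<Rightarrow>\<^sub>0 complex"

abbreviation monomial :: "'i list \<Rightarrow> complex \<Rightarrow> 'i free_algebra" where
  "monomial \<equiv> Poly_Mapping.single"

lemma monomial_mult: "monomial x c * monomial y d = monomial (x @ y) (c * d)"
  by (simp add: mult_single plus_list_def)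

lemma monomial_Nil: "monomial [] 1 = 1"
  using single_one[where 'a = "'i list"] by (simp add: zero_list_def)

lemma free_algebra_induct [case_names zero monomial add]:
  assumes "P 0" "\<And>x c. P (monomial x c)" "\<And>f g. P f \<Longrightarrow> P g \<Longrightarrow> P (f + g)"
  shows "P (f :: 'i free_algebra)"
proof (induction f rule: update_induct)
  case (update f a b)
  have "Poly_Mapping.update a b f = f + monomial a b"
    using update(1) by (intro poly_mapping_eqI) (auto simp: lookup_update lookup_add lookup_single when_def in_keys_iff)
  then show ?case using update assms by metis
qed (rule assms(1))

definition additive_extension :: "('i list \<Rightarrow> complex \<Rightarrow> 'b::comm_monoid_add) \<Rightarrow> 'i free_algebra \<Rightarrow> 'b" where
  "additive_extension h f = (\<Sum>x\<in>Poly_Mapping.keys f. h x (Poly_Mapping.lookup f x))"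

lemma additive_extension_monomial: "(\<And>x. h x 0 = 0) \<Longrightarrow> additive_extension h (monomial x c) = h x c"
  by (simp add: additive_extension_def)

lemma additive_extension_0 [simp]: "additive_extension h 0 = 0"
  by (simp add: additive_extension_def)

lemma additive_extension_add:
  assumes "\<And>x. h x 0 = 0" "\<And>x c d. h x (c + d) = h x c + h x d"
  shows "additive_extension h (f + g) = additive_extension h f + additive_extension h g"
  unfolding additive_extension_def using assms by (intro setsum_keys_plus_distrib) auto

definition fstar :: "'i free_algebra \<Rightarrow> 'i free_algebra" where
  "fstar = additive_extension (\<lambda>x c. monomial (rev x) (cnj c))"

lemma fstar_monomial [simp]: "fstar (monomial x c) = monomial (rev x) (cnj c)"
  by (simp add: fstar_def additive_extension_monomial)

lemma fstar_add: "fstar (f + g) = fstar f + fstar g"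
  unfolding fstar_def by (rule additive_extension_add) (simp_all add: single_add)

lemma fstar_0 [simp]: "fstar 0 = 0"
  by (simp add: fstar_def)

interpretation free: star_ring "monomial []" fstar
proof
  fix c d :: complex and f g :: "'i free_algebra"
  show "monomial [] (c + d) = (monomial [] c + monomial [] d :: 'i free_algebra)" by (simp add: single_add)
  show "monomial [] (c * d) = (monomial [] c * monomial [] d :: 'i free_algebra)" by (simp add: monomial_mult)
  show "monomial [] 1 = (1 :: 'i free_algebra)" by (rule monomial_Nil)
  show "f * monomial [] c = monomial [] c * f"
    by (induction f rule: free_algebra_induct) (simp_all add: monomial_mult distrib_left distrib_right mult.commute)
  show "fstar (f + g) = fstar f + fstar g" by (rule fstar_add)
  have "fstar (monomial x c * g) = fstar g * fstar (monomial x c)" for x c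
    by (induction g rule: free_algebra_induct)
      (simp_all add: monomial_mult distrib_left distrib_right fstar_add mult.commute)
  then show "fstar (f * g) = fstar g * fstar f"
    by (induction f rule: free_algebra_induct) (simp_all add: distrib_left distrib_right fstar_add)
  show "fstar (fstar f) = f"
    by (induction f rule: free_algebra_induct) (simp_all add: fstar_add)
  show "fstar (monomial [] c) = (monomial [] (cnj c) :: 'i free_algebra)" by simp
qed

definition moment_functional :: "('i list \<Rightarrow> complex) \<Rightarrow> 'i free_algebra \<Rightarrow> complex" where
  "moment_functional \<phi> = additive_extension (\<lambda>x c. c * \<phi> x)"

lemma moment_functional_monomial [simp]: "moment_functional \<phi> (monomial x c) = c * \<phi> x"
  by (simp add: moment_functional_def additive_extension_monomial)

lemma moment_functional_add:
  "moment_functional \<phi> (f + g) = moment_functional \<phi> f + moment_functional \<phi> g"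
  unfolding moment_functional_def by (rule additive_extension_add) (simp_all add: distrib_right)

lemma moment_functional_0 [simp]: "moment_functional \<phi> 0 = 0"
  by (simp add: moment_functional_def)

lemma moment_functional_sum: "moment_functional \<phi> (sum f I) = (\<Sum>i\<in>I. moment_functional \<phi> (f i))"
  by (induction I rule: infinite_finite_induct) (simp_all add: moment_functional_add)

lemma moment_functional_pos:
  assumes "psd \<phi>"
  shows "moment_functional \<phi> (fstar f * f) \<in> \<real>\<^sub>\<ge>\<^sub>0"
proof -
  obtain x n where bij: "bij_betw x {..<n::nat} (Poly_Mapping.keys f)"
    using ex_bij_betw_nat_finite[of "Poly_Mapping.keys f"] by (auto simp: atLeast0LessThan)
  let ?c = "\<lambda>i. Poly_Mapping.lookup f (x i)"
  have "f = (\<Sum>y\<in>Poly_Mapping.keys f. monomial y (Poly_Mapping.lookup f y))"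
    by (rule poly_mapping_eqI)
      (simp add: lookup_sum lookup_single when_def in_keys_iff sum.delta)
  also have "\<dots> = (\<Sum>i<n. monomial (x i) (?c i))"
    by (rule sum.reindex_bij_betw[OF bij, symmetric])
  finally have f: "f = (\<Sum>i<n. monomial (x i) (?c i))" .
  have "fstar f * f = (\<Sum>i<n. \<Sum>j<n. monomial (rev (x i) @ x j) (cnj (?c i) * ?c j))"
    by (subst (1 2) f) (simp add: free.star_sum sum_product monomial_mult)
  then have "moment_functional \<phi> (fstar f * f) = (\<Sum>i<n. \<Sum>j<n. cnj (?c i) * ?c j * \<phi> (rev (x i) @ x j))"
    by (simp add: moment_functional_sum)
  then show ?thesis using assms unfolding psd_def by simp
qed

lemma tracial_algebra_moment_functional:
  assumes "tracial_moments E \<phi>"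
  shows "tracial_algebra (monomial []) fstar (moment_functional \<phi>)"
proof
  note \<phi> = tracial_momentsD[OF assms]
  fix f g :: "'a free_algebra"
  show "moment_functional \<phi> (f + g) = moment_functional \<phi> f + moment_functional \<phi> g"
    by (rule moment_functional_add)
  show "moment_functional \<phi> (monomial [] c * f) = c * moment_functional \<phi> f" for c
    by (induction f rule: free_algebra_induct)
      (simp_all add: monomial_mult distrib_left moment_functional_add)
  show "moment_functional \<phi> (fstar f * f) \<in> \<real>\<^sub>\<ge>\<^sub>0" by (rule moment_functional_pos[OF \<phi>(5)])
  show "moment_functional \<phi> 1 = 1" using moment_functional_monomial[of \<phi> "[]" 1] by (simp add: \<phi>(1))
  have "moment_functional \<phi> (monomial x c * g) = moment_functional \<phi> (g * monomial x c)" for x c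
    by (induction g rule: free_algebra_induct)
      (simp_all add: monomial_mult distrib_left distrib_right moment_functional_add mult.commute \<phi>(2)[of x])
  then show "moment_functional \<phi> (f * g) = moment_functional \<phi> (g * f)"
    by (induction f rule: free_algebra_induct)
      (simp_all add: distrib_left distrib_right moment_functional_add)
qed

text \<open>
  The free algebra with the trace given by moments.  Its letters are projections satisfying the edge
  relations up to elements of 2-norm zero.
\<close>
locale moment_algebra =
  fixes E :: "('i \<times> 'i) set" and \<phi> :: "'i list \<Rightarrow> complex"
  assumes moments: "tracial_moments E \<phi>"

sublocale moment_algebra \<subseteq> tracial_algebra "monomial []" fstar "moment_functional \<phi>"
  by (rule tracial_algebra_moment_functional[OF moments])

context moment_algebra
begin

abbreviation letter :: "'i \<Rightarrow> 'i free_algebra" where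
  "letter v \<equiv> monomial [v] 1"

lemma letter_idem: "norm2 (letter v * letter v - letter v) = 0"
proof -
  note \<phi> = tracial_momentsD[OF moments]
  have "star (letter v * letter v - letter v) * (letter v * letter v - letter v)
      = monomial [v, v, v, v] 1 - monomial [v, v, v] 1 - monomial [v, v, v] 1 + monomial [v, v] 1" if "star = fstar" for star
    by (simp add: that star_diff monomial_mult algebra_simps)
  then show ?thesis unfolding norm2_def by (simp add: s_diff s_add \<phi>(3))
qed

lemma letter_orth:
  assumes "(v, w) \<in> E"
  shows "norm2 (letter v * letter w) = 0"
proof -
  note \<phi> = tracial_momentsD[OF moments]
  have "\<phi> [w, v, v, w] = \<phi> [v, w, w]" using \<phi>(2)[of "[w]" "[v, v, w]"] \<phi>(3) by simp
  then show ?thesis using \<phi>(4)[OF assms] by (simp add: norm2_def monomial_mult)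
qed

lemma letter_effect: "effect (letter v)"
  by (rule effect_projection[OF _ letter_idem]) simp

lemma word_contraction: "contraction (monomial x 1)"
proof (induction x)
  case Nil
  then show ?case by (simp add: contraction_1)
next
  case (Cons v x)
  have "monomial (v # x) 1 = letter v * monomial x 1" by (simp add: monomial_mult)
  then show ?case using Cons effect_contraction[OF letter_effect] contraction_mult by metis
qed

end

section \<open>Representing moments in a C*-algebra\<close>

text \<open>
  If every left multiplication is bounded in the 2-norm, the operator norm is a C*-seminorm.  All its
  properties follow from those of operators on a pre-Hilbert space, and completing the operators then
  gives a C*-algebra directly.
\<close>
locale bounded_tracial_algebra = tracial_algebra sc star s
  for sc :: "complex \<Rightarrow> 'a::ring_1" and star s +
  assumes bounded: "\<exists>c\<ge>0. \<forall>y. norm2 (x * y) \<le> c * norm2 y"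
begin

definition opnorm :: "'a \<Rightarrow> real" where
  "opnorm x = Inf {c. 0 \<le> c \<and> (\<forall>y. norm2 (x * y) \<le> c * norm2 y)}"

lemma opnorm_le: "0 \<le> c \<Longrightarrow> (\<And>y. norm2 (x * y) \<le> c * norm2 y) \<Longrightarrow> opnorm x \<le> c"
  unfolding opnorm_def by (rule cInf_lower) (auto intro: bdd_belowI[of _ 0])

lemma opnorm_nonneg: "0 \<le> opnorm x"
  unfolding opnorm_def by (rule cInf_greatest) (use bounded[of x] in auto)

lemma norm2_mult_le_opnorm: "norm2 (x * y) \<le> opnorm x * norm2 y"
proof (cases "norm2 y = 0")
  case True
  then show ?thesis by (simp add: norm2_mult_eq_0)
next
  case False
  then have y: "0 < norm2 y" by (simp add: order_less_le)
  have "norm2 (x * y) / norm2 y \<le> opnorm x"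
    unfolding opnorm_def
    by (rule cInf_greatest) (use bounded[of x] y in \<open>auto simp: pos_divide_le_eq\<close>)
  then show ?thesis using y by (simp add: pos_divide_le_eq)
qed

lemma norm2_le_opnorm: "norm2 x \<le> opnorm x"
  using norm2_mult_le_opnorm[of x 1] by simp

lemma opnorm_mult: "opnorm (x * y) \<le> opnorm x * opnorm y"
proof (rule opnorm_le)
  fix z
  have "norm2 (x * y * z) \<le> opnorm x * norm2 (y * z)"
    using norm2_mult_le_opnorm[of x "y * z"] by (simp add: mult.assoc)
  also have "\<dots> \<le> opnorm x * (opnorm y * norm2 z)"
    by (rule mult_left_mono[OF norm2_mult_le_opnorm opnorm_nonneg])
  finally show "norm2 (x * y * z) \<le> opnorm x * opnorm y * norm2 z" by (simp add: mult.assoc)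
qed (simp add: opnorm_nonneg)

lemma opnorm_add: "opnorm (x + y) \<le> opnorm x + opnorm y"
proof (rule opnorm_le)
  show "norm2 ((x + y) * z) \<le> (opnorm x + opnorm y) * norm2 z" for z
    using norm2_triangle[of "x * z" "y * z"] norm2_mult_le_opnorm[of x z] norm2_mult_le_opnorm[of y z]
    by (simp add: distrib_right)
qed (simp add: opnorm_nonneg)

lemma opnorm_sc: "opnorm (sc c * x) = cmod c * opnorm x"
proof -
  have le: "opnorm (sc d * y) \<le> cmod d * opnorm y" for d y
  proof (rule opnorm_le)
    show "norm2 (sc d * y * z) \<le> cmod d * opnorm y * norm2 z" for z
      using mult_left_mono[OF norm2_mult_le_opnorm[of y z], of "cmod d"] by (simp add: mult.assoc norm2_sc)
  qed (simp add: opnorm_nonneg)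
  show ?thesis
  proof (cases "c = 0")
    case True
    then show ?thesis using le[of 0 x] opnorm_nonneg[of 0] by simp
  next
    case False
    have "sc (inverse c) * (sc c * x) = sc (inverse c * c) * x" by (simp only: sc_mult mult.assoc)
    then have "opnorm x \<le> inverse (cmod c) * opnorm (sc c * x)"
      using le[of "inverse c" "sc c * x"] False by (simp add: norm_inverse)
    then have "cmod c * opnorm x \<le> opnorm (sc c * x)" using False by (simp add: field_simps)
    with le[of c x] show ?thesis by simp
  qed
qed

text \<open>
  \<open>\<parallel>x* y\<parallel>\<^sup>2 = \<langle>y, x x* y\<rangle> \<le> \<parallel>y\<parallel> \<parallel>x\<parallel> \<parallel>x* y\<parallel>\<close>, and one factor cancels.
\<close>
lemma opnorm_star_le: "opnorm (star x) \<le> opnorm x"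
proof (rule opnorm_le)
  fix y
  have "s (star (star x * y) * (star x * y)) = s (star y * (x * (star x * y)))"
    by (simp add: star_mult mult.assoc)
  then have "(norm2 (star x * y))\<^sup>2 = cmod (s (star y * (x * (star x * y))))"
    by (metis s_star_mult_self norm_of_real abs_of_nonneg zero_le_power2)
  also have "\<dots> \<le> norm2 y * norm2 (x * (star x * y))" by (rule cauchy_schwarz)
  also have "\<dots> \<le> norm2 y * (opnorm x * norm2 (star x * y))"
    by (rule mult_left_mono[OF norm2_mult_le_opnorm]) simp
  finally have "norm2 (star x * y) * norm2 (star x * y) \<le> (opnorm x * norm2 y) * norm2 (star x * y)"
    by (simp add: power2_eq_square mult_ac)
  then show "norm2 (star x * y) \<le> opnorm x * norm2 y"
    by (cases "norm2 (star x * y) = 0") (auto simp: opnorm_nonneg mult_le_cancel_right order_less_le)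
qed (rule opnorm_nonneg)

text \<open>
  The C*-identity: \<open>\<parallel>x y\<parallel>\<^sup>2 = \<langle>y, x* x y\<rangle> \<le> \<parallel>x* x\<parallel> \<parallel>y\<parallel>\<^sup>2\<close> by Cauchy-Schwarz.
\<close>
lemma opnorm_star_mult_self: "opnorm (star x * x) = (opnorm x)\<^sup>2"
proof (rule antisym)
  show "opnorm (star x * x) \<le> (opnorm x)\<^sup>2"
    using opnorm_mult[of "star x" x] mult_right_mono[OF opnorm_star_le[of x] opnorm_nonneg[of x]]
    by (simp add: power2_eq_square)
  have "opnorm x \<le> sqrt (opnorm (star x * x))"
  proof (rule opnorm_le)
    fix y
    have "s (star (x * y) * (x * y)) = s (star y * (star x * x * y))"
      by (simp add: star_mult mult.assoc)
    then have "(norm2 (x * y))\<^sup>2 = cmod (s (star y * (star x * x * y)))"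
      by (metis s_star_mult_self norm_of_real abs_of_nonneg zero_le_power2)
    also have "\<dots> \<le> norm2 y * norm2 (star x * x * y)" by (rule cauchy_schwarz)
    also have "\<dots> \<le> norm2 y * (opnorm (star x * x) * norm2 y)"
      by (rule mult_left_mono[OF norm2_mult_le_opnorm]) simp
    finally have "(norm2 (x * y))\<^sup>2 \<le> (sqrt (opnorm (star x * x)) * norm2 y)\<^sup>2"
      by (simp add: power_mult_distrib opnorm_nonneg power2_eq_square mult_ac)
    then show "norm2 (x * y) \<le> sqrt (opnorm (star x * x)) * norm2 y"
      by (rule power2_le_imp_le) (simp add: opnorm_nonneg)
  qed (simp add: opnorm_nonneg)
  from power_mono[OF this opnorm_nonneg, of 2] show "(opnorm x)\<^sup>2 \<le> opnorm (star x * x)"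
    by (simp add: opnorm_nonneg)
qed

lemma opnorm_eq_0: "norm2 x = 0 \<Longrightarrow> opnorm x = 0"
  using opnorm_le[of 0 x] opnorm_nonneg[of x] by (simp add: norm2_mult_eq_0)

sublocale c_star_seminorm sc star opnorm
  by standard (fact opnorm_nonneg opnorm_add opnorm_sc opnorm_mult opnorm_star_mult_self)+

text \<open>
  The trace is bounded by the operator norm because \<open>1\<close> has 2-norm one.
\<close>
lemma ex_completion_state:
  "\<exists>S. tracial_state cstar_completion S \<and> (\<forall>a. S (cls (\<lambda>n. a)) = s a)"
proof -
  have "cmod (s x) \<le> opnorm x" for x using s_le_norm2[of x] norm2_le_opnorm[of x] by simp
  from completion_functional[of s, OF s_add s_sc this]
  obtain S where S: "\<And>x. cauchy x \<Longrightarrow> (\<lambda>n. s (x n)) \<longlonglongrightarrow> S (cls x)" by blast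
  have const: "S (cls (\<lambda>n. a)) = s a" for a
    using LIMSEQ_unique[OF S[of "\<lambda>n. a"], of "s a"] by simp
  have "tracial_state cstar_completion S"
    unfolding tracial_state_def
  proof (intro conjI ballI allI)
    show "S \<one>\<^bsub>cstar_completion\<^esub> = 1" using const[of 1] by simp
    fix X assume "X \<in> carrier cstar_completion"
    then obtain x where x: "cauchy x" "X = cls x" by auto
    show "S (c \<odot>\<^bsub>cstar_completion\<^esub> X) = c * S X" for c
      using LIMSEQ_unique[OF S[OF cauchy_sc[OF x(1), of c]], of "c * S X"]
        tendsto_mult_left[OF S[OF x(1)], of c] x by (simp add: s_sc)
    show "S (adj cstar_completion X \<otimes>\<^bsub>cstar_completion\<^esub> X) \<in> \<real>\<^sub>\<ge>\<^sub>0"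
      using Lim_in_closed_set[OF closed_nonneg_Reals_complex _ _ S[OF cauchy_mult[OF cauchy_star[OF x(1)] x(1)]]] x
      by (simp add: cauchy_star s_pos)
    fix Y assume "Y \<in> carrier cstar_completion"
    then obtain y where y: "cauchy y" "Y = cls y" by auto
    show "S (X \<oplus>\<^bsub>cstar_completion\<^esub> Y) = S X + S Y"
      using LIMSEQ_unique[OF S[OF cauchy_add[OF x(1) y(1)]], of "S X + S Y"]
        tendsto_add[OF S[OF x(1)] S[OF y(1)]] x y by (simp add: s_add)
    have "S (cls (\<lambda>n. x n * y n)) = S (cls (\<lambda>n. y n * x n))"
    proof (rule LIMSEQ_unique[OF S[OF cauchy_mult[OF x(1) y(1)]]])
      show "(\<lambda>n. s (x n * y n)) \<longlonglongrightarrow> S (cls (\<lambda>n. y n * x n))"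
        using S[OF cauchy_mult[OF y(1) x(1)]] by (simp only: s_comm)
    qed
    then show "S (X \<otimes>\<^bsub>cstar_completion\<^esub> Y) = S (Y \<otimes>\<^bsub>cstar_completion\<^esub> X)" using x y by simp
  qed
  with const show ?thesis by blast
qed

lemma cls_const_eq: "norm2 (a - b) = 0 \<Longrightarrow> cls (\<lambda>n. a) = cls (\<lambda>n. b)"
  by (simp add: cls_eq_iff eqv_def opnorm_eq_0)

end

text \<open>
  Letters are contractions, hence so are words, and every element is a finite combination of words.
\<close>
sublocale moment_algebra \<subseteq> bounded_tracial_algebra "monomial []" fstar "moment_functional \<phi>"
proof
  show "\<exists>c\<ge>0. \<forall>y. norm2 (f * y) \<le> c * norm2 y" for f
  proof (induction f rule: free_algebra_induct)
    case zero
    then show ?case by (intro exI[of _ 0]) simp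
  next
    case (monomial x c)
    have "norm2 (monomial x c * y) \<le> cmod c * norm2 y" for y
    proof -
      have "monomial x c * y = monomial [] c * (monomial x 1 * y)" by (simp add: monomial_mult flip: mult.assoc)
      moreover have "norm2 (monomial x 1 * y) \<le> norm2 y" using word_contraction by (simp add: contraction_def)
      ultimately show ?thesis by (simp add: norm2_sc mult_left_mono)
    qed
    then show ?case by (intro exI[of _ "cmod c"]) simp
  next
    case (add f g)
    then obtain c d where cd: "c \<ge> 0" "d \<ge> 0" "\<And>y. norm2 (f * y) \<le> c * norm2 y" "\<And>y. norm2 (g * y) \<le> d * norm2 y"
      by blast
    have "norm2 ((f + g) * y) \<le> (c + d) * norm2 y" for y
      using norm2_triangle[of "f * y" "g * y"] cd(3)[of y] cd(4)[of y] by (simp add: distrib_right)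
    then show ?case using cd by (intro exI[of _ "c + d"]) simp
  qed
qed

text \<open>
  The letters become projections in the completion, because elements of 2-norm zero have operator norm
  zero.
\<close>
lemma tracial_values_of_moments:
  assumes "pair_graph G" and \<phi>: "tracial_moments (parcs G) \<phi>"
    and u: "\<And>v. v \<in> pverts G \<Longrightarrow> \<phi> [v] = complex_of_real u"
  shows "u \<in> tracial_values G"
proof -
  interpret moment_algebra "parcs G" \<phi> using \<phi> by unfold_locales
  obtain S where S: "tracial_state cstar_completion S" "\<And>a. S (cls (\<lambda>n. a)) = moment_functional \<phi> a"
    using ex_completion_state by blast
  have "tracial_rep G u cstar_completion S (\<lambda>v. cls (\<lambda>n. letter v))"
    unfolding tracial_rep_def
  proof (intro conjI completion_c_star S ballI)
    fix v assume "v \<in> pverts G"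
    then show "S (cls (\<lambda>n. letter v)) = complex_of_real u" by (simp add: S u)
    show "projection cstar_completion (cls (\<lambda>n. letter v))"
      using cls_const_eq[OF letter_idem] by (simp add: projection_def)
  next
    fix e assume "e \<in> parcs G"
    then show "case e of (v, w) \<Rightarrow> cls (\<lambda>n. letter v) \<otimes>\<^bsub>cstar_completion\<^esub> cls (\<lambda>n. letter w)
        = \<zero>\<^bsub>cstar_completion\<^esub>"
    proof clarify
      fix v w assume "(v, w) \<in> parcs G"
      then have "cls (\<lambda>n. letter v * letter w) = cls (\<lambda>n. 0)"
        by (intro cls_const_eq) (simp add: letter_orth)
      then show "cls (\<lambda>n. letter v) \<otimes>\<^bsub>cstar_completion\<^esub> cls (\<lambda>n. letter w) = \<zero>\<^bsub>cstar_completion\<^esub>"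
        by simp
    qed
  qed
  then show ?thesis by (rule tracial_values_universal[OF pair_graphD(1,2)[OF assms(1)]])
qed

section \<open>Moments of a representation\<close>
text \<open>
  The moments of the family of zero projections.
\<close>
lemma zero_moments: "tracial_moments E (\<lambda>w. if w = [] then 1 else 0)"
proof -
  have "psd (\<lambda>w :: 'a list. if w = [] then 1 else 0)"
    unfolding psd_def
  proof (intro allI)
    fix n :: nat and c :: "nat \<Rightarrow> complex" and x :: "nat \<Rightarrow> 'a list"
    let ?z = "\<Sum>i<n. if x i = [] then c i else 0"
    have "(\<Sum>i<n. \<Sum>j<n. cnj (c i) * c j * (if rev (x i) @ x j = [] then 1 else 0)) = cnj ?z * ?z"
      by (simp add: sum_product if_distrib cong: if_cong) (intro sum.cong refl, simp)
    also have "\<dots> = complex_of_real ((cmod ?z)\<^sup>2)"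
      by (simp only: complex_norm_square mult.commute)
    also have "\<dots> \<in> \<real>\<^sub>\<ge>\<^sub>0" by (simp del: of_real_power)
    finally show "(\<Sum>i<n. \<Sum>j<n. cnj (c i) * c j * (if rev (x i) @ x j = [] then 1 else 0)) \<in> \<real>\<^sub>\<ge>\<^sub>0" .
  qed
  then show ?thesis by (auto simp: tracial_moments_def)
qed

text \<open>
  The quadratic form of the kernel at coefficients \<open>c\<close> is \<open>s (X* X)\<close> for the combination \<open>X\<close> of the word operators
  with these coefficients.
\<close>
lemma moments_of_tracial_values:
  assumes G: "pair_graph G" and u: "u \<in> tracial_values G"
  shows "\<exists>\<phi>. tracial_moments (parcs G) \<phi> \<and> (\<forall>v\<in>pverts G. \<phi> [v] = complex_of_real u)"
proof -
  obtain A :: "real star_algebra" and s e where rep: "tracial_rep G u A s e"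
    using u by (auto simp: tracial_values_def)
  interpret c_star_algebra A using rep by (simp add: tracial_rep_def)
  have ts: "tracial_state A s" using rep by (simp add: tracial_rep_def)
  have s_add: "s (x \<oplus>\<^bsub>A\<^esub> y) = s x + s y" and s_comm: "s (x \<otimes>\<^bsub>A\<^esub> y) = s (y \<otimes>\<^bsub>A\<^esub> x)"
    if "x \<in> carrier A" "y \<in> carrier A" for x y
    using ts that by (auto simp: tracial_state_def)
  have s_sm: "s (c \<odot>\<^bsub>A\<^esub> x) = c * s x" and s_pos: "s (adj A x \<otimes>\<^bsub>A\<^esub> x) \<in> \<real>\<^sub>\<ge>\<^sub>0" if "x \<in> carrier A" for c x
    using ts that by (auto simp: tracial_state_def)
  have s_one: "s \<one>\<^bsub>A\<^esub> = 1" using ts by (simp add: tracial_state_def)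
  have zero: "0 \<odot>\<^bsub>A\<^esub> \<one>\<^bsub>A\<^esub> = \<zero>\<^bsub>A\<^esub>" using V.smult_l_null[of "\<one>\<^bsub>A\<^esub>"] by simp
  have s_zero: "s \<zero>\<^bsub>A\<^esub> = 0" using s_sm[of "\<one>\<^bsub>A\<^esub>" 0] by (simp add: zero)
  have adj_zero: "adj A \<zero>\<^bsub>A\<^esub> = \<zero>\<^bsub>A\<^esub>"
    using adj_smult[of "\<one>\<^bsub>A\<^esub>" 0] V.smult_l_null[of "adj A \<one>\<^bsub>A\<^esub>"] by (simp add: zero adj_closed)
  have adj_one: "adj A \<one>\<^bsub>A\<^esub> = \<one>\<^bsub>A\<^esub>"
    using adj_mult[of "adj A \<one>\<^bsub>A\<^esub>" "\<one>\<^bsub>A\<^esub>"] by (simp add: adj_adj adj_closed)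
  \<comment> \<open>letters that are not vertices are represented by zero, so that the relations hold for all letters\<close>
  define p where "p v = (if v \<in> pverts G then e v else \<zero>\<^bsub>A\<^esub>)" for v
  have proj: "projection A (p v)" for v
    using rep by (simp add: p_def tracial_rep_def) (simp add: projection_def adj_zero)
  then have p: "p v \<in> carrier A" "p v \<otimes>\<^bsub>A\<^esub> p v = p v" "adj A (p v) = p v" for v
    by (auto simp: projection_def)
  define W where "W x = foldr (\<lambda>v a. p v \<otimes>\<^bsub>A\<^esub> a) x \<one>\<^bsub>A\<^esub>" for x
  have W: "W [] = \<one>\<^bsub>A\<^esub>" "W (v # x) = p v \<otimes>\<^bsub>A\<^esub> W x" for v x
    by (simp_all add: W_def)
  have Wc: "W x \<in> carrier A" for x
    by (induction x) (simp_all add: W p)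
  have Wapp: "W (x @ y) = W x \<otimes>\<^bsub>A\<^esub> W y" for x y
    by (induction x) (simp_all add: W p Wc m_assoc)
  have Wadj: "adj A (W x) = W (rev x)" for x
    by (induction x) (simp_all add: W p Wc Wapp adj_mult adj_one)
  have "psd (\<lambda>x. s (W x))"
    unfolding psd_def
  proof (intro allI)
    fix n :: nat and c :: "nat \<Rightarrow> complex" and x :: "nat \<Rightarrow> 'a list"
    define X where "X n = rec_nat \<zero>\<^bsub>A\<^esub> (\<lambda>n a. a \<oplus>\<^bsub>A\<^esub> c n \<odot>\<^bsub>A\<^esub> W (x n)) n" for n
    have X: "X 0 = \<zero>\<^bsub>A\<^esub>" "X (Suc n) = X n \<oplus>\<^bsub>A\<^esub> c n \<odot>\<^bsub>A\<^esub> W (x n)" for n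
      by (simp_all add: X_def)
    have Xc: "X n \<in> carrier A" for n
      by (induction n) (simp_all add: X Wc)
    have right: "s (a \<otimes>\<^bsub>A\<^esub> X n) = (\<Sum>j<n. c j * s (a \<otimes>\<^bsub>A\<^esub> W (x j)))" if "a \<in> carrier A" for a n
      using that by (induction n) (simp_all add: X Xc Wc s_zero r_distr s_add smult_mult_right s_sm)
    have left: "s (adj A (X n) \<otimes>\<^bsub>A\<^esub> b) = (\<Sum>i<n. cnj (c i) * s (W (rev (x i)) \<otimes>\<^bsub>A\<^esub> b))"
      if "b \<in> carrier A" for b n
      using that by (induction n)
        (simp_all add: X Xc Wc s_zero adj_zero adj_add adj_smult adj_closed l_distr s_add smult_mult_left s_sm Wadj)
    have "s (adj A (X n) \<otimes>\<^bsub>A\<^esub> X n) = (\<Sum>i<n. \<Sum>j<n. cnj (c i) * c j * s (W (rev (x i) @ x j)))"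
      by (simp add: left right Xc Wc Wapp sum_distrib_left mult.assoc)
    then show "(\<Sum>i<n. \<Sum>j<n. cnj (c i) * c j * s (W (rev (x i) @ x j))) \<in> \<real>\<^sub>\<ge>\<^sub>0"
      using s_pos[OF Xc[of n]] by simp
  qed
  moreover have "s (W (v # w # x)) = 0" if "(v, w) \<in> parcs G" for v w x
  proof -
    have "v \<in> pverts G" "w \<in> pverts G" using pair_graphD(2)[OF G] that by auto
    then have "p v \<otimes>\<^bsub>A\<^esub> p w = \<zero>\<^bsub>A\<^esub>" using rep that by (auto simp: p_def tracial_rep_def)
    then have "W (v # w # x) = \<zero>\<^bsub>A\<^esub>" using p Wc by (simp add: W flip: m_assoc)
    then show ?thesis by (simp add: s_zero)
  qed
  moreover have "W (v # v # x) = W (v # x)" for v x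
    using p Wc by (simp add: W flip: m_assoc)
  moreover have "s (W (x @ y)) = s (W (y @ x))" for x y
    using s_comm Wc by (simp add: Wapp)
  ultimately have "tracial_moments (parcs G) (\<lambda>x. s (W x))"
    by (auto simp: tracial_moments_def W(1) s_one)
  moreover have "\<forall>v\<in>pverts G. s (W [v]) = complex_of_real u"
    using rep p by (simp add: W) (simp add: p_def tracial_rep_def)
  ultimately show ?thesis by blast
qed

section \<open>Schur products\<close>

definition psd_kernel :: "nat \<Rightarrow> (nat \<Rightarrow> nat \<Rightarrow> complex) \<Rightarrow> bool" where
  "psd_kernel n K \<longleftrightarrow> (\<forall>c. (\<Sum>i<n. \<Sum>j<n. cnj (c i) * c j * K i j) \<in> \<real>\<^sub>\<ge>\<^sub>0)"

lemma psd_kernelD: "psd_kernel n K \<Longrightarrow> (\<Sum>i<n. \<Sum>j<n. cnj (c i) * c j * K i j) \<in> \<real>\<^sub>\<ge>\<^sub>0"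
  unfolding psd_kernel_def by (erule allE)

lemma psd_kernel_two_points:
  assumes "psd_kernel n K" "i < n" "j < n" "i \<noteq> j"
  shows "cnj a * a * K i i + cnj a * b * K i j + cnj b * a * K j i + cnj b * b * K j j \<in> \<real>\<^sub>\<ge>\<^sub>0"
proof -
  let ?c = "\<lambda>k. if k = i then a else if k = j then b else 0"
  have "(\<Sum>k<n. \<Sum>l<n. cnj (?c k) * ?c l * K k l) = (\<Sum>k\<in>{i, j}. \<Sum>l\<in>{i, j}. cnj (?c k) * ?c l * K k l)"
    using assms by (intro sum.mono_neutral_cong_right ballI) (auto intro!: sum.mono_neutral_cong_right sum.neutral)
  also have "\<dots> = cnj a * a * K i i + cnj a * b * K i j + cnj b * a * K j i + cnj b * b * K j j"
    using assms(4) by simp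
  finally show ?thesis using psd_kernelD[OF assms(1), of ?c] by (simp only:)
qed

lemma psd_kernel_diag:
  assumes "psd_kernel n K" "i < n"
  shows "K i i \<in> \<real>\<^sub>\<ge>\<^sub>0"
proof -
  let ?c = "\<lambda>k. if k = i then 1 else (0 :: complex)"
  have "(\<Sum>k<n. \<Sum>l<n. cnj (?c k) * ?c l * K k l) = (\<Sum>k\<in>{i}. \<Sum>l\<in>{i}. cnj (?c k) * ?c l * K k l)"
    using assms by (intro sum.mono_neutral_cong_right ballI) (auto intro!: sum.mono_neutral_cong_right sum.neutral)
  also have "\<dots> = K i i" by simp
  finally show ?thesis using psd_kernelD[OF assms(1), of ?c] by (simp only:)
qed

lemma psd_kernel_hermitian:
  assumes "psd_kernel n K" "i < n" "j < n"
  shows "K j i = cnj (K i j)"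
proof (cases "i = j")
  case True
  then show ?thesis
    using psd_kernel_diag[OF assms(1,2)] by (auto simp: complex_nonneg_Reals_iff complex_eq_iff)
next
  case False
  note two = psd_kernel_two_points[OF assms False] and d = psd_kernel_diag[OF assms(1)]
  show ?thesis
    using two[of 1 1] two[of 1 "\<i>"] d[OF assms(2)] d[OF assms(3)]
    by (auto simp: complex_nonneg_Reals_iff complex_eq_iff)
qed

text \<open>
  Otherwise the quadratic form at the vector with entries \<open>1\<close> at \<open>i\<close> and \<open>- r * cnj (K i j)\<close> at \<open>j\<close> would be
  negative for large \<open>r\<close>.
\<close>
lemma psd_kernel_null:
  assumes "psd_kernel n K" "i < n" "j < n" "K j j = 0"
  shows "K i j = 0"
proof (cases "i = j")
  case False
  let ?z = "K i j"
  have ineq: "0 \<le> Re (K i i) - 2 * r * (cmod ?z)\<^sup>2" for r :: real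
  proof -
    let ?t = "- complex_of_real r * cnj ?z"
    have eq: "cnj 1 * 1 * K i i + cnj 1 * ?t * K i j + cnj ?t * 1 * K j i + cnj ?t * ?t * K j j
        = K i i - complex_of_real (2 * r * (cmod ?z)\<^sup>2)"
      using assms(4) unfolding of_real_mult complex_norm_square
      by (simp add: psd_kernel_hermitian[OF assms(1-3)] mult_ac)
    then show ?thesis
      using psd_kernel_two_points[OF assms(1-3) False, of 1 ?t] unfolding eq
      by (simp add: complex_nonneg_Reals_iff del: of_real_mult of_real_power)
  qed
  show ?thesis
  proof (rule ccontr)
    assume "?z \<noteq> 0"
    then show False
      using ineq[of "(Re (K i i) + 1) / (2 * (cmod ?z)\<^sup>2)"] by (simp add: field_simps)
  qed
qed (use assms in simp)

text \<open>
  Induction on the size, by eliminating the last row and column.  The Schur complement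
  \<open>K' i j = K i j - K i n * K n j / K n n\<close> is positive semidefinite on the first \<open>n\<close> indices and vanishes on the
  last row and column, so the induction hypothesis covers its product with \<open>L\<close>.  The rest of \<open>K\<close> has
  rank one, and multiplying \<open>L\<close> with it rescales the coefficients.  If \<open>K n n = 0\<close>, the last row and column of
  \<open>K\<close> vanish already; the convention \<open>x / 0 = 0\<close> makes the same formulas cover this case.
\<close>
lemma psd_kernel_schur:
  assumes "psd_kernel n K" "psd_kernel n L"
  shows "psd_kernel n (\<lambda>i j. K i j * L i j)"
  using assms
proof (induction n arbitrary: K)
  case 0
  then show ?case by (simp add: psd_kernel_def)
next
  case (Suc n)
  let ?k = "K n n"
  define K' where "K' i j = K i j - K i n * K n j / ?k" for i j
  note herm = psd_kernel_hermitian[OF Suc.prems(1)]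
  have pos: "?k \<in> \<real>\<^sub>\<ge>\<^sub>0" by (rule psd_kernel_diag[OF Suc.prems(1)]) simp
  have border: "K' i n = 0" "K' n i = 0" if "i < Suc n" for i
    using psd_kernel_null[OF Suc.prems(1) that, of n] herm[OF that, of n] by (auto simp: K'_def)
  have "psd_kernel n K'"
    unfolding psd_kernel_def
  proof
    fix c
    define S where "S = (\<Sum>j<n. c j * K n j)"
    have cS: "cnj S = (\<Sum>i<n. cnj (c i) * K i n)"
      unfolding S_def cnj_sum using herm[of n] by (intro sum.cong) auto
    \<comment> \<open>this last coefficient minimizes the quadratic form of \<open>K\<close> over the free variable\<close>
    let ?c = "\<lambda>i. if i < n then c i else - S / ?k"
    have ck: "cnj ?k = ?k" using herm[of n n] by simp
    have "(\<Sum>i<Suc n. \<Sum>j<Suc n. cnj (?c i) * ?c j * K i j)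
       = (\<Sum>i<n. \<Sum>j<n. cnj (c i) * c j * K i j) + (\<Sum>i<n. cnj (c i) * (- S / ?k) * K i n)
         + (\<Sum>j<n. cnj (- S / ?k) * c j * K n j) + cnj (- S / ?k) * (- S / ?k) * ?k"
      by (simp add: sum.distrib sum_subtractf sum_negf)
    also have "(\<Sum>i<n. cnj (c i) * (- S / ?k) * K i n) = (- S / ?k) * cnj S"
      unfolding cS sum_distrib_left by (intro sum.cong refl) simp
    also have "(\<Sum>j<n. cnj (- S / ?k) * c j * K n j) = cnj (- S / ?k) * S"
      unfolding sum_distrib_left mult.assoc S_def ..
    also have "(\<Sum>i<n. \<Sum>j<n. cnj (c i) * c j * K i j) + (- S / ?k) * cnj S + cnj (- S / ?k) * S
        + cnj (- S / ?k) * (- S / ?k) * ?k = (\<Sum>i<n. \<Sum>j<n. cnj (c i) * c j * K i j) - cnj S * S / ?k"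
      by (simp add: ck)
    also have "cnj S * S / ?k = (\<Sum>i<n. \<Sum>j<n. cnj (c i) * c j * (K i n * K n j / ?k))"
      unfolding cS unfolding S_def sum_product sum_divide_distrib by (intro sum.cong refl) simp
    finally have "(\<Sum>i<Suc n. \<Sum>j<Suc n. cnj (?c i) * ?c j * K i j) = (\<Sum>i<n. \<Sum>j<n. cnj (c i) * c j * K' i j)"
      by (simp only: K'_def right_diff_distrib sum_subtractf)
    then show "(\<Sum>i<n. \<Sum>j<n. cnj (c i) * c j * K' i j) \<in> \<real>\<^sub>\<ge>\<^sub>0"
      using psd_kernelD[OF Suc.prems(1), of ?c] by (simp only:)
  qed
  moreover have "psd_kernel n L"
    unfolding psd_kernel_def
  proof
    fix c
    have "(\<Sum>i<Suc n. \<Sum>j<Suc n. cnj (if i < n then c i else 0) * (if j < n then c j else 0) * L i j) \<in> \<real>\<^sub>\<ge>\<^sub>0"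
      by (rule psd_kernelD[OF Suc.prems(2)])
    then show "(\<Sum>i<n. \<Sum>j<n. cnj (c i) * c j * L i j) \<in> \<real>\<^sub>\<ge>\<^sub>0" by simp
  qed
  ultimately have IH: "psd_kernel n (\<lambda>i j. K' i j * L i j)" by (rule Suc.IH)
  show ?case
    unfolding psd_kernel_def
  proof
    fix c
    define d where "d j = c j * K n j" for j
    have cd: "cnj (d i) = cnj (c i) * K i n" if "i < Suc n" for i
      using herm[of n i] that by (simp add: d_def)
    have "(\<Sum>i<Suc n. \<Sum>j<Suc n. cnj (c i) * c j * (K i j * L i j))
        = (\<Sum>i<Suc n. \<Sum>j<Suc n. cnj (c i) * c j * (K' i j * L i j) + cnj (d i) * d j * L i j / ?k)"
      by (intro sum.cong refl) (simp add: cd, simp add: K'_def d_def algebra_simps)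
    also have "\<dots> = (\<Sum>i<n. \<Sum>j<n. cnj (c i) * c j * (K' i j * L i j))
        + (\<Sum>i<Suc n. \<Sum>j<Suc n. cnj (d i) * d j * L i j) / ?k"
      by (simp add: border sum.distrib sum_divide_distrib add_divide_distrib)
    also have "\<dots> \<in> \<real>\<^sub>\<ge>\<^sub>0"
      by (intro nonneg_Reals_add_I nonneg_Reals_divide_I psd_kernelD IH Suc.prems(2) pos)
    finally show "(\<Sum>i<Suc n. \<Sum>j<Suc n. cnj (c i) * c j * (K i j * L i j)) \<in> \<real>\<^sub>\<ge>\<^sub>0" .
  qed
qed

section \<open>Operations on moments\<close>

lemma tracial_moments_mono: "tracial_moments E \<phi> \<Longrightarrow> F \<subseteq> E \<Longrightarrow> tracial_moments F \<phi>"
  unfolding tracial_moments_def by blast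

lemma psd_kernel_moments: "psd \<phi> \<Longrightarrow> psd_kernel n (\<lambda>i j. \<phi> (rev (x i) @ x j))"
  by (simp add: psd_def psd_kernel_def)

text \<open>
  The tensor product of two families of projections.
\<close>
lemma product_moments:
  assumes "tracial_moments E \<phi>" "tracial_moments F \<psi>"
  shows "tracial_moments {((g, h), (g', h')). (g, g') \<in> E \<or> (h, h') \<in> F} (\<lambda>w. \<phi> (map fst w) * \<psi> (map snd w))"
proof -
  note \<phi> = tracial_momentsD[OF assms(1)] and \<psi> = tracial_momentsD[OF assms(2)]
  have "psd (\<lambda>w. \<phi> (map fst w) * \<psi> (map snd w))"
    unfolding psd_def
  proof (intro allI)
    fix n :: nat and c :: "nat \<Rightarrow> complex" and x :: "nat \<Rightarrow> ('a \<times> 'b) list"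
    show "(\<Sum>i<n. \<Sum>j<n. cnj (c i) * c j * (\<phi> (map fst (rev (x i) @ x j)) * \<psi> (map snd (rev (x i) @ x j)))) \<in> \<real>\<^sub>\<ge>\<^sub>0"
      using psd_kernelD[OF psd_kernel_schur[OF psd_kernel_moments[OF \<phi>(5), of n "\<lambda>i. map fst (x i)"]
            psd_kernel_moments[OF \<psi>(5), of n "\<lambda>i. map snd (x i)"]], of c]
      by (simp add: rev_map)
  qed
  moreover have "\<phi> (map fst (x @ y)) * \<psi> (map snd (x @ y)) = \<phi> (map fst (y @ x)) * \<psi> (map snd (y @ x))" for x y
    using \<phi>(2)[of "map fst x" "map fst y"] \<psi>(2)[of "map snd x" "map snd y"] by simp
  ultimately show ?thesis
    unfolding tracial_moments_def by (auto simp: \<phi>(1,3,4) \<psi>(1,3,4))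
qed

text \<open>
  Words with letters outside \<open>S\<close> contribute nothing, so they may be replaced by the empty word with
  coefficient zero.
\<close>
lemma psd_restrict:
  assumes "\<And>n c x. (\<And>i. set (x i) \<subseteq> S) \<Longrightarrow> (\<Sum>i<n::nat. \<Sum>j<n. cnj (c i) * c j * \<phi> (rev (x i) @ x j)) \<in> \<real>\<^sub>\<ge>\<^sub>0"
  shows "psd (\<lambda>w. if set w \<subseteq> S then \<phi> w else 0)"
  unfolding psd_def
proof (intro allI)
  fix n :: nat and c :: "nat \<Rightarrow> complex" and x :: "nat \<Rightarrow> 'a list"
  define c' x' where "c' i = (if set (x i) \<subseteq> S then c i else 0)" and "x' i = (if set (x i) \<subseteq> S then x i else [])" for i
  have "(\<Sum>i<n. \<Sum>j<n. cnj (c i) * c j * (if set (rev (x i) @ x j) \<subseteq> S then \<phi> (rev (x i) @ x j) else 0))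
      = (\<Sum>i<n. \<Sum>j<n. cnj (c' i) * c' j * \<phi> (rev (x' i) @ x' j))"
    by (intro sum.cong refl) (auto simp: c'_def x'_def)
  also have "\<dots> \<in> \<real>\<^sub>\<ge>\<^sub>0"
  proof (rule assms)
    show "set (x' i) \<subseteq> S" for i by (cases "set (x i) \<subseteq> S") (simp_all add: x'_def)
  qed
  finally show "(\<Sum>i<n. \<Sum>j<n. cnj (c i) * c j * (if set (rev (x i) @ x j) \<subseteq> S then \<phi> (rev (x i) @ x j) else 0)) \<in> \<real>\<^sub>\<ge>\<^sub>0" .
qed

text \<open>
  Replacing the projections outside \<open>S\<close> by zero.
\<close>
lemma restrict_moments:
  assumes "tracial_moments E \<phi>"
  shows "tracial_moments E (\<lambda>w. if set w \<subseteq> S then \<phi> w else 0)"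
proof -
  note \<phi> = tracial_momentsD[OF assms]
  have "psd (\<lambda>w. if set w \<subseteq> S then \<phi> w else 0)"
    by (rule psd_restrict) (use \<phi>(5) in \<open>simp add: psd_def\<close>)
  moreover have "(if set (x @ y) \<subseteq> S then \<phi> (x @ y) else 0) = (if set (y @ x) \<subseteq> S then \<phi> (y @ x) else 0)" for x y
    using \<phi>(2)[of x y] by auto
  ultimately show ?thesis
    unfolding tracial_moments_def by (auto simp: \<phi>(1,3,4))
qed

text \<open>
  Direct sums, with the trace weighted by \<open>t\<close> and \<open>1 - t\<close>.
\<close>
lemma convex_moments:
  assumes "tracial_moments E \<phi>" "tracial_moments E \<psi>" "0 \<le> t" "t \<le> (1::real)"
  shows "tracial_moments E (\<lambda>w. of_real t * \<phi> w + of_real (1 - t) * \<psi> w)"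
proof -
  note \<phi> = tracial_momentsD[OF assms(1)] and \<psi> = tracial_momentsD[OF assms(2)]
  have "psd (\<lambda>w. of_real t * \<phi> w + of_real (1 - t) * \<psi> w)"
    unfolding psd_def
  proof (intro allI)
    fix n :: nat and c :: "nat \<Rightarrow> complex" and x :: "nat \<Rightarrow> 'a list"
    let ?S = "\<lambda>\<phi>. \<Sum>i<n. \<Sum>j<n. cnj (c i) * c j * \<phi> (rev (x i) @ x j)"
    have "?S (\<lambda>w. of_real t * \<phi> w + of_real (1 - t) * \<psi> w) = of_real t * ?S \<phi> + of_real (1 - t) * ?S \<psi>"
      by (simp add: sum_distrib_left sum.distrib distrib_left mult_ac del: of_real_diff)
    also have "\<dots> \<in> \<real>\<^sub>\<ge>\<^sub>0"
      using \<phi>(5) \<psi>(5) assms(3,4) unfolding psd_def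
      by (intro nonneg_Reals_add_I nonneg_Reals_mult_I) (auto simp del: of_real_diff)
    finally show "?S (\<lambda>w. of_real t * \<phi> w + of_real (1 - t) * \<psi> w) \<in> \<real>\<^sub>\<ge>\<^sub>0" .
  qed
  moreover have "of_real t * \<phi> (x @ y) + of_real (1 - t) * \<psi> (x @ y)
      = of_real t * \<phi> (y @ x) + of_real (1 - t) * \<psi> (y @ x)" for x y
    using \<phi>(2)[of x y] \<psi>(2)[of x y] by simp
  ultimately show ?thesis
    unfolding tracial_moments_def by (auto simp: \<phi>(1,3,4) \<psi>(1,3,4) simp flip: distrib_right of_real_add)
qed

text \<open>
  Treat the letters one after the other: mixing with weight \<open>t = u / q v\<close> the given family and the one in
  which the projection of \<open>v\<close> is replaced by zero multiplies the trace of this projection by \<open>t\<close> and leaves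
  the other traces unchanged.
\<close>
lemma thin_moments:
  assumes "finite V" "tracial_moments E \<phi>" "0 \<le> u"
    and "\<And>v. v \<in> V \<Longrightarrow> \<phi> [v] = of_real (q v)" "\<And>v. v \<in> V \<Longrightarrow> u \<le> q v"
  shows "\<exists>\<psi>. tracial_moments E \<psi> \<and> (\<forall>v\<in>V. \<psi> [v] = of_real u)"
proof -
  have "\<exists>\<psi>. tracial_moments E \<psi> \<and> (\<forall>v\<in>S. \<psi> [v] = of_real u) \<and> (\<forall>v. v \<notin> S \<longrightarrow> \<psi> [v] = \<phi> [v])"
    if "finite S" "S \<subseteq> V" for S
    using that
  proof (induction S rule: finite_induct)
    case empty
    then show ?case using assms(2) by auto
  next
    case (insert a S)
    then obtain \<psi> where \<psi>: "tracial_moments E \<psi>" "\<forall>v\<in>S. \<psi> [v] = of_real u" "\<forall>v. v \<notin> S \<longrightarrow> \<psi> [v] = \<phi> [v]"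
      by auto
    have qa: "u \<le> q a" "\<psi> [a] = of_real (q a)" using assms(4,5)[of a] insert \<psi> by auto
    define t where "t = (if q a = 0 then 1 else u / q a)"
    have t: "0 \<le> t" "t \<le> 1" "t * q a = u" using qa(1) assms(3) by (auto simp: t_def divide_simps)
    define \<rho> where "\<rho> w = of_real t * \<psi> w + of_real (1 - t) * (if set w \<subseteq> - {a} then \<psi> w else 0)" for w
    have "tracial_moments E \<rho>"
      unfolding \<rho>_def by (rule convex_moments[OF \<psi>(1) restrict_moments[OF \<psi>(1)] t(1,2)])
    moreover have new: "\<rho> [a] = of_real u" using qa(2) t(3) by (simp add: \<rho>_def flip: of_real_mult)
    moreover have old: "\<rho> [v] = \<psi> [v]" if "v \<noteq> a" for v using that by (simp add: \<rho>_def left_diff_distrib)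
    have "\<rho> [v] = of_real u" if "v \<in> insert a S" for v
      using that new old[of v] \<psi>(2) by (cases "v = a") auto
    moreover have "\<rho> [v] = \<phi> [v]" if "v \<notin> insert a S" for v
      using that old[of v] \<psi>(3) by auto
    ultimately show ?case by (intro exI[of _ \<rho>]) blast
  qed
  from this[OF assms(1)] show ?thesis by blast
qed

section \<open>Joins of projections\<close>

lemma one_minus_power:
  fixes b :: "'a::ring_1"
  shows "\<exists>q. 1 - b ^ n = q * (1 - b) \<and> 1 - b ^ n = (1 - b) * q"
proof (induction n)
  case 0
  show ?case by (rule exI[of _ "0 :: 'a"]) simp
next
  case (Suc n)
  then obtain q where q: "1 - b ^ n = q * (1 - b)" "1 - b ^ n = (1 - b) * q" by blast
  have "1 - b ^ Suc n = (1 - b ^ n) + b ^ n * (1 - b)" "b ^ n * (1 - b) = (1 - b) * b ^ n"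
    by (simp_all add: algebra_simps power_commutes)
  then show ?case using q by (intro exI[of _ "q + b ^ n"]) (metis distrib_left distrib_right)
qed

context tracial_algebra
begin

lemma norm2_sum_eq_0: "(\<And>i. i \<in> I \<Longrightarrow> norm2 (f i) = 0) \<Longrightarrow> norm2 (sum f I) = 0"
proof (induction I rule: infinite_finite_induct)
  case (insert i I)
  then show ?case using norm2_triangle[of "f i" "sum f I"] norm2_nonneg[of "f i + sum f I"] by simp
qed simp_all

lemma effect_power_diff_null:
  assumes "effect b"
  shows "(\<lambda>n. norm2 (b ^ (2 * n) - b ^ n)) \<longlonglongrightarrow> 0"
proof (rule LIMSEQ_I)
  fix r :: real assume "0 < r"
  then obtain M where "\<forall>m\<ge>M. \<forall>n\<ge>M. norm2 (b ^ m - b ^ n) < r"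
    using norm2_cauchyD[OF effect_power_norm2_cauchy[OF assms]] by blast
  then have "\<forall>n\<ge>M. norm (norm2 (b ^ (2 * n) - b ^ n) - 0) < r" by simp
  then show "\<exists>no. \<forall>n\<ge>no. norm (norm2 (b ^ (2 * n) - b ^ n) - 0) < r" by blast
qed

end

text \<open>
  For a fixed first index \<open>g\<close>, the letters \<open>(g, h)\<close> with \<open>h \<in> B\<close> form a block, whose join is to be
  constructed.
\<close>
locale projection_blocks = moment_algebra E \<phi>
  for E :: "(('v \<times> 'w) \<times> ('v \<times> 'w)) set" and \<phi> +
  fixes B :: "'w set"
  assumes fin: "finite B" and nonempty: "B \<noteq> {}"
begin

text \<open>
  An effect whose eigenspace for the eigenvalue \<open>1\<close> is the common kernel of the block, that is, the
  complement of the join; its powers converge to the projection onto this kernel.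
\<close>
definition defect :: "'v \<Rightarrow> ('v \<times> 'w) free_algebra" where
  "defect g = monomial [] (1 / of_nat (card B)) * (\<Sum>h\<in>B. 1 - letter (g, h))"

lemma defect_effect: "effect (defect g)"
  unfolding defect_def by (rule effect_mean[OF fin nonempty effect_compl[OF letter_effect]])

lemma one_minus_defect: "1 - defect g = monomial [] (1 / of_nat (card B)) * (\<Sum>h\<in>B. letter (g, h))"
proof -
  have of_nat: "monomial [] (of_nat n) = (of_nat n :: ('v \<times> 'w) free_algebra)" for n
    by (induction n) (simp_all add: sc_add)
  have "monomial [] (1 / of_nat (card B)) * (of_nat (card B) :: ('v \<times> 'w) free_algebra) = 1"
    using fin nonempty unfolding of_nat[symmetric] by (simp add: monomial_mult)
  then show ?thesis by (simp add: defect_def sum_subtractf right_diff_distrib)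
qed

text \<open>
  \<open>1 - b\<^sup>n\<close> is a multiple of \<open>1 - b\<close> on either side, and \<open>1 - b\<close> is a multiple of the sum of the
  block, so products of orthogonal blocks vanish.
\<close>
lemma defect_orth:
  assumes "\<forall>h\<in>B. \<forall>h'\<in>B. ((g, h), (g', h')) \<in> E"
  shows "norm2 ((1 - defect g ^ n) * (1 - defect g' ^ n)) = 0"
proof -
  let ?m = "monomial [] (1 / of_nat (card B)) :: ('v \<times> 'w) free_algebra"
  have "(1 - defect g) * (1 - defect g') = ?m * (?m * (\<Sum>h\<in>B. \<Sum>h'\<in>B. letter (g, h) * letter (g', h')))"
    unfolding one_minus_defect by (simp add: sum_product mult.assoc sc_left_commute[of "sum _ _"])
  moreover have "norm2 (\<Sum>h\<in>B. \<Sum>h'\<in>B. letter (g, h) * letter (g', h')) = 0"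
    using assms by (intro norm2_sum_eq_0 letter_orth) auto
  ultimately have null: "norm2 ((1 - defect g) * (1 - defect g')) = 0"
    by (simp add: norm2_mult_eq_0)
  obtain q q' where "1 - defect g ^ n = q * (1 - defect g)" "1 - defect g' ^ n = (1 - defect g') * q'"
    using one_minus_power by metis
  then have "(1 - defect g ^ n) * (1 - defect g' ^ n) = q * ((1 - defect g) * (1 - defect g')) * q'"
    by (simp add: mult.assoc)
  then show ?thesis using null by (simp add: norm2_mult_eq_0)
qed

lemma join_moments:
  "\<exists>\<psi>. tracial_moments {(g, g'). \<forall>h\<in>B. \<forall>h'\<in>B. ((g, h), (g', h')) \<in> E} \<psi>
     \<and> (\<forall>g. (\<lambda>n. moment_functional \<phi> (1 - defect g ^ n)) \<longlonglongrightarrow> \<psi> [g])"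
proof -
  let ?f = "\<lambda>n g. 1 - defect g ^ n"
  have eff: "effect (?f n g)" for n g by (intro effect_compl effect_power defect_effect)
  have "\<exists>\<psi>. tracial_moments {(g, g'). \<forall>h\<in>B. \<forall>h'\<in>B. ((g, h), (g', h')) \<in> E} \<psi>
     \<and> (\<forall>w. (\<lambda>n. moment_functional \<phi> (prod_list (map (?f n) w))) \<longlonglongrightarrow> \<psi> w)"
  proof (rule limit_moments)
    show "fstar (?f n g) = ?f n g" for n g using eff by (rule effect_pos)
    show "contraction (?f n g)" for n g using eff by (rule effect_contraction)
    show "norm2_cauchy (\<lambda>n. ?f n g)" for g
      using effect_power_norm2_cauchy[OF defect_effect[of g]] by (simp add: norm2_cauchy_def norm2_diff_commute)
    have "?f n g * ?f n g - ?f n g = defect g ^ (2 * n) - defect g ^ n" for n g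
      by (simp add: left_diff_distrib right_diff_distrib mult_2 power_add)
    then show "(\<lambda>n. norm2 (?f n g * ?f n g - ?f n g)) \<longlonglongrightarrow> 0" for g
      using effect_power_diff_null[OF defect_effect[of g]] by simp
  qed (use defect_orth in auto)
  then obtain \<psi> where \<psi>: "tracial_moments {(g, g'). \<forall>h\<in>B. \<forall>h'\<in>B. ((g, h), (g', h')) \<in> E} \<psi>"
    "\<And>w. (\<lambda>n. moment_functional \<phi> (prod_list (map (?f n) w))) \<longlonglongrightarrow> \<psi> w" by blast
  show ?thesis using \<psi>(1) \<psi>(2)[of "[g]" for g] by (intro exI[of _ \<psi>]) simp
qed

lemma letter_le_defect:
  assumes "h \<in> B"
  shows "(norm2 (letter (g, h) * y))\<^sup>2
    \<le> real (card B) * Re (moment_functional \<phi> (fstar y * (1 - defect g) * y))"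
proof -
  let ?s = "moment_functional \<phi>" and ?e = "\<lambda>h. letter (g, h)"
  have pos: "0 \<le> Re (?s (fstar y * ?e h * y))" for h
    using effect_pos(2)[OF letter_effect] by (simp add: complex_nonneg_Reals_iff)
  have star: "fstar (?e h) = ?e h" by simp
  have "fstar (?e h * y) * (?e h * y) - fstar y * ?e h * y = fstar y * (?e h * ?e h - ?e h) * y"
    by (simp add: star_mult algebra_simps)
  moreover have "?s (fstar y * (?e h * ?e h - ?e h) * y) = 0"
    using s_le_norm2[of "fstar y * (?e h * ?e h - ?e h) * y"] norm2_mult_eq_0[OF letter_idem]
      norm2_mult_eq_0(1)[OF norm2_mult_eq_0(2)[OF letter_idem]] by (metis norm_le_zero_iff)
  ultimately have "complex_of_real ((norm2 (?e h * y))\<^sup>2) = ?s (fstar y * ?e h * y)"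
    unfolding s_star_mult_self[symmetric] by (metis s_diff right_minus_eq)
  from arg_cong[OF this, of Re] have "(norm2 (?e h * y))\<^sup>2 = Re (?s (fstar y * ?e h * y))"
    by (simp del: of_real_power)
  also have "\<dots> \<le> (\<Sum>h\<in>B. Re (?s (fstar y * ?e h * y)))"
    by (rule member_le_sum) (use assms fin pos in auto)
  also have "\<dots> = real (card B) * Re (?s (fstar y * (1 - defect g) * y))"
  proof -
    have "fstar y * (1 - defect g) * y = monomial [] (1 / of_nat (card B)) * (\<Sum>h\<in>B. fstar y * ?e h * y)"
      unfolding one_minus_defect
      by (simp add: sum_distrib_left sum_distrib_right mult.assoc sc_left_commute[of "fstar y"])
    then have "?s (fstar y * (1 - defect g) * y) = (\<Sum>h\<in>B. ?s (fstar y * ?e h * y)) / of_nat (card B)"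
      by (simp only: s_sc s_sum) simp
    then show ?thesis using fin nonempty by simp
  qed
  finally show ?thesis .
qed

text \<open>
  In the limit this says that the join acts as the identity on each projection of the block.  The sum
  of the block is a multiple of \<open>1 - b\<close>, so the squared 2-norm is bounded by a multiple of
  \<open>s (b\<^sup>2\<^sup>n) - s (b\<^sup>2\<^sup>n\<^sup>+\<^sup>1)\<close>, and the two traces have the same limit.
\<close>
lemma letter_defect_null:
  assumes "h \<in> B"
  shows "(\<lambda>n. norm2 (defect g ^ n * letter (g, h))) \<longlonglongrightarrow> 0"
proof -
  let ?b = "defect g" and ?s = "moment_functional \<phi>"
  note b = effect_pos(1)[OF defect_effect[of g]]
  obtain t where t: "(\<lambda>n. ?s (?b ^ n)) \<longlonglongrightarrow> complex_of_real t"
    using effect_power_trace_converges[OF defect_effect] by blast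
  have bound: "(norm2 (?b ^ n * letter (g, h)))\<^sup>2
      \<le> real (card B) * Re (?s (?b ^ (2 * n)) - ?s (?b ^ (2 * n + 1)))" for n
  proof -
    have "norm2 (?b ^ n * letter (g, h)) = norm2 (letter (g, h) * ?b ^ n)"
      using norm2_star[of "letter (g, h) * ?b ^ n"] by (simp add: star_mult star_power b)
    moreover have "fstar (?b ^ n) * (1 - ?b) * ?b ^ n = ?b ^ (2 * n) - ?b ^ (2 * n + 1)"
      by (simp add: star_power b mult_2 power_add left_diff_distrib right_diff_distrib mult.assoc power_commutes)
    ultimately show ?thesis using letter_le_defect[OF assms, of g "?b ^ n"] by (simp only: s_diff)
  qed
  have lim: "(\<lambda>n. real (card B) * Re (?s (?b ^ (2 * n)) - ?s (?b ^ (2 * n + 1)))) \<longlonglongrightarrow> 0"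
  proof -
    have "(\<lambda>n. ?s (?b ^ (2 * n))) \<longlonglongrightarrow> complex_of_real t"
      using LIMSEQ_subseq_LIMSEQ[OF t, of "\<lambda>n. 2 * n"] by (simp add: strict_mono_def comp_def)
    moreover have "(\<lambda>n. ?s (?b ^ (2 * n + 1))) \<longlonglongrightarrow> complex_of_real t"
      using LIMSEQ_subseq_LIMSEQ[OF t, of "\<lambda>n. 2 * n + 1"] by (simp add: strict_mono_def comp_def)
    ultimately have "(\<lambda>n. real (card B) * Re (?s (?b ^ (2 * n)) - ?s (?b ^ (2 * n + 1))))
        \<longlonglongrightarrow> real (card B) * Re (complex_of_real t - complex_of_real t)"
      by (intro tendsto_intros)
    then show ?thesis by simp
  qed
  have "(\<lambda>n. (norm2 (?b ^ n * letter (g, h)))\<^sup>2) \<longlonglongrightarrow> 0"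
    by (rule Lim_null_comparison[OF _ lim], rule always_eventually)
      (simp only: real_norm_def abs_power2 bound simp_thms)
  from tendsto_real_sqrt[OF this] show ?thesis by simp
qed

text \<open>
  The moments of the block in the corner of its join \<open>p\<close>, whose unit is \<open>p\<close>: the empty word stands
  for \<open>p\<close>, and the trace is divided by \<open>q\<close>, the trace of \<open>p\<close>.  Positivity is the limit of the positivity of Gram
  matrices in which \<open>p\<close> is replaced by \<open>1 - b\<^sup>n\<close>.
\<close>
lemma corner_moments:
  assumes q: "(\<lambda>n. moment_functional \<phi> (1 - defect g ^ n)) \<longlonglongrightarrow> complex_of_real q" "0 < q"
  shows "\<exists>\<psi>. tracial_moments {(h, h'). ((g, h), (g, h')) \<in> E} \<psi> \<and> (\<forall>h\<in>B. \<psi> [h] = \<phi> [(g, h)] / of_real q)"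
proof -
  let ?b = "defect g" and ?s = "moment_functional \<phi>"
  let ?w = "map (Pair g)"
  note \<phi> = tracial_momentsD[OF moments]
  define \<theta> where "\<theta> w = (if w = [] then 1 else \<phi> (?w w) / of_real q)" for w
  define a where "a n w = (if w = [] then 1 - ?b ^ n else monomial (?w w) 1)" for n w
  have eff: "effect (1 - ?b ^ n)" for n by (intro effect_compl effect_power defect_effect)
  have unit: "(\<lambda>n. ?s ((1 - ?b ^ n) * monomial (?w w) 1)) \<longlonglongrightarrow> \<phi> (?w w)" if "w \<noteq> []" "set w \<subseteq> B" for w
  proof -
    obtain h z where hz: "w = h # z" "h \<in> B" using \<open>w \<noteq> []\<close> \<open>set w \<subseteq> B\<close> by (cases w) auto
    have "(\<lambda>n. ?s (?b ^ n * monomial (?w w) 1)) \<longlonglongrightarrow> 0"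
    proof (rule Lim_null_comparison)
      have "cmod (?s (?b ^ n * monomial (?w w) 1)) \<le> norm2 (?b ^ n * letter (g, h))" for n
      proof -
        have eq: "?b ^ n * monomial (?w w) 1 = ?b ^ n * letter (g, h) * monomial (?w z) 1"
          by (simp add: hz mult.assoc monomial_mult)
        have "cmod (?s (?b ^ n * monomial (?w w) 1)) \<le> norm2 (?b ^ n * letter (g, h) * monomial (?w z) 1)"
          unfolding eq by (rule s_le_norm2)
        also have "\<dots> \<le> norm2 (?b ^ n * letter (g, h))"
          using word_contraction[of "?w z"] unfolding contraction_def by blast
        finally show ?thesis .
      qed
      then show "\<forall>\<^sub>F n in sequentially. cmod (?s (?b ^ n * monomial (?w w) 1)) \<le> norm2 (?b ^ n * letter (g, h))" by simp
    qed (rule letter_defect_null[OF hz(2)])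
    from tendsto_diff[OF tendsto_const[of "\<phi> (?w w)"] this] show ?thesis
      by (simp add: left_diff_distrib s_diff)
  qed
  have lim: "(\<lambda>n. ?s (fstar (a n x) * a n y)) \<longlonglongrightarrow> of_real q * \<theta> (rev x @ y)"
    if "set x \<subseteq> B" "set y \<subseteq> B" for x y
  proof (cases "x = []")
    case x: True
    show ?thesis
    proof (cases "y = []")
      case True
      have sq: "fstar (1 - ?b ^ n) * (1 - ?b ^ n) = (1 - ?b ^ n) + (1 - ?b ^ n) - (1 - ?b ^ (2 * n))" for n
        using effect_pos(1)[OF eff] by (simp add: left_diff_distrib right_diff_distrib mult_2 power_add)
      have "(\<lambda>n. ?s (1 - ?b ^ (2 * n))) \<longlonglongrightarrow> complex_of_real q"
        using LIMSEQ_subseq_LIMSEQ[OF q(1), of "\<lambda>n. 2 * n"] by (simp add: strict_mono_def comp_def)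
      from tendsto_diff[OF tendsto_add[OF q(1) q(1)] this]
      have "(\<lambda>n. ?s (fstar (1 - ?b ^ n) * (1 - ?b ^ n))) \<longlonglongrightarrow> of_real q + of_real q - of_real q"
        unfolding sq s_diff[of "p + p'" for p p'] s_add .
      then show ?thesis using x True by (simp add: a_def \<theta>_def)
    next
      case False
      then show ?thesis
        using x unit[OF False that(2)] effect_pos(1)[OF eff] q(2) by (simp add: a_def \<theta>_def)
    qed
  next
    case x: False
    show ?thesis
    proof (cases "y = []")
      case True
      have "?s (fstar (a n x) * a n y) = ?s ((1 - ?b ^ n) * monomial (?w (rev x)) 1)" for n
        using x True s_comm[of "monomial (?w (rev x)) 1" "1 - ?b ^ n"] by (simp add: a_def rev_map)
      then show ?thesis using unit[of "rev x"] x that True q(2) by (simp add: \<theta>_def)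
    next
      case False
      then show ?thesis using x q(2) by (simp add: a_def \<theta>_def monomial_mult rev_map)
    qed
  qed
  have "psd (\<lambda>w. if set w \<subseteq> B then \<theta> w else 0)"
  proof (rule psd_restrict)
    fix n :: nat and c :: "nat \<Rightarrow> complex" and x :: "nat \<Rightarrow> 'w list"
    assume x: "\<And>i. set (x i) \<subseteq> B"
    let ?S = "\<Sum>i<n. \<Sum>j<n. cnj (c i) * c j * \<theta> (rev (x i) @ x j)"
    have "(\<Sum>i<n. \<Sum>j<n. cnj (c i) * c j * (of_real q * \<theta> (rev (x i) @ x j))) \<in> \<real>\<^sub>\<ge>\<^sub>0"
    proof (rule Lim_in_closed_set)
      show "(\<lambda>k. \<Sum>i<n. \<Sum>j<n. cnj (c i) * c j * ?s (fstar (a k (x i)) * a k (x j)))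
          \<longlonglongrightarrow> (\<Sum>i<n. \<Sum>j<n. cnj (c i) * c j * (of_real q * \<theta> (rev (x i) @ x j)))"
        by (intro tendsto_intros lim x)
      show "\<forall>\<^sub>F k in sequentially. (\<Sum>i<n. \<Sum>j<n. cnj (c i) * c j * ?s (fstar (a k (x i)) * a k (x j))) \<in> \<real>\<^sub>\<ge>\<^sub>0"
        by (intro always_eventually allI psd_gram)
    qed simp_all
    also have "(\<Sum>i<n. \<Sum>j<n. cnj (c i) * c j * (of_real q * \<theta> (rev (x i) @ x j))) = of_real q * ?S"
      by (simp add: sum_distrib_left mult_ac)
    finally have "of_real q * ?S / of_real q \<in> \<real>\<^sub>\<ge>\<^sub>0"
      by (rule nonneg_Reals_divide_I) (use q(2) in simp)
    then show "?S \<in> \<real>\<^sub>\<ge>\<^sub>0" using q(2) by simp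
  qed
  moreover have "\<theta> (x @ y) = \<theta> (y @ x)" for x y
    using \<phi>(2)[of "?w x" "?w y"] by (auto simp: \<theta>_def)
  ultimately have "tracial_moments {(h, h'). ((g, h), (g, h')) \<in> E} (\<lambda>w. if set w \<subseteq> B then \<theta> w else 0)"
    unfolding tracial_moments_def by (auto simp: \<theta>_def \<phi>(3,4))
  moreover have "\<forall>h\<in>B. (if set [h] \<subseteq> B then \<theta> [h] else 0) = \<phi> [(g, h)] / of_real q"
    by (simp add: \<theta>_def)
  ultimately show ?thesis by blast
qed

text \<open>
  The join dominates the mean of the block, which has trace \<open>u\<close>; in terms of \<open>b\<close>, the traces of
  \<open>b\<^sup>n\<close> for \<open>n \<ge> 1\<close> are at most \<open>1 - u\<close>.
\<close>
lemma ex_join_trace: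
  assumes u: "\<And>h. h \<in> B \<Longrightarrow> \<phi> [(g, h)] = complex_of_real u" "0 < u"
  shows "\<exists>q>0. (\<lambda>n. moment_functional \<phi> (1 - defect g ^ n)) \<longlonglongrightarrow> complex_of_real q"
proof -
  let ?b = "defect g" and ?s = "moment_functional \<phi>"
  obtain t where t: "(\<lambda>n. ?s (?b ^ n)) \<longlonglongrightarrow> complex_of_real t"
    using effect_power_trace_converges[OF defect_effect] by blast
  have "?s (1 - ?b) = complex_of_real u"
    unfolding one_minus_defect using u(1) fin nonempty by (simp add: s_sc s_sum)
  then have b1: "?s ?b = complex_of_real (1 - u)" by (simp add: s_diff algebra_simps)
  have dec: "decseq (\<lambda>n. Re (?s (?b ^ n)))"
    by (rule decseq_SucI)
      (use effect_power_decreasing[OF defect_effect, of 1] in \<open>auto simp: complex_nonneg_Reals_iff s_diff\<close>)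
  have "Re (?s (?b ^ n)) \<le> 1 - u" if "n \<ge> 1" for n
    using decseqD[OF dec that] by (simp add: b1 del: of_real_diff)
  then have "\<forall>\<^sub>F n in sequentially. Re (?s (?b ^ n)) \<le> 1 - u"
    unfolding eventually_sequentially by blast
  then have "t \<le> 1 - u"
    using tendsto_upperbound[OF tendsto_Re[OF t], of "1 - u"] by simp
  moreover have "(\<lambda>n. ?s (1 - ?b ^ n)) \<longlonglongrightarrow> complex_of_real (1 - t)"
    using tendsto_diff[OF tendsto_const[of 1] t] by (simp add: s_diff)
  ultimately show ?thesis using u(2) by (intro exI[of _ "1 - t"]) simp
qed

end

section \<open>Tracial values of products\<close>

lemma tracial_values_iff_moments:
  assumes "pair_graph G"
  shows "u \<in> tracial_values G
    \<longleftrightarrow> (\<exists>\<phi>. tracial_moments (parcs G) \<phi> \<and> (\<forall>v\<in>pverts G. \<phi> [v] = complex_of_real u))"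
  using moments_of_tracial_values[OF assms] tracial_values_of_moments[OF assms] by blast

lemma zero_in_tracial_values: "pair_graph G \<Longrightarrow> 0 \<in> tracial_values G"
  using zero_moments by (force simp: tracial_values_iff_moments)

lemma tracial_values_no_verts: "pair_graph G \<Longrightarrow> pverts G = {} \<Longrightarrow> tracial_values G = UNIV"
  using zero_moments by (force simp: tracial_values_iff_moments)

lemma tracial_values_le_1:
  assumes "pair_graph G" "pverts G \<noteq> {}" "u \<in> tracial_values G"
  shows "u \<le> 1"
proof -
  obtain \<phi> v where \<phi>: "tracial_moments (parcs G) \<phi>" "\<phi> [v] = complex_of_real u"
    using assms by (auto simp: tracial_values_iff_moments)
  interpret moment_algebra "parcs G" \<phi> using \<phi>(1) by unfold_locales
  have "cmod (moment_functional \<phi> (letter v)) \<le> norm2 (letter v)" by (rule s_le_norm2)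
  also have "\<dots> \<le> 1"
    using effect_contraction[OF letter_effect[of v]] norm2_1 unfolding contraction_def by (metis mult_1_right)
  finally show ?thesis using \<phi>(2) by simp
qed

lemma tracial_values_disj_product:
  assumes "pair_graph G" "pair_graph H" "u \<in> tracial_values G" "v \<in> tracial_values H"
  shows "u * v \<in> tracial_values (disj_product G H)"
proof -
  obtain \<phi> \<psi> where \<phi>: "tracial_moments (parcs G) \<phi>" "\<forall>g\<in>pverts G. \<phi> [g] = complex_of_real u"
    and \<psi>: "tracial_moments (parcs H) \<psi>" "\<forall>h\<in>pverts H. \<psi> [h] = complex_of_real v"
    using assms by (auto simp: tracial_values_iff_moments)
  have "tracial_moments (parcs (disj_product G H)) (\<lambda>w. \<phi> (map fst w) * \<psi> (map snd w))"
    by (rule tracial_moments_mono[OF product_moments[OF \<phi>(1) \<psi>(1)]]) (auto simp: disj_product_def)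
  moreover have "\<forall>p\<in>pverts (disj_product G H). \<phi> (map fst [p]) * \<psi> (map snd [p]) = complex_of_real (u * v)"
    using \<phi>(2) \<psi>(2) by (auto simp: disj_product_def)
  ultimately show ?thesis
    unfolding tracial_values_iff_moments[OF pair_graph_disj_product[OF assms(1,2)]] by blast
qed

lemma tracial_values_disj_lex:
  assumes "pair_graph G" "pair_graph H" "u \<in> tracial_values (disj_product G H)"
  shows "u \<in> tracial_values (lex_product G H)"
proof -
  obtain \<phi> where \<phi>: "tracial_moments (parcs (disj_product G H)) \<phi>"
    "\<forall>p\<in>pverts (disj_product G H). \<phi> [p] = complex_of_real u"
    using assms(3) unfolding tracial_values_iff_moments[OF pair_graph_disj_product[OF assms(1,2)]] by blast
  have "tracial_moments (parcs (lex_product G H)) \<phi>"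
    by (rule tracial_moments_mono[OF \<phi>(1)]) (auto simp: disj_product_def lex_product_def)
  moreover have "pverts (lex_product G H) = pverts (disj_product G H)"
    by (simp add: disj_product_def lex_product_def)
  ultimately show ?thesis
    unfolding tracial_values_iff_moments[OF pair_graph_lex_product[OF assms(1,2)]] using \<phi>(2) by auto
qed

text \<open>
  Joins represent \<open>G\<close> and corners represent \<open>H\<close>: if \<open>q\<close> is the trace of the join of the block of \<open>g\<close>, the
  corner shows \<open>u / q \<le> r'\<close>.  So all joins have trace at least \<open>u / r'\<close>, and thinning them to exactly this
  trace shows \<open>u / r' \<le> r\<close>.
\<close>
lemma tracial_values_lex_product_le:
  assumes G: "pair_graph G" and H: "pair_graph H" and ne: "pverts G \<noteq> {}" "pverts H \<noteq> {}"
    and u: "u \<in> tracial_values (lex_product G H)"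
    and bG: "\<And>x. x \<in> tracial_values G \<Longrightarrow> x \<le> r" and bH: "\<And>y. y \<in> tracial_values H \<Longrightarrow> y \<le> r'"
  shows "u \<le> r * r'"
proof (cases "u \<le> 0")
  case True
  then show ?thesis
    using bG[OF zero_in_tracial_values[OF G]] bH[OF zero_in_tracial_values[OF H]] by (meson mult_nonneg_nonneg order.trans)
next
  case False
  then have upos: "0 < u" by simp
  obtain \<phi> where \<phi>: "tracial_moments (parcs (lex_product G H)) \<phi>"
    and \<phi>u: "\<And>g h. g \<in> pverts G \<Longrightarrow> h \<in> pverts H \<Longrightarrow> \<phi> [(g, h)] = complex_of_real u"
    using u unfolding tracial_values_iff_moments[OF pair_graph_lex_product[OF G H]]
    by (auto simp: lex_product_def)
  interpret projection_blocks "parcs (lex_product G H)" \<phi> "pverts H"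
    using \<phi> pair_graphD(1)[OF H] ne(2) by unfold_locales
  obtain \<psi> where \<psi>: "tracial_moments {(g, g'). \<forall>h\<in>pverts H. \<forall>h'\<in>pverts H. ((g, h), (g', h')) \<in> parcs (lex_product G H)} \<psi>"
    and \<psi>lim: "\<And>g. (\<lambda>n. moment_functional \<phi> (1 - defect g ^ n)) \<longlonglongrightarrow> \<psi> [g]"
    using join_moments by blast
  have \<psi>G: "tracial_moments (parcs G) \<psi>"
    by (rule tracial_moments_mono[OF \<psi>]) (use pair_graphD(2)[OF G] in \<open>auto simp: lex_product_def\<close>)
  have "\<exists>q. \<psi> [g] = complex_of_real q \<and> 0 < r' \<and> u / r' \<le> q" if g: "g \<in> pverts G" for g
  proof -
    obtain q where q: "0 < q" "(\<lambda>n. moment_functional \<phi> (1 - defect g ^ n)) \<longlonglongrightarrow> complex_of_real q"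
      using ex_join_trace[of g u] \<phi>u[OF g] upos by blast
    obtain \<theta> where \<theta>: "tracial_moments {(h, h'). ((g, h), (g, h')) \<in> parcs (lex_product G H)} \<theta>"
      "\<forall>h\<in>pverts H. \<theta> [h] = \<phi> [(g, h)] / of_real q"
      using corner_moments[OF q(2,1)] by blast
    have "tracial_moments (parcs H) \<theta>"
      by (rule tracial_moments_mono[OF \<theta>(1)]) (use pair_graphD(2)[OF H] g in \<open>auto simp: lex_product_def\<close>)
    moreover have "\<forall>h\<in>pverts H. \<theta> [h] = complex_of_real (u / q)" using \<theta>(2) \<phi>u[OF g] by simp
    ultimately have "u / q \<in> tracial_values H" unfolding tracial_values_iff_moments[OF H] by blast
    then have "u / q \<le> r'" by (rule bH)
    moreover have "0 < u / q" using upos q(1) by simp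
    ultimately have "0 < r'" by linarith
    with \<open>u / q \<le> r'\<close> have "u / r' \<le> q" using q(1) by (simp add: field_simps)
    then show ?thesis using LIMSEQ_unique[OF \<psi>lim q(2)] \<open>0 < r'\<close> by blast
  qed
  then obtain q where q: "\<And>g. g \<in> pverts G \<Longrightarrow> \<psi> [g] = complex_of_real (q g)" "\<And>g. g \<in> pverts G \<Longrightarrow> u / r' \<le> q g"
    and r': "0 < r'" using ne(1) by (metis ex_in_conv)
  have "\<exists>\<rho>. tracial_moments (parcs G) \<rho> \<and> (\<forall>g\<in>pverts G. \<rho> [g] = complex_of_real (u / r'))"
    by (rule thin_moments[OF pair_graphD(1)[OF G] \<psi>G _ q]) (use upos r' in auto)
  then have "u / r' \<in> tracial_values G" unfolding tracial_values_iff_moments[OF G] .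
  then have "u / r' \<le> r" by (rule bG)
  then show ?thesis using r' by (simp add: pos_divide_le_eq)
qed

lemma tracial_rank_no_verts:
  assumes "pair_graph G" "pverts G = {}"
  shows "tracial_rank G = 0"
proof -
  have "(SUP u\<in>UNIV. ereal u) = \<infinity>"
  proof (rule SUP_PInfty)
    show "\<exists>u\<in>UNIV. ereal (real n) \<le> ereal u" for n :: nat by (rule bexI[of _ "real n"]) simp_all
  qed
  then show ?thesis by (simp add: tracial_rank_def tracial_values_no_verts[OF assms])
qed

lemma tracial_rank_verts:
  assumes "pair_graph G" "pverts G \<noteq> {}"
  shows "tracial_rank G = inverse (ereal (Sup (tracial_values G)))"
    and "u \<in> tracial_values G \<Longrightarrow> u \<le> Sup (tracial_values G)"
proof -
  have bdd: "bdd_above (tracial_values G)"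
    using tracial_values_le_1[OF assms] by (auto intro: bdd_aboveI[of _ 1])
  show "u \<in> tracial_values G \<Longrightarrow> u \<le> Sup (tracial_values G)" by (rule cSup_upper[OF _ bdd])
  have "(SUP u\<in>tracial_values G. ereal u) \<le> 1"
    using tracial_values_le_1[OF assms] by (intro SUP_least) simp
  moreover have "0 \<le> (SUP u\<in>tracial_values G. ereal u)"
    using zero_in_tracial_values[OF assms(1)] by (intro SUP_upper2[of 0]) auto
  ultimately have "\<bar>SUP u\<in>tracial_values G. ereal u\<bar> \<noteq> \<infinity>" by auto
  then have "ereal (Sup (tracial_values G)) = (SUP u\<in>tracial_values G. ereal u)" by (rule ereal_Sup)
  then show "tracial_rank G = inverse (ereal (Sup (tracial_values G)))" by (simp add: tracial_rank_def)
qed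

theorem theorem6p12:
  fixes G :: "'v pair_pre_digraph" and H :: "'w pair_pre_digraph"
  assumes "pair_graph G" and "pair_graph H"
  shows "tracial_rank (disj_product G H) = tracial_rank (lex_product G H)
    \<and> tracial_rank (lex_product G H) = tracial_rank G * tracial_rank H"
proof -
  let ?D = "disj_product G H" and ?L = "lex_product G H"
  note D = pair_graph_disj_product[OF assms] and L = pair_graph_lex_product[OF assms]
  have verts: "pverts ?D = pverts G \<times> pverts H" "pverts ?L = pverts G \<times> pverts H"
    by (simp_all add: disj_product_def lex_product_def)
  show ?thesis
  proof (cases "pverts G = {} \<or> pverts H = {}")
    case True
    then have "pverts ?D = {}" "pverts ?L = {}" unfolding verts by auto
    moreover have "tracial_rank G = 0 \<or> tracial_rank H = 0"
      using True tracial_rank_no_verts[OF assms(1)] tracial_rank_no_verts[OF assms(2)] by blast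
    ultimately show ?thesis using tracial_rank_no_verts[OF D] tracial_rank_no_verts[OF L] by auto
  next
    case False
    then have ne: "pverts G \<noteq> {}" "pverts H \<noteq> {}" and neD: "pverts ?D \<noteq> {}" and neL: "pverts ?L \<noteq> {}"
      unfolding verts by auto
    define r r' d l where "r = Sup (tracial_values G)" and "r' = Sup (tracial_values H)"
      and "d = Sup (tracial_values ?D)" and "l = Sup (tracial_values ?L)"
    note bG = tracial_rank_verts(2)[OF assms(1) ne(1), folded r_def]
      and bH = tracial_rank_verts(2)[OF assms(2) ne(2), folded r'_def]
      and bD = tracial_rank_verts(2)[OF D neD, folded d_def]
    have ge0: "0 \<le> r" "0 \<le> r'" "0 \<le> d"
      using bG bH bD zero_in_tracial_values assms D by blast+
    have "d \<le> l"
      unfolding d_def l_def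
      using zero_in_tracial_values[OF D] tracial_values_disj_lex[OF assms] tracial_rank_verts(2)[OF L neL]
      by (intro cSup_least) auto
    moreover have "l \<le> r * r'"
      unfolding l_def
      using zero_in_tracial_values[OF L] tracial_values_lex_product_le[OF assms ne _ bG bH]
      by (intro cSup_least) auto
    moreover have "r * r' \<le> d"
    proof -
      have uv: "u * v \<le> d" if "u \<in> tracial_values G" "v \<in> tracial_values H" for u v
        by (rule bD[OF tracial_values_disj_product[OF assms that]])
      have ur: "u * r' \<le> d" if u: "u \<in> tracial_values G" for u
      proof (cases "0 < u")
        case True
        \<comment> \<open>the two suprema are taken one after the other\<close>
        have "r' \<le> d / u"
          unfolding r'_def using zero_in_tracial_values[OF assms(2)] uv[OF u] True
          by (intro cSup_least) (auto simp: field_simps)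
        then show ?thesis using True by (simp add: field_simps)
      next
        case False
        then have "u * r' \<le> 0" using ge0 by (simp add: mult_nonpos_nonneg)
        then show ?thesis using ge0 by simp
      qed
      show ?thesis
      proof (cases "r' = 0")
        case False
        then have "0 < r'" using ge0 by simp
        then have "r \<le> d / r'"
          unfolding r_def using zero_in_tracial_values[OF assms(1)] ur
          by (intro cSup_least) (auto simp: field_simps)
        then show ?thesis using \<open>0 < r'\<close> by (simp add: field_simps)
      qed (use ge0 in simp)
    qed
    ultimately have eq: "d = r * r'" "l = r * r'" by auto
    have "inverse (ereal (r * r')) = inverse (ereal r) * inverse (ereal r')"
      using ge0 by (cases "r = 0"; cases "r' = 0") auto
    then show ?thesis
      using tracial_rank_verts(1)[OF D neD] tracial_rank_verts(1)[OF L neL]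
        tracial_rank_verts(1)[OF assms(1) ne(1)] tracial_rank_verts(1)[OF assms(2) ne(2)] eq
      unfolding r_def r'_def d_def l_def by simp
  qed
qed

end
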